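(* Let $s>3/2$ and $u_0\in H^s(\mathbb{R})$. Let $f,g\in C^\infty(\mathbb{R})$ be real-valued functions and let $\gamma>0$ be a constant such that $f''\geq\gamma$ on $\mathbb{R}$. Let $T^*$ be the maximal existence time of the solution $u\in C([0,T^* );H^s(\mathbb{R}))\cap C^1([0,T^* );H^{s-1}(\mathbb{R}))$ of the Cauchy problem $$u_t+f'(u)u_x+\partial_x p*\Big[g(u)+\frac{f''(u)}{2}u_x^2\Big]=0,\qquad u(0,x)=u_0(x),\qquad p(x)=\tfrac12 e^{-|x|}.$$ Then $T^*$ is finite if at least one of the following two conditions (i) or (ii) is fulfilled. (i) There exists $c\in\mathbb{R}$ such that $m:=g(c)=\min_{\mathbb{R}} g$; the map $\phi:\mathbb{R}\to\mathbb{R}$ given by $\phi=\sqrt{\frac{g-m}{\gamma}}$ is $K$-Lipschitz for some $K$ with $0\leq K\leq 1$; and there exists $x_0\in\mathbb{R}$ such that $$u_0'(x_0)<-\frac{1}{2K}\left(\sqrt{1+8K^2}-1\right)\phi(u_0(x_0)).$$ More precisely, in this case $$T^*\leq\frac{4K}{\gamma\sqrt{4K^2u_0'(x_0)^2-\left(\sqrt{1+8K^2}-1\right)^2\phi(u_0(x_0))^2}}.$$ (ii) There exists $c\in\mathbb{R}$ such that $M:=g(c)=\max_{\mathbb{R}} g$; the map $\psi:\mathbb{R}\to\mathbb{R}$ given by $\psi=\sqrt{\frac{M-g}{\gamma}}$ is $K$-Lipschitz for some $K$ with $0\leq K\leq \frac{1}{\sqrt8}$; and there exists $x_0\in\mathbb{R}$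 such that $$u_0'(x_0)<-\frac{1}{2K}\left(1-\sqrt{1-8K^2}\right)\psi(u_0(x_0)).$$ More precisely, in this case $$T^*\leq\frac{4K}{\gamma\sqrt{4K^2u_0'(x_0)^2-\left(\sqrt{1-8K^2}-1\right)^2\psi(u_0(x_0))^2}}.$$ When $K=0$, the expressions containing $K$ in a denominator or of the form $0/0$ are understood as their limits as $K\to0^+$, i.e. in (i) and in (ii) the condition on $x_0$ reads $u_0'(x_0)<0$ and the bound reads $T^*\leq \frac{2}{\gamma|u_0'(x_0)|}$.
   Context: The Cauchy problem is the nonlocal form of the generalized hyperelastic rod equation $u_t-u_{txx}+[f(u)]_x-[f(u)]_{xxx}+\big[g(u)+\frac{f''(u)}{2}u_x^2\big]_x=0$ for $u=u(t,x)$, $t\ge0$, $x\in\mathbb{R}$. Here $*$ denotes convolution in the space variable $x$, and $\partial_x p * F=\partial_x(p*F)$. For $u_0\in H^s(\mathbb{R})$ with $s>3/2$, it is known that this problem is locally well-posed: there is $T>0$ and a unique solution $u\in C([0,T);H^s(\mathbb{R}))\cap C^1([0,T);H^{s-1}(\mathbb{R}))$. The maximal time $T^*\in(0,+\infty]$ is the supremum of all $T>0$ for which such a solution exists on $[0,T)$. A map $h:\mathbb{R}\to\mathbb{R}$ is $K$-Lipschitz if $|h(a)-h(b)|\le K|a-b|$ for all $a,b\in\mathbb{R}$. *)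

theory Defs
  imports "HOL-Analysis.Analysis"
begin

text \<open>
  The Fourier--Plancherel transform of a square-integrable real function, as a relation:
  \<open>H\<close> is the limit in the mean, as \<open>R\<close> tends to infinity, of the integrals of
  \<open>exp (- \<i> \<xi> x) * h x\<close> over \<open>-R \<le> x \<le> R\<close>.  It determines \<open>H\<close> up to null sets.
\<close>

definition has_fourier_L2 :: "(real \<Rightarrow> real) \<Rightarrow> (real \<Rightarrow> complex) \<Rightarrow> bool" where
  "has_fourier_L2 h H \<longleftrightarrow>
     h \<in> borel_measurable borel \<and> integrable lborel (\<lambda>x. (h x)\<^sup>2) \<and>
     H \<in> borel_measurable borel \<and> integrable lborel (\<lambda>\<xi>. (cmod (H \<xi>))\<^sup>2) \<and>
     ((\<lambda>R. \<integral>\<^sup>+\<xi>. ennreal ((cmod ((LINT x:{-R..R}|lborel.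
              exp (- (\<i> * complex_of_real (\<xi> * x))) * complex_of_real (h x)) - H \<xi>))\<^sup>2) \<partial>lborel)
        \<longlongrightarrow> 0) at_top"

definition fourier_L2 :: "(real \<Rightarrow> real) \<Rightarrow> real \<Rightarrow> complex" where
  "fourier_L2 h = (SOME H. has_fourier_L2 h H)"

text \<open>
  The real-valued Sobolev space \<open>H\<^sup>s(\<real>)\<close>, for \<open>s \<ge> 0\<close> only (it is taken inside \<open>L\<^sup>2\<close>).  Its elements
  here are functions, not classes modulo null sets: both predicates below are insensitive to changes
  on a null set (up to Borel measurability), and the continuous representative is selected
  explicitly where point values are needed.
\<close>

definition sobolev_space :: "real \<Rightarrow> (real \<Rightarrow> real) set" where
  "sobolev_space s = {h. \<exists>H. has_fourier_L2 h H \<and>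
     integrable lborel (\<lambda>\<xi>. (1 + \<xi>\<^sup>2) powr s * (cmod (H \<xi>))\<^sup>2)}"

definition sobolev_norm :: "real \<Rightarrow> (real \<Rightarrow> real) \<Rightarrow> real" where
  "sobolev_norm s h = sqrt (LINT \<xi>|lborel. (1 + \<xi>\<^sup>2) powr s * (cmod (fourier_L2 h \<xi>))\<^sup>2)"

text \<open>
  \<open>u \<in> C([0,T); H\<^sup>s)\<close>, where \<open>u t\<close> is the function \<open>x \<mapsto> u(t,x)\<close>; and
  \<open>u \<in> C\<^sup>1([0,T); H\<^sup>s)\<close> with time derivative \<open>v\<close> (one-sided at time 0), all limits being in the
  norm of \<open>H\<^sup>s\<close>.
\<close>

definition sobolev_C0 :: "real \<Rightarrow> real \<Rightarrow> (real \<Rightarrow> real \<Rightarrow> real) \<Rightarrow> bool" where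
  "sobolev_C0 s T u \<longleftrightarrow> (\<forall>t\<in>{0..<T}. u t \<in> sobolev_space s \<and>
     ((\<lambda>\<tau>. sobolev_norm s (\<lambda>x. u \<tau> x - u t x)) \<longlongrightarrow> 0) (at t within {0..<T}))"

definition sobolev_C1 :: "real \<Rightarrow> real \<Rightarrow> (real \<Rightarrow> real \<Rightarrow> real) \<Rightarrow> (real \<Rightarrow> real \<Rightarrow> real) \<Rightarrow> bool" where
  "sobolev_C1 s T u v \<longleftrightarrow> sobolev_C0 s T u \<and> sobolev_C0 s T v \<and>
     (\<forall>t\<in>{0..<T}. ((\<lambda>\<tau>. sobolev_norm s (\<lambda>x. (u \<tau> x - u t x) / (\<tau> - t) - v t x)) \<longlongrightarrow> 0)
        (at t within {0..<T}))"

definition smooth :: "(real \<Rightarrow> real) \<Rightarrow> bool" where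
  "smooth h \<longleftrightarrow> (\<forall>n x. (deriv ^^ n) h differentiable (at x))"

definition kernel_p :: "real \<Rightarrow> real" where
  "kernel_p x = 1 / 2 * exp (- \<bar>x\<bar>)"

definition convolution :: "(real \<Rightarrow> real) \<Rightarrow> (real \<Rightarrow> real) \<Rightarrow> real \<Rightarrow> real" where
  "convolution F G x = (LINT y|lborel. F (x - y) * G y)"

text \<open>
  For \<open>s > 3/2\<close>, solutions on \<open>[0,T)\<close> of the Cauchy problem with initial datum \<open>u0\<close>.  Each \<open>u t\<close> is
  the continuous representative of its class; it is then continuously differentiable since
  \<open>s > 3/2\<close>, so that \<open>deriv (u t) x\<close> is the classical \<open>u\<^sub>x(t,x)\<close>.  The equation is an identity in
  \<open>H\<^bsup>s-1\<^esup>\<close>, that is, almost everywhere in \<open>x\<close> for every \<open>t\<close>.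
\<close>

definition rod_solution ::
  "(real \<Rightarrow> real) \<Rightarrow> (real \<Rightarrow> real) \<Rightarrow> real \<Rightarrow> (real \<Rightarrow> real) \<Rightarrow> real \<Rightarrow> (real \<Rightarrow> real \<Rightarrow> real) \<Rightarrow> bool" where
  "rod_solution f g s u0 T u \<longleftrightarrow>
     (\<forall>t\<in>{0..<T}. continuous_on UNIV (u t)) \<and>
     sobolev_C0 s T u \<and>
     (\<forall>x. u 0 x = u0 x) \<and>
     (\<exists>v. sobolev_C1 (s - 1) T u v \<and>
        (\<forall>t\<in>{0..<T}. AE x in lborel.
           v t x + deriv f (u t x) * deriv (u t) x
             + deriv (convolution kernel_p
                 (\<lambda>y. g (u t y) + deriv (deriv f) (u t y) / 2 * (deriv (u t) y)\<^sup>2)) x = 0))"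

definition max_time :: "(real \<Rightarrow> real) \<Rightarrow> (real \<Rightarrow> real) \<Rightarrow> real \<Rightarrow> (real \<Rightarrow> real) \<Rightarrow> ennreal" where
  "max_time f g s u0 = (SUP T\<in>{T. 0 < T \<and> (\<exists>u. rod_solution f g s u0 T u)}. ennreal T)"

text \<open>
  Blow-up conditions and lifespan bounds, at a minimum, respectively maximum, point \<open>c\<close> of \<open>g\<close>.
  For \<open>K = 0\<close> the formulas are replaced by their limits as \<open>K\<close> decreases to 0.
\<close>

definition phi :: "(real \<Rightarrow> real) \<Rightarrow> real \<Rightarrow> real \<Rightarrow> real \<Rightarrow> real" where
  "phi g \<gamma> c v = sqrt ((g v - g c) / \<gamma>)"

definition psi :: "(real \<Rightarrow> real) \<Rightarrow> real \<Rightarrow> real \<Rightarrow> real \<Rightarrow> real" where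
  "psi g \<gamma> c v = sqrt ((g c - g v) / \<gamma>)"

definition condition_i ::
  "(real \<Rightarrow> real) \<Rightarrow> real \<Rightarrow> (real \<Rightarrow> real) \<Rightarrow> real \<Rightarrow> real \<Rightarrow> real \<Rightarrow> bool" where
  "condition_i g \<gamma> u0 c K x0 \<longleftrightarrow>
     (\<forall>v. g c \<le> g v) \<and>
     0 \<le> K \<and> K \<le> 1 \<and> K-lipschitz_on UNIV (phi g \<gamma> c) \<and>
     deriv u0 x0 <
       (if K = 0 then 0
        else - (1 / (2 * K)) * (sqrt (1 + 8 * K\<^sup>2) - 1) * phi g \<gamma> c (u0 x0))"

definition bound_i ::
  "(real \<Rightarrow> real) \<Rightarrow> real \<Rightarrow> (real \<Rightarrow> real) \<Rightarrow> real \<Rightarrow> real \<Rightarrow> real \<Rightarrow> real" where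
  "bound_i g \<gamma> u0 c K x0 =
     (if K = 0 then 2 / (\<gamma> * \<bar>deriv u0 x0\<bar>)
      else 4 * K / (\<gamma> * sqrt (4 * K\<^sup>2 * (deriv u0 x0)\<^sup>2
             - (sqrt (1 + 8 * K\<^sup>2) - 1)\<^sup>2 * (phi g \<gamma> c (u0 x0))\<^sup>2)))"

definition condition_ii ::
  "(real \<Rightarrow> real) \<Rightarrow> real \<Rightarrow> (real \<Rightarrow> real) \<Rightarrow> real \<Rightarrow> real \<Rightarrow> real \<Rightarrow> bool" where
  "condition_ii g \<gamma> u0 c K x0 \<longleftrightarrow>
     (\<forall>v. g v \<le> g c) \<and>
     0 \<le> K \<and> K \<le> 1 / sqrt 8 \<and> K-lipschitz_on UNIV (psi g \<gamma> c) \<and>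
     deriv u0 x0 <
       (if K = 0 then 0
        else - (1 / (2 * K)) * (1 - sqrt (1 - 8 * K\<^sup>2)) * psi g \<gamma> c (u0 x0))"

definition bound_ii ::
  "(real \<Rightarrow> real) \<Rightarrow> real \<Rightarrow> (real \<Rightarrow> real) \<Rightarrow> real \<Rightarrow> real \<Rightarrow> real \<Rightarrow> real" where
  "bound_ii g \<gamma> u0 c K x0 =
     (if K = 0 then 2 / (\<gamma> * \<bar>deriv u0 x0\<bar>)
      else 4 * K / (\<gamma> * sqrt (4 * K\<^sup>2 * (deriv u0 x0)\<^sup>2
             - (sqrt (1 - 8 * K\<^sup>2) - 1)\<^sup>2 * (psi g \<gamma> c (u0 x0))\<^sup>2)))"

end

theory Submission
  imports Defs "HOL-Probability.Characteristic_Functions" "HOL-Real_Asymp.Real_Asymp"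
begin

text \<open>
Along a characteristic \<open>q' = f'(u(t,q))\<close> the slope \<open>m(t) = u\<^sub>x(t,q(t))\<close> of a solution obeys
\<open>m' = g(u) - f''(u)/2 m\<^sup>2 - p * F\<close> with \<open>F = g(u) + f''(u)/2 u\<^sub>x\<^sup>2\<close>, whereas the value
\<open>U(t) = u(t,q(t))\<close> obeys \<open>U' = - \<partial>\<^sub>x p * F\<close>.  The kernel splits as \<open>p = p\<^sub>+ + p\<^sub>-\<close>, the parts living on
the two half-lines, and \<open>\<partial>\<^sub>x p = p\<^sub>- - p\<^sub>+\<close>; hence with \<open>L = p\<^sub>+ * F\<close> and \<open>R = p\<^sub>- * F\<close> one has
\<open>m' = g(U) - f''(U)/2 m\<^sup>2 - (L + R)\<close> and \<open>U' = L - R\<close>: the same two nonlocal quantities govern both.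

The two blow-up conditions are one condition with a sign.  Write \<open>g - g(c) = \<sigma> \<gamma> \<phi>\<^sup>2\<close> with \<open>\<sigma> = 1\<close> at a
minimum and \<open>\<sigma> = -1\<close> at a maximum, and let \<open>\<alpha>\<close> be the root of \<open>\<alpha> (1 + \<sigma> \<alpha> K) = 2 K\<close> that vanishes
with \<open>K\<close>; this \<open>\<alpha>\<close> is the constant in front of \<open>\<phi>(u\<^sub>0(x\<^sub>0))\<close> in the condition on \<open>u\<^sub>0'(x\<^sub>0)\<close>.  As
\<open>\<phi>\<close> is \<open>K\<close>-Lipschitz, \<open>\<bar>g'\<bar> \<le> 2 K \<gamma> \<phi>\<close>, and with \<open>w = g(u) - g(c)\<close> the choice of \<open>\<alpha>\<close> gives
\<open>w \<plusminus> w\<^sub>x \<le> (1 + \<sigma> \<alpha> K) (F - g(c))\<close>.  Integrating against \<open>exp x\<close> and \<open>exp (- x)\<close> bounds \<open>L\<close> and \<open>R\<close> below by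
multiples of \<open>w\<close> (\<open>left_avg_lower_bound\<close>, \<open>right_avg_lower_bound\<close>).

Put \<open>A = \<alpha> \<phi>(U) - m\<close> and \<open>B = - \<alpha> \<phi>(U) - m\<close>, both positive at time 0 by hypothesis.  Since
\<open>\<bar>(\<alpha> \<phi>(U))'\<bar> \<le> \<alpha> K \<bar>L - R\<bar>\<close> and \<open>\<alpha> K \<le> 1\<close>, the lower bounds give \<open>A' \<ge> \<gamma>/2 A B\<close> and
\<open>B' \<ge> \<gamma>/2 A B\<close> (in integrated form, \<open>\<phi>\<close> being only Lipschitz), so \<open>\<surd>(A B)\<close> grows at least like
the solution of \<open>h' = \<gamma>/2 h\<^sup>2\<close> and the lifespan is at most \<open>2 / (\<gamma> \<surd>(A(0) B(0)))\<close>
(\<open>riccati_lifespan\<close>, \<open>blowup_time\<close>).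

For \<open>s > 3/2\<close> the slope \<open>u\<^sub>x\<close> is in general merely continuous, so its equation cannot be obtained by
differentiating the equation for \<open>u\<close>.  It is read off in the limit \<open>h \<rightarrow> 0\<close> from the difference quotients
\<open>(u(t,q(t)+h) - u(t,q(t)))/h\<close>, whose time derivatives converge uniformly (\<open>slope_equation\<close>).  This needs
\<open>u\<close> and \<open>u\<^sub>x\<close> continuous in time for the sup norm and \<open>u\<close> classically differentiable in time.  These
facts come from the Sobolev embedding, which in turn rests on Fourier inversion for continuous functions
whose transform in the mean is integrable; inversion is tested against Gaussians.
\<close>

section \<open>The Fourier transform in the mean\<close>

lemma cmod_add_power2_le: "(cmod (a + b))\<^sup>2 \<le> 2 * (cmod a)\<^sup>2 + 2 * (cmod b)\<^sup>2"
proof -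
  have "(cmod (a + b))\<^sup>2 \<le> (cmod a + cmod b)\<^sup>2"
    by (simp add: norm_triangle_ineq power_mono)
  also have "\<dots> \<le> 2 * (cmod a)\<^sup>2 + 2 * (cmod b)\<^sup>2"
    using sum_squares_bound[of "cmod a" "cmod b"] by (simp add: power2_sum)
  finally show ?thesis .
qed

lemma nn_integral_cmod_add_power2_le:
  assumes [measurable]: "a \<in> borel_measurable M" "b \<in> borel_measurable M"
  shows "(\<integral>\<^sup>+\<xi>. ennreal ((cmod (a \<xi> + b \<xi>))\<^sup>2) \<partial>M)
           \<le> 2 * (\<integral>\<^sup>+\<xi>. ennreal ((cmod (a \<xi>))\<^sup>2) \<partial>M) + 2 * (\<integral>\<^sup>+\<xi>. ennreal ((cmod (b \<xi>))\<^sup>2) \<partial>M)"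
proof -
  have "(\<integral>\<^sup>+\<xi>. ennreal ((cmod (a \<xi> + b \<xi>))\<^sup>2) \<partial>M)
      \<le> (\<integral>\<^sup>+\<xi>. 2 * ennreal ((cmod (a \<xi>))\<^sup>2) + 2 * ennreal ((cmod (b \<xi>))\<^sup>2) \<partial>M)"
  proof (rule nn_integral_mono)
    fix \<xi>
    have "2 * ennreal ((cmod (a \<xi>))\<^sup>2) + 2 * ennreal ((cmod (b \<xi>))\<^sup>2)
        = ennreal (2 * (cmod (a \<xi>))\<^sup>2 + 2 * (cmod (b \<xi>))\<^sup>2)"
      by (simp add: ennreal_mult)
    then show "ennreal ((cmod (a \<xi> + b \<xi>))\<^sup>2) \<le> 2 * ennreal ((cmod (a \<xi>))\<^sup>2) + 2 * ennreal ((cmod (b \<xi>))\<^sup>2)"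
      using ennreal_leI[OF cmod_add_power2_le[of "a \<xi>" "b \<xi>"]] by metis
  qed
  also have "\<dots> = 2 * (\<integral>\<^sup>+\<xi>. ennreal ((cmod (a \<xi>))\<^sup>2) \<partial>M) + 2 * (\<integral>\<^sup>+\<xi>. ennreal ((cmod (b \<xi>))\<^sup>2) \<partial>M)"
    by (simp add: nn_integral_add nn_integral_cmult)
  finally show ?thesis .
qed

lemma integrable_mult_power2:
  fixes F G :: "'a \<Rightarrow> real"
  assumes [measurable]: "F \<in> borel_measurable M" "G \<in> borel_measurable M"
    and F2: "integrable M (\<lambda>x. (F x)\<^sup>2)" and G2: "integrable M (\<lambda>x. (G x)\<^sup>2)"
  shows "integrable M (\<lambda>x. F x * G x)"
proof (rule Bochner_Integration.integrable_bound)
  show "integrable M (\<lambda>x. (F x)\<^sup>2 + (G x)\<^sup>2)" using F2 G2 by simp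
  show "AE x in M. norm (F x * G x) \<le> norm ((F x)\<^sup>2 + (G x)\<^sup>2)"
  proof (rule AE_I2)
    fix x
    have "2 * (\<bar>F x\<bar> * \<bar>G x\<bar>) \<le> (F x)\<^sup>2 + (G x)\<^sup>2"
      using sum_squares_bound[of "\<bar>F x\<bar>" "\<bar>G x\<bar>"] by simp
    moreover have "0 \<le> \<bar>F x\<bar> * \<bar>G x\<bar>" by simp
    ultimately have "\<bar>F x\<bar> * \<bar>G x\<bar> \<le> (F x)\<^sup>2 + (G x)\<^sup>2" by linarith
    then show "norm (F x * G x) \<le> norm ((F x)\<^sup>2 + (G x)\<^sup>2)" by (simp add: abs_mult)
  qed
qed simp

text \<open>
The quadratic polynomial \<open>r \<mapsto> \<integral> (F + r G)\<^sup>2\<close> is nonnegative, so its discriminant is not positive.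
\<close>

lemma integral_Cauchy_Schwarz:
  fixes F G :: "'a \<Rightarrow> real"
  assumes [measurable]: "F \<in> borel_measurable M" "G \<in> borel_measurable M"
    and F2: "integrable M (\<lambda>x. (F x)\<^sup>2)" and G2: "integrable M (\<lambda>x. (G x)\<^sup>2)"
  shows "(LINT x|M. F x * G x) \<le> sqrt (LINT x|M. (F x)\<^sup>2) * sqrt (LINT x|M. (G x)\<^sup>2)"
proof -
  define a b c where "a = (LINT x|M. (F x)\<^sup>2)" and "b = (LINT x|M. (G x)\<^sup>2)" and "c = (LINT x|M. F x * G x)"
  have FG: "integrable M (\<lambda>x. F x * G x)" by (rule integrable_mult_power2) fact+
  have quad: "0 \<le> a + 2 * r * c + r\<^sup>2 * b" for r
  proof -
    have "0 \<le> (LINT x|M. (F x + r * G x)\<^sup>2)" by simp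
    also have "\<dots> = (LINT x|M. (F x)\<^sup>2 + 2 * r * (F x * G x) + r\<^sup>2 * (G x)\<^sup>2)"
      by (simp add: power2_eq_square algebra_simps)
    also have "\<dots> = a + 2 * r * c + r\<^sup>2 * b"
      unfolding a_def b_def c_def using FG F2 G2 by simp
    finally show ?thesis .
  qed
  have ab: "a \<ge> 0" "b \<ge> 0" by (simp_all add: a_def b_def)
  have "c\<^sup>2 \<le> a * b"
  proof (cases "b = 0")
    case True
    have "c = 0"
    proof (rule ccontr)
      assume "c \<noteq> 0"
      then show False using quad[of "- (a + 1) / (2 * c)"] True ab by (simp add: field_simps)
    qed
    then show ?thesis using ab by simp
  next
    case False
    then have "b > 0" using ab by simp
    have "0 \<le> a - c\<^sup>2 / b" using quad[of "- c / b"] False by (simp add: field_simps power2_eq_square)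
    then show ?thesis using \<open>b > 0\<close> by (simp add: field_simps)
  qed
  then have "\<bar>c\<bar> \<le> sqrt (a * b)" by (metis real_sqrt_abs real_sqrt_le_mono)
  then show ?thesis by (simp add: real_sqrt_mult a_def b_def c_def)
qed

definition truncated_fourier :: "(real \<Rightarrow> real) \<Rightarrow> real \<Rightarrow> real \<Rightarrow> complex" where
  "truncated_fourier h R \<xi> = (LINT x:{-R..R}|lborel.
     exp (- (\<i> * complex_of_real (\<xi> * x))) * complex_of_real (h x))"

lemma measurable_truncated_fourier [measurable]:
  assumes [measurable]: "h \<in> borel_measurable borel"
  shows "truncated_fourier h R \<in> borel_measurable borel"
  unfolding truncated_fourier_def set_lebesgue_integral_def by measurable

lemma truncated_fourier_AE_cong:
  assumes "AE x in lborel. h x = k x" "h \<in> borel_measurable borel" "k \<in> borel_measurable borel"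
  shows "truncated_fourier h R = truncated_fourier k R"
  unfolding truncated_fourier_def set_lebesgue_integral_def using assms
  by (intro ext integral_cong_AE) auto

lemma set_integrable_L2_interval:
  fixes h :: "real \<Rightarrow> real"
  assumes [measurable]: "h \<in> borel_measurable borel" and "integrable lborel (\<lambda>x. (h x)\<^sup>2)"
  shows "integrable lborel (\<lambda>x. indicator {-R..R} x * h x)"
proof (rule integrable_mult_power2)
  show "integrable lborel (\<lambda>x. (indicator {-R..R} x :: real)\<^sup>2)"
  proof -
    have "(\<lambda>x. (indicator {-R..R} x :: real)\<^sup>2) = indicator {-R..R}"
      by (auto simp: indicator_def)
    then show ?thesis by (simp add: integrable_indicator_iff emeasure_lborel_Icc_eq)
  qed
qed (use assms in simp_all)

lemma integrable_truncated_fourier: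
  fixes h :: "real \<Rightarrow> real"
  assumes h [measurable]: "h \<in> borel_measurable borel" and "integrable lborel (\<lambda>x. (h x)\<^sup>2)"
  shows "set_integrable lborel {-R..R} (\<lambda>x. exp (- (\<i> * complex_of_real (\<xi> * x))) * complex_of_real (h x))"
  unfolding set_integrable_def
  by (rule Bochner_Integration.integrable_bound[OF set_integrable_L2_interval[OF assms, of R]])
     (auto simp: norm_mult norm_exp_eq_Re indicator_def)

lemma has_fourier_L2_iff:
  "has_fourier_L2 h H \<longleftrightarrow>
     h \<in> borel_measurable borel \<and> integrable lborel (\<lambda>x. (h x)\<^sup>2) \<and>
     H \<in> borel_measurable borel \<and> integrable lborel (\<lambda>\<xi>. (cmod (H \<xi>))\<^sup>2) \<and>
     ((\<lambda>R. \<integral>\<^sup>+\<xi>. ennreal ((cmod (truncated_fourier h R \<xi> - H \<xi>))\<^sup>2) \<partial>lborel) \<longlongrightarrow> 0) at_top"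
  unfolding has_fourier_L2_def truncated_fourier_def ..

lemma has_fourier_L2_AE_cong:
  assumes h: "has_fourier_L2 h H" and eq: "AE x in lborel. h x = k x" and k [measurable]: "k \<in> borel_measurable borel"
  shows "has_fourier_L2 k H"
proof -
  have [measurable]: "h \<in> borel_measurable borel" using h by (simp add: has_fourier_L2_iff)
  have "integrable lborel (\<lambda>x. (h x)\<^sup>2) \<longleftrightarrow> integrable lborel (\<lambda>x. (k x)\<^sup>2)"
    using eq by (intro integrable_cong_AE) auto
  then show ?thesis
    using h truncated_fourier_AE_cong[OF eq, THEN fun_cong] k by (simp add: has_fourier_L2_iff)
qed

text \<open>
Both transforms are \<open>L\<^sup>2\<close>-limits of the same truncated integrals.  This is what makes the choice
in \<open>fourier_L2\<close> immaterial.
\<close>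

lemma has_fourier_L2_unique:
  assumes H: "has_fourier_L2 h H" and J: "has_fourier_L2 h J"
  shows "AE \<xi> in lborel. H \<xi> = J \<xi>"
proof -
  have [measurable]: "h \<in> borel_measurable borel" "H \<in> borel_measurable borel" "J \<in> borel_measurable borel"
    using H J by (simp_all add: has_fourier_L2_iff)
  let ?d = "\<lambda>H R. \<integral>\<^sup>+\<xi>. ennreal ((cmod (truncated_fourier h R \<xi> - H \<xi>))\<^sup>2) \<partial>lborel"
  have "(\<integral>\<^sup>+\<xi>. ennreal ((cmod (H \<xi> - J \<xi>))\<^sup>2) \<partial>lborel) \<le> 2 * ?d H R + 2 * ?d J R" for R
    using nn_integral_cmod_add_power2_le[of "\<lambda>\<xi>. H \<xi> - truncated_fourier h R \<xi>" lborel
        "\<lambda>\<xi>. truncated_fourier h R \<xi> - J \<xi>"]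
    by (simp add: norm_minus_commute)
  moreover have "((\<lambda>R. 2 * ?d H R + 2 * ?d J R) \<longlongrightarrow> 2 * 0 + 2 * 0) at_top"
    using H J unfolding has_fourier_L2_iff by (intro tendsto_add ennreal_tendsto_cmult) auto
  ultimately have "(\<integral>\<^sup>+\<xi>. ennreal ((cmod (H \<xi> - J \<xi>))\<^sup>2) \<partial>lborel) \<le> 0"
    by (intro tendsto_lowerbound[where F = at_top]) auto
  then have "AE \<xi> in lborel. ennreal ((cmod (H \<xi> - J \<xi>))\<^sup>2) = 0"
    by (subst nn_integral_0_iff_AE[symmetric]) auto
  then show ?thesis by eventually_elim (simp add: ennreal_eq_0_iff)
qed

lemma has_fourier_L2_lincomb:
  assumes H: "has_fourier_L2 h H" and J: "has_fourier_L2 k J"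
  shows "has_fourier_L2 (\<lambda>x. a * h x + b * k x) (\<lambda>\<xi>. of_real a * H \<xi> + of_real b * J \<xi>)"
proof -
  have [measurable]: "h \<in> borel_measurable borel" "H \<in> borel_measurable borel"
    "k \<in> borel_measurable borel" "J \<in> borel_measurable borel"
    and i: "integrable lborel (\<lambda>x. (h x)\<^sup>2)" "integrable lborel (\<lambda>x. (k x)\<^sup>2)"
      "integrable lborel (\<lambda>\<xi>. (cmod (H \<xi>))\<^sup>2)" "integrable lborel (\<lambda>\<xi>. (cmod (J \<xi>))\<^sup>2)"
    using H J by (simp_all add: has_fourier_L2_iff)
  have 1: "integrable lborel (\<lambda>x. (a * h x + b * k x)\<^sup>2)"
  proof -
    have "integrable lborel (\<lambda>x. a\<^sup>2 * (h x)\<^sup>2 + b\<^sup>2 * (k x)\<^sup>2 + 2 * a * b * (h x * k x))"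
      by (intro Bochner_Integration.integrable_add integrable_mult_right integrable_mult_power2) (use i in auto)
    also have "(\<lambda>x. a\<^sup>2 * (h x)\<^sup>2 + b\<^sup>2 * (k x)\<^sup>2 + 2 * a * b * (h x * k x)) = (\<lambda>x. (a * h x + b * k x)\<^sup>2)"
      by (simp add: fun_eq_iff power2_sum power_mult_distrib)
    finally show ?thesis .
  qed
  have 2: "integrable lborel (\<lambda>\<xi>. (cmod (of_real a * H \<xi> + of_real b * J \<xi>))\<^sup>2)"
  proof (rule Bochner_Integration.integrable_bound)
    show "integrable lborel (\<lambda>\<xi>. 2 * (a\<^sup>2 * (cmod (H \<xi>))\<^sup>2) + 2 * (b\<^sup>2 * (cmod (J \<xi>))\<^sup>2))" using i by simp
    show "AE \<xi> in lborel. norm ((cmod (of_real a * H \<xi> + of_real b * J \<xi>))\<^sup>2)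
          \<le> norm (2 * (a\<^sup>2 * (cmod (H \<xi>))\<^sup>2) + 2 * (b\<^sup>2 * (cmod (J \<xi>))\<^sup>2))"
    proof (rule AE_I2)
      fix \<xi>
      show "norm ((cmod (of_real a * H \<xi> + of_real b * J \<xi>))\<^sup>2)
          \<le> norm (2 * (a\<^sup>2 * (cmod (H \<xi>))\<^sup>2) + 2 * (b\<^sup>2 * (cmod (J \<xi>))\<^sup>2))"
        using cmod_add_power2_le[of "of_real a * H \<xi>" "of_real b * J \<xi>"]
        by (simp add: norm_mult power_mult_distrib)
    qed
  qed measurable
  have lin: "truncated_fourier (\<lambda>x. a * h x + b * k x) R \<xi>
      = of_real a * truncated_fourier h R \<xi> + of_real b * truncated_fourier k R \<xi>" for R \<xi>
  proof -
    let ?e = "\<lambda>x. exp (- (\<i> * complex_of_real (\<xi> * x)))"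
    have "truncated_fourier (\<lambda>x. a * h x + b * k x) R \<xi>
        = (LINT x:{-R..R}|lborel. of_real a * (?e x * of_real (h x)) + of_real b * (?e x * of_real (k x)))"
      unfolding truncated_fourier_def by (simp add: distrib_left mult.left_commute)
    also have "\<dots> = of_real a * truncated_fourier h R \<xi> + of_real b * truncated_fourier k R \<xi>"
      unfolding truncated_fourier_def using integrable_truncated_fourier i
      by (subst set_integral_add) (auto intro!: set_integrable_mult_right)
    finally show ?thesis .
  qed
  let ?d = "\<lambda>h H R. \<integral>\<^sup>+\<xi>. ennreal ((cmod (truncated_fourier h R \<xi> - H \<xi>))\<^sup>2) \<partial>lborel"
  have bound: "?d (\<lambda>x. a * h x + b * k x) (\<lambda>\<xi>. of_real a * H \<xi> + of_real b * J \<xi>) R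
      \<le> 2 * (ennreal (a\<^sup>2) * ?d h H R) + 2 * (ennreal (b\<^sup>2) * ?d k J R)" for R
  proof -
    have sc: "(\<integral>\<^sup>+\<xi>. ennreal ((cmod (of_real c * (truncated_fourier h R \<xi> - H \<xi>)))\<^sup>2) \<partial>lborel) = ennreal (c\<^sup>2) * ?d h H R"
      if [measurable]: "h \<in> borel_measurable borel" "H \<in> borel_measurable borel" for c h H
      by (simp add: norm_mult power_mult_distrib ennreal_mult nn_integral_cmult)
    have "?d (\<lambda>x. a * h x + b * k x) (\<lambda>\<xi>. of_real a * H \<xi> + of_real b * J \<xi>) R
       = (\<integral>\<^sup>+\<xi>. ennreal ((cmod (of_real a * (truncated_fourier h R \<xi> - H \<xi>)
              + of_real b * (truncated_fourier k R \<xi> - J \<xi>)))\<^sup>2) \<partial>lborel)"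
      unfolding lin right_diff_distrib by (simp add: add_diff_add)
    also have "\<dots> \<le> 2 * (\<integral>\<^sup>+\<xi>. ennreal ((cmod (of_real a * (truncated_fourier h R \<xi> - H \<xi>)))\<^sup>2) \<partial>lborel)
        + 2 * (\<integral>\<^sup>+\<xi>. ennreal ((cmod (of_real b * (truncated_fourier k R \<xi> - J \<xi>)))\<^sup>2) \<partial>lborel)"
      by (rule nn_integral_cmod_add_power2_le) measurable
    finally show ?thesis by (simp add: sc)
  qed
  have null: "((\<lambda>R. 2 * (ennreal (a\<^sup>2) * ?d h H R) + 2 * (ennreal (b\<^sup>2) * ?d k J R))
      \<longlongrightarrow> 2 * (ennreal (a\<^sup>2) * 0) + 2 * (ennreal (b\<^sup>2) * 0)) at_top"
    using H J unfolding has_fourier_L2_iff by (intro tendsto_add ennreal_tendsto_cmult) auto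
  have "(?d (\<lambda>x. a * h x + b * k x) (\<lambda>\<xi>. of_real a * H \<xi> + of_real b * J \<xi>) \<longlongrightarrow> 0) at_top"
  proof (rule tendsto_sandwich[OF _ _ tendsto_const])
    show "eventually (\<lambda>R. ?d (\<lambda>x. a * h x + b * k x) (\<lambda>\<xi>. of_real a * H \<xi> + of_real b * J \<xi>) R
        \<le> 2 * (ennreal (a\<^sup>2) * ?d h H R) + 2 * (ennreal (b\<^sup>2) * ?d k J R)) at_top"
      by (rule always_eventually) (use bound in blast)
    show "((\<lambda>R. 2 * (ennreal (a\<^sup>2) * ?d h H R) + 2 * (ennreal (b\<^sup>2) * ?d k J R)) \<longlongrightarrow> 0) at_top"
      using null by (simp only: mult_zero_right add_0)
  qed simp
  then show ?thesis using 1 2 by (simp add: has_fourier_L2_iff)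
qed

section \<open>Fourier inversion for continuous functions\<close>

text \<open>
A Fourier transform can be moved from one factor of an integral to the other; \<open>\<theta>\<close> is the transform of
\<open>\<phi>\<close>.  For a truncation of \<open>h\<close> this is Fubini's theorem; the truncations pass to the limit by Cauchy--Schwarz on the frequency side and by dominated convergence
on the other.
\<close>

lemma has_fourier_L2_multiplication:
  assumes hH: "has_fourier_L2 h H"
    and \<phi>: "integrable lborel \<phi>" and \<phi>2: "integrable lborel (\<lambda>\<xi>. (cmod (\<phi> \<xi>))\<^sup>2)"
    and \<theta>: "\<And>y. \<theta> y = (LINT \<xi>|lborel. exp (- (\<i> * complex_of_real (\<xi> * y))) * \<phi> \<xi>)"
    and \<theta>2: "integrable lborel (\<lambda>y. (cmod (\<theta> y))\<^sup>2)"
  shows "(LINT \<xi>|lborel. H \<xi> * \<phi> \<xi>) = (LINT y|lborel. of_real (h y) * \<theta> y)"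
proof -
  let ?e = "\<lambda>\<xi> y. exp (- (\<i> * complex_of_real (\<xi> * y)))"
  have [measurable]: "\<phi> \<in> borel_measurable borel" using \<phi> by auto
  have [measurable]: "\<theta> \<in> borel_measurable borel" unfolding \<theta>[abs_def] by measurable
  have [measurable]: "h \<in> borel_measurable borel" "H \<in> borel_measurable borel"
    and i: "integrable lborel (\<lambda>x. (h x)\<^sup>2)" "integrable lborel (\<lambda>\<xi>. (cmod (H \<xi>))\<^sup>2)"
    using hH by (simp_all add: has_fourier_L2_iff)
  let ?d = "\<lambda>R. \<integral>\<^sup>+\<xi>. ennreal ((cmod (truncated_fourier h R \<xi> - H \<xi>))\<^sup>2) \<partial>lborel"
  have h\<theta>: "integrable lborel (\<lambda>y. of_real (h y) * \<theta> y)"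
  proof (rule Bochner_Integration.integrable_bound)
    show "integrable lborel (\<lambda>y. h y * cmod (\<theta> y))" by (rule integrable_mult_power2) (use i \<theta>2 in auto)
  qed (auto simp: norm_mult)
  have H\<phi>: "integrable lborel (\<lambda>\<xi>. H \<xi> * \<phi> \<xi>)"
  proof (rule Bochner_Integration.integrable_bound)
    show "integrable lborel (\<lambda>y. cmod (H y) * cmod (\<phi> y))" by (rule integrable_mult_power2) (use i \<phi>2 in auto)
  qed (auto simp: norm_mult)
  have swap: "integrable lborel (\<lambda>\<xi>. truncated_fourier h R \<xi> * \<phi> \<xi>) \<and>
     (LINT \<xi>|lborel. truncated_fourier h R \<xi> * \<phi> \<xi>) = (LINT y|lborel. indicator {-R..R} y *\<^sub>R (of_real (h y) * \<theta> y))" for R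
  proof -
    let ?F = "\<lambda>\<xi> y. indicator {-R..R} y *\<^sub>R (?e \<xi> y * of_real (h y)) * \<phi> \<xi>"
    have hR: "integrable lborel (\<lambda>x. indicator {-R..R} x * h x)"
      by (rule set_integrable_L2_interval) (use i in auto)
    have "integrable (lborel \<Otimes>\<^sub>M lborel) (\<lambda>(\<xi>, y). \<phi> \<xi> * of_real (indicator {-R..R} y * h y))"
    proof (rule lborel_pair.Fubini_integrable)
      have "integrable lborel (\<lambda>y. norm (indicator {-R..R} y * h y))" by (rule integrable_norm[OF hR])
      then show "integrable lborel (\<lambda>\<xi>. LINT y|lborel. norm (case (\<xi>, y) of (\<xi>, y) \<Rightarrow> \<phi> \<xi> * of_real (indicator {-R..R} y * h y)))"
        using \<phi> by (simp add: norm_mult)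
      show "AE \<xi> in lborel. integrable lborel (\<lambda>y. case (\<xi>, y) of (\<xi>, y) \<Rightarrow> \<phi> \<xi> * of_real (indicator {-R..R} y * h y))"
        using hR by (auto intro!: integrable_of_real simp del: of_real_mult)
    qed measurable
    then have I: "integrable (lborel \<Otimes>\<^sub>M lborel) (\<lambda>(\<xi>, y). ?F \<xi> y)"
      by (rule Bochner_Integration.integrable_bound) (auto simp: norm_mult)
    have a: "(LINT y|lborel. ?F \<xi> y) = truncated_fourier h R \<xi> * \<phi> \<xi>" for \<xi>
      unfolding truncated_fourier_def set_lebesgue_integral_def 
      by (rule integral_mult_left_zero)
    have b: "(LINT \<xi>|lborel. ?F \<xi> y) = indicator {-R..R} y *\<^sub>R (of_real (h y) * \<theta> y)" for y
    proof -
      have "(LINT \<xi>|lborel. ?F \<xi> y) = (LINT \<xi>|lborel. (indicator {-R..R} y *\<^sub>R of_real (h y)) * (?e \<xi> y * \<phi> \<xi>))"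
        by (simp add: mult_ac scaleR_conv_of_real)
      also have "\<dots> = (indicator {-R..R} y *\<^sub>R of_real (h y)) * \<theta> y"
        unfolding \<theta> by (rule integral_mult_right_zero)
      finally show ?thesis by simp
    qed
    show ?thesis
      using lborel_pair.Fubini_integral[OF I] lborel_pair.integrable_fst'[OF I]
      by (simp only: a b case_prod_conv)
  qed
  have "((\<lambda>R. LINT \<xi>|lborel. truncated_fourier h R \<xi> * \<phi> \<xi>) \<longlongrightarrow> (LINT \<xi>|lborel. H \<xi> * \<phi> \<xi>)) at_top"
  proof -
    define c where "c = sqrt (LINT \<xi>|lborel. (cmod (\<phi> \<xi>))\<^sup>2)"
    have d0: "(?d \<longlongrightarrow> 0) at_top" using hH by (simp add: has_fourier_L2_iff)
    then have fin: "eventually (\<lambda>R. ?d R < \<infinity>) at_top"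
      by (rule order_tendstoD) simp
    have close: "eventually (\<lambda>R. cmod ((LINT \<xi>|lborel. truncated_fourier h R \<xi> * \<phi> \<xi>) - (LINT \<xi>|lborel. H \<xi> * \<phi> \<xi>))
              \<le> sqrt (enn2real (?d R)) * c) at_top"
      using fin
    proof eventually_elim
      case (elim R)
      let ?D = "\<lambda>\<xi>. truncated_fourier h R \<xi> - H \<xi>"
      have D2: "integrable lborel (\<lambda>\<xi>. (cmod (?D \<xi>))\<^sup>2)"
        using elim by (intro integrableI_bounded) auto
      have "cmod ((LINT \<xi>|lborel. truncated_fourier h R \<xi> * \<phi> \<xi>) - (LINT \<xi>|lborel. H \<xi> * \<phi> \<xi>))
          = cmod (LINT \<xi>|lborel. ?D \<xi> * \<phi> \<xi>)"
        using swap[of R] H\<phi> by (simp add: left_diff_distrib)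
      also have "\<dots> \<le> (LINT \<xi>|lborel. cmod (?D \<xi> * \<phi> \<xi>))"
        by (rule integral_norm_bound)
      also have "\<dots> \<le> sqrt (LINT \<xi>|lborel. (cmod (?D \<xi>))\<^sup>2) * c"
        unfolding c_def norm_mult by (rule integral_Cauchy_Schwarz) (use D2 \<phi>2 in auto)
      also have "(LINT \<xi>|lborel. (cmod (?D \<xi>))\<^sup>2) = enn2real (?d R)"
        by (subst integral_eq_nn_integral) auto
      finally show ?case .
    qed
    have lim: "((\<lambda>R. sqrt (enn2real (?d R)) * c) \<longlongrightarrow> sqrt (enn2real 0) * c) at_top"
    proof (intro tendsto_mult tendsto_real_sqrt tendsto_const)
      show "((\<lambda>R. enn2real (?d R)) \<longlongrightarrow> enn2real 0) at_top"
        using tendsto_enn2real[of ?d 0 at_top] d0 by (simp only: ennreal_0 enn2real_0 order_refl)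
    qed
    have "((\<lambda>R. (LINT \<xi>|lborel. truncated_fourier h R \<xi> * \<phi> \<xi>) - (LINT \<xi>|lborel. H \<xi> * \<phi> \<xi>)) \<longlongrightarrow> 0) at_top"
      by (rule Lim_null_comparison[OF close]) (use lim in \<open>simp only: enn2real_0 real_sqrt_zero mult_zero_left\<close>)
    then show ?thesis by (rule LIM_zero_cancel)
  qed
  moreover have "((\<lambda>R. LINT \<xi>|lborel. truncated_fourier h R \<xi> * \<phi> \<xi>) \<longlongrightarrow> (LINT y|lborel. of_real (h y) * \<theta> y)) at_top"
  proof -
    have "((\<lambda>R. LINT y|lborel. indicator {-R..R} y *\<^sub>R (of_real (h y) * \<theta> y)) \<longlongrightarrow> (LINT y|lborel. of_real (h y) * \<theta> y)) at_top"
    proof (rule integral_dominated_convergence_at_top[where w = "\<lambda>y. cmod (of_real (h y) * \<theta> y)"])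
      show "AE y in lborel. ((\<lambda>R. indicator {-R..R} y *\<^sub>R (of_real (h y) * \<theta> y)) \<longlongrightarrow> of_real (h y) * \<theta> y) at_top"
      proof (rule AE_I2, rule tendsto_eventually)
        fix y :: real
        show "eventually (\<lambda>R. indicator {-R..R} y *\<^sub>R (of_real (h y) * \<theta> y) = of_real (h y) * \<theta> y) at_top"
          using eventually_ge_at_top[of "\<bar>y\<bar>"] by eventually_elim (auto simp: indicator_def)
      qed
      show "integrable lborel (\<lambda>y. cmod (of_real (h y) * \<theta> y))" using h\<theta> by (rule integrable_norm)
      show "eventually (\<lambda>R. AE y in lborel. norm (indicator {-R..R} y *\<^sub>R (of_real (h y) * \<theta> y)) \<le> cmod (of_real (h y) * \<theta> y)) at_top"
        by (rule always_eventually) (auto simp: indicator_def)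
    qed measurable
    moreover have "(LINT \<xi>|lborel. truncated_fourier h R \<xi> * \<phi> \<xi>)
        = (LINT y|lborel. indicator {-R..R} y *\<^sub>R (of_real (h y) * \<theta> y))" for R
      by (rule conjunct2[OF swap])
    ultimately show ?thesis by (simp only:)
  qed
  ultimately show ?thesis using tendsto_unique[OF trivial_limit_at_top_linorder] by blast
qed

lemma gaussian_fourier:
  assumes s: "s > 0"
  shows "(LINT \<xi>|lborel. std_normal_density (\<xi> / s) *\<^sub>R iexp (\<xi> * r)) = of_real (s * exp (- (s * r)\<^sup>2 / 2))"
proof -
  have "complex_of_real (exp (- (s * r)\<^sup>2 / 2)) = char std_normal_distribution (s * r)"
    by (simp add: char_std_normal_distribution)
  also have "\<dots> = (LINT z|lborel. std_normal_density z *\<^sub>R iexp (s * r * z))"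
    unfolding char_def by (subst integral_density) (auto simp: normal_density_nonneg)
  finally have 1: "(LINT z|lborel. std_normal_density z *\<^sub>R iexp (s * r * z)) = of_real (exp (- (s * r)\<^sup>2 / 2))" ..
  show ?thesis
    using lborel_integral_real_affine[of s "\<lambda>\<xi>. std_normal_density (\<xi> / s) *\<^sub>R iexp (\<xi> * r)" 0] s 1
    by (simp add: mult_ac scaleR_conv_of_real)
qed

lemma exp_power2_eq_std_normal_density: "exp (- z\<^sup>2 / 2) = sqrt (2 * pi) * std_normal_density z"
  by (simp add: std_normal_density_def)

text \<open>
The function \<open>h\<close> need not be bounded, so a single dominated convergence does not suffice.  Within
distance 1 of \<open>x\<close> the function is bounded and the substitution \<open>y = x + z / s\<close> fixes the Gaussian; farther
away all the kernels with \<open>s \<ge> 1\<close> lie below the one with \<open>s = 1\<close>, against which \<open>h\<close> is integrable.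
\<close>

lemma gaussian_approximate_identity:
  fixes h :: "real \<Rightarrow> real"
  assumes h: "continuous_on UNIV h" and h2: "integrable lborel (\<lambda>y. (h y)\<^sup>2)"
  shows "(\<lambda>n. LINT y|lborel. h y * (real (Suc n) * exp (- (real (Suc n) * (x - y))\<^sup>2 / 2))) \<longlonglongrightarrow> sqrt (2 * pi) * h x"
proof -
  have [measurable]: "h \<in> borel_measurable borel" using h by (rule borel_measurable_continuous_onI)
  define s where "s n = real (Suc n)" for n
  have s: "s n \<ge> 1" for n by (simp add: s_def)
  have gi: "integrable lborel (\<lambda>z::real. exp (- z\<^sup>2 / 2))"
    unfolding exp_power2_eq_std_normal_density by simp
  have gi2: "integrable lborel (\<lambda>y. (exp (- (x - y)\<^sup>2 / 2))\<^sup>2)"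
  proof (rule Bochner_Integration.integrable_bound)
    show "integrable lborel (\<lambda>y. exp (- (x - y)\<^sup>2 / 2))"
      using lborel_integrable_real_affine[OF gi, of "-1" x] by simp
  qed (auto simp: power2_eq_square mult_le_one)
  define A where "A n y = indicator {x - 1..x + 1} y * (h y * (s n * exp (- (s n * (x - y))\<^sup>2 / 2)))" for n y
  define B where "B n y = indicator (- {x - 1..x + 1}) y * (h y * (s n * exp (- (s n * (x - y))\<^sup>2 / 2)))" for n y
  obtain M where M: "\<bar>h y\<bar> \<le> M" if "y \<in> {x - 1..x + 1}" for y
  proof -
    have "compact (h ` {x - 1..x + 1})"
      using h by (intro compact_continuous_image) (auto intro: continuous_on_subset)
    then obtain M where "\<forall>v\<in>h ` {x - 1..x + 1}. norm v \<le> M"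
      using compact_imp_bounded bounded_iff by blast
    then show ?thesis by (intro that[of M]) auto
  qed
  have [measurable]: "A n \<in> borel_measurable borel" "B n \<in> borel_measurable borel" for n
    unfolding A_def B_def by measurable
  have A_sub: "A n (x + 1 / s n * z) = s n * (indicator {- s n..s n} z * h (x + z / s n) * exp (- z\<^sup>2 / 2))" for n z
  proof -
    have "x + z / s n \<in> {x - 1..x + 1} \<longleftrightarrow> z \<in> {- s n..s n}" using s[of n] by (auto simp: field_simps)
    moreover have "s n * (x - (x + z / s n)) = - z" using s[of n] by (simp add: field_simps)
    ultimately show ?thesis by (simp add: A_def indicator_def)
  qed
  have A_bound: "\<bar>indicator {- s n..s n} z * h (x + z / s n) * exp (- z\<^sup>2 / 2)\<bar> \<le> M * exp (- z\<^sup>2 / 2)" for n z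
  proof -
    have M0: "M \<ge> 0" using M[of x] by auto
    have "\<bar>h (x + z / s n)\<bar> \<le> M" if "z \<in> {- s n..s n}"
      using that s[of n] by (intro M) (auto simp: field_simps)
    then show ?thesis using M0 by (auto simp: indicator_def abs_mult intro!: mult_right_mono)
  qed
  have "(\<lambda>n. LINT z|lborel. indicator {- s n..s n} z * h (x + z / s n) * exp (- z\<^sup>2 / 2))
      \<longlonglongrightarrow> (LINT z|lborel. h x * exp (- z\<^sup>2 / 2))"
  proof (rule integral_dominated_convergence[where w = "\<lambda>z. M * exp (- z\<^sup>2 / 2)"])
    show "AE z in lborel. (\<lambda>n. indicator {- s n..s n} z * h (x + z / s n) * exp (- z\<^sup>2 / 2)) \<longlonglongrightarrow> h x * exp (- z\<^sup>2 / 2)"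
    proof (rule AE_I2)
      fix z :: real
      have "eventually (\<lambda>n. \<bar>z\<bar> \<le> s n) sequentially"
        unfolding s_def by real_asymp
      then have "eventually (\<lambda>n. indicator {- s n..s n} z = (1::real)) sequentially"
        by eventually_elim (auto simp: indicator_def)
      then have 1: "(\<lambda>n. indicator {- s n..s n} z :: real) \<longlonglongrightarrow> 1" by (rule tendsto_eventually)
      have "(\<lambda>n. x + z / s n) \<longlonglongrightarrow> x" unfolding s_def by real_asymp
      then have "(\<lambda>n. h (x + z / s n)) \<longlonglongrightarrow> h x"
        using h by (intro isCont_tendsto_compose[of x h]) (auto simp: continuous_on_eq_continuous_at)
      from tendsto_mult[OF tendsto_mult[OF 1 this] tendsto_const[of "exp (- z\<^sup>2 / 2)"]]
      show "(\<lambda>n. indicator {- s n..s n} z * h (x + z / s n) * exp (- z\<^sup>2 / 2)) \<longlonglongrightarrow> h x * exp (- z\<^sup>2 / 2)"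
        by simp
    qed
    show "AE z in lborel. norm (indicator {- s n..s n} z * h (x + z / s n) * exp (- z\<^sup>2 / 2)) \<le> M * exp (- z\<^sup>2 / 2)" for n
      using A_bound[of n] by simp
  qed (use gi in auto)
  also have "(LINT z|lborel. h x * exp (- z\<^sup>2 / 2)) = sqrt (2 * pi) * h x"
    unfolding exp_power2_eq_std_normal_density by simp
  also have "(\<lambda>n. LINT z|lborel. indicator {- s n..s n} z * h (x + z / s n) * exp (- z\<^sup>2 / 2)) = (\<lambda>n. LINT y|lborel. A n y)"
  proof
    fix n
    have "s n > 0" using s[of n] by simp
    then show "(LINT z|lborel. indicator {- s n..s n} z * h (x + z / s n) * exp (- z\<^sup>2 / 2)) = (LINT y|lborel. A n y)"
      using lborel_integral_real_affine[of "1 / s n" "A n" x] by (simp add: A_sub[simplified])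
  qed
  finally have limA: "(\<lambda>n. LINT y|lborel. A n y) \<longlonglongrightarrow> sqrt (2 * pi) * h x" .
  have B_bound: "\<bar>B n y\<bar> \<le> \<bar>h y * exp (- (x - y)\<^sup>2 / 2)\<bar>" for n y
  proof (cases "y \<in> {x - 1..x + 1}")
    case False
    then have "1 \<le> \<bar>x - y\<bar>" by auto
    then have r: "1 \<le> (x - y)\<^sup>2" using abs_le_square_iff[of 1 "x - y"] by simp
    \<comment> \<open>at distance \<open>r \<ge> 1\<close> the kernel \<open>s exp(- (s r)\<^sup>2 / 2)\<close> decreases in \<open>s \<ge> 1\<close>\<close>
    have "s n \<le> 1 + ((s n)\<^sup>2 - 1) / 2" using sum_squares_bound[of "s n" 1] by (simp add: field_simps)
    also have "\<dots> \<le> exp (((s n)\<^sup>2 - 1) / 2)" by (rule exp_ge_add_one_self)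
    also have "\<dots> \<le> exp (((s n)\<^sup>2 - 1) / 2 * (x - y)\<^sup>2)"
      using r s[of n] mult_left_mono[OF r, of "((s n)\<^sup>2 - 1) / 2"] by simp
    finally have "s n * exp (- (s n * (x - y))\<^sup>2 / 2) \<le> exp (((s n)\<^sup>2 - 1) / 2 * (x - y)\<^sup>2) * exp (- (s n * (x - y))\<^sup>2 / 2)"
      by (rule mult_right_mono) simp
    also have "\<dots> = exp (- (x - y)\<^sup>2 / 2)"
      unfolding exp_add[symmetric] power_mult_distrib by (simp add: left_diff_distrib diff_divide_distrib)
    finally show ?thesis using s[of n] by (auto simp: B_def indicator_def abs_mult intro!: mult_left_mono)
  qed (simp add: B_def)
  have hg: "integrable lborel (\<lambda>y. h y * exp (- (x - y)\<^sup>2 / 2))"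
    by (rule integrable_mult_power2) (use h2 gi2 in auto)
  have "(\<lambda>n. LINT y|lborel. B n y) \<longlonglongrightarrow> (LINT y|(lborel :: real measure). 0)"
  proof (rule integral_dominated_convergence[where w = "\<lambda>y. \<bar>h y * exp (- (x - y)\<^sup>2 / 2)\<bar>"])
    show "AE y in lborel. (\<lambda>n. B n y) \<longlonglongrightarrow> 0"
    proof (rule AE_I2)
      fix y
      show "(\<lambda>n. B n y) \<longlonglongrightarrow> 0"
      proof (cases "y \<in> {x - 1..x + 1}")
        case False
        then have "\<bar>x - y\<bar> > 0" by auto
        define r where "r = (x - y)\<^sup>2 / 2"
        have "r > 0" using \<open>\<bar>x - y\<bar> > 0\<close> by (simp add: r_def)
        then have "(\<lambda>n. s n * exp (- r * (s n)\<^sup>2)) \<longlonglongrightarrow> 0" unfolding s_def by real_asymp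
        then have "(\<lambda>n. s n * exp (- (s n * (x - y))\<^sup>2 / 2)) \<longlonglongrightarrow> 0"
          by (simp add: r_def power_mult_distrib mult_ac)
        from tendsto_mult[OF tendsto_const[of "indicator (- {x - 1..x + 1}) y * h y"] this]
        show ?thesis by (simp add: B_def mult_ac)
      qed (simp add: B_def)
    qed
    show "integrable lborel (\<lambda>y. \<bar>h y * exp (- (x - y)\<^sup>2 / 2)\<bar>)" using hg by (rule integrable_abs)
    show "AE y in lborel. norm (B n y) \<le> \<bar>h y * exp (- (x - y)\<^sup>2 / 2)\<bar>" for n
      using B_bound[of n] by simp
  qed auto
  then have limB: "(\<lambda>n. LINT y|lborel. B n y) \<longlonglongrightarrow> 0" by simp
  have "(LINT y|lborel. h y * (s n * exp (- (s n * (x - y))\<^sup>2 / 2))) = (LINT y|lborel. A n y) + (LINT y|lborel. B n y)" for n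
  proof -
    have "integrable lborel (B n)"
      by (rule Bochner_Integration.integrable_bound[OF hg]) (use B_bound[of n] in auto)
    moreover have "integrable lborel (A n)"
    proof -
      have "integrable lborel (\<lambda>z. M * exp (- z\<^sup>2 / 2))" using gi by simp
      then have "integrable lborel (\<lambda>z. indicator {- s n..s n} z * h (x + z / s n) * exp (- z\<^sup>2 / 2))"
        by (rule Bochner_Integration.integrable_bound) (use A_bound[of n] order_trans[OF _ abs_ge_self] in auto)
      then have "integrable lborel (\<lambda>z. A n (x + 1 / s n * z))"
        unfolding A_sub by (rule integrable_mult_right)
      then show ?thesis
        using lborel_integrable_real_affine_iff[of "1 / s n" "A n" x] s[of n] by auto
    qed
    moreover have "h y * (s n * exp (- (s n * (x - y))\<^sup>2 / 2)) = A n y + B n y" for y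
      by (simp add: A_def B_def indicator_def)
    ultimately show ?thesis by simp
  qed
  then show ?thesis using tendsto_add[OF limA limB] by (simp add: s_def)
qed

text \<open>
Apply the multiplication formula to \<open>\<phi>(\<xi>) = \<rho>(\<xi>/s) exp(\<i> \<xi> x)\<close>, \<open>\<rho>\<close> the normal density.  Its transform is a
Gaussian of width \<open>1/s\<close> about \<open>x\<close>, and \<open>s \<rightarrow> \<infinity>\<close> recovers \<open>h(x)\<close> on one side and the inversion integral on
the other.
\<close>

lemma fourier_inversion:
  assumes hH: "has_fourier_L2 h H" and h: "continuous_on UNIV h" and H: "integrable lborel H"
  shows "complex_of_real (h x) = (LINT \<xi>|lborel. iexp (\<xi> * x) * H \<xi>) / (2 * pi)"
proof -
  have h2: "integrable lborel (\<lambda>y. (h y)\<^sup>2)" using hH by (simp add: has_fourier_L2_iff)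
  define s where "s n = real (Suc n)" for n
  have s: "s n > 0" for n by (simp add: s_def)
  define \<phi> where "\<phi> n \<xi> = std_normal_density (\<xi> / s n) *\<^sub>R iexp (\<xi> * x)" for n \<xi>
  define \<theta> where "\<theta> n y = complex_of_real (s n * exp (- (s n * (x - y))\<^sup>2 / 2))" for n y
  have dens: "integrable lborel (\<lambda>\<xi>. std_normal_density (\<xi> / s n))" for n
    using lborel_integrable_real_affine[of std_normal_density "1 / s n" 0] s[of n] by simp
  have dens_le: "std_normal_density z \<le> 1 / sqrt (2 * pi)" for z
    unfolding std_normal_density_def using mult_left_mono[of "exp (- z\<^sup>2 / 2)" 1 "1 / sqrt (2 * pi)"] by simp
  have [measurable]: "\<phi> n \<in> borel_measurable borel" for n unfolding \<phi>_def by measurable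
  have norm_\<phi>: "cmod (\<phi> n \<xi>) = std_normal_density (\<xi> / s n)" for n \<xi>
    by (simp add: \<phi>_def normal_density_nonneg)
  have mult: "(LINT \<xi>|lborel. H \<xi> * \<phi> n \<xi>) = (LINT y|lborel. of_real (h y) * \<theta> n y)" for n
  proof (rule has_fourier_L2_multiplication[OF hH])
    show "integrable lborel (\<phi> n)"
      by (rule Bochner_Integration.integrable_bound[OF dens[of n]]) (auto simp: norm_\<phi> normal_density_nonneg)
    show "integrable lborel (\<lambda>\<xi>. (cmod (\<phi> n \<xi>))\<^sup>2)"
    proof (rule Bochner_Integration.integrable_bound[OF integrable_mult_right[OF dens[of n], of "1 / sqrt (2 * pi)"]])
      show "AE \<xi> in lborel. norm ((cmod (\<phi> n \<xi>))\<^sup>2) \<le> norm (1 / sqrt (2 * pi) * std_normal_density (\<xi> / s n))"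
      proof (rule AE_I2)
        fix \<xi>
        have "std_normal_density (\<xi> / s n) * std_normal_density (\<xi> / s n) \<le> 1 / sqrt (2 * pi) * std_normal_density (\<xi> / s n)"
          by (rule mult_right_mono[OF dens_le normal_density_nonneg])
        then show "norm ((cmod (\<phi> n \<xi>))\<^sup>2) \<le> norm (1 / sqrt (2 * pi) * std_normal_density (\<xi> / s n))"
          unfolding norm_\<phi> power2_eq_square by (simp add: normal_density_nonneg)
      qed
    qed measurable
    show "\<theta> n y = (LINT \<xi>|lborel. exp (- (\<i> * complex_of_real (\<xi> * y))) * \<phi> n \<xi>)" for y
    proof -
      have "exp (- (\<i> * complex_of_real (\<xi> * y))) * \<phi> n \<xi> = std_normal_density (\<xi> / s n) *\<^sub>R iexp (\<xi> * (x - y))" for \<xi>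
        by (simp add: \<phi>_def exp_diff exp_minus field_simps right_diff_distrib)
      then show ?thesis using gaussian_fourier[OF s, of n "x - y"] by (simp add: \<theta>_def)
    qed
    show "integrable lborel (\<lambda>y. (cmod (\<theta> n y))\<^sup>2)"
    proof -
      have "integrable lborel (\<lambda>z::real. (s n)\<^sup>2 * exp (- z\<^sup>2 / 2))"
        unfolding exp_power2_eq_std_normal_density by simp
      then have "integrable lborel (\<lambda>z::real. (s n)\<^sup>2 * (exp (- z\<^sup>2 / 2))\<^sup>2)"
        by (rule Bochner_Integration.integrable_bound)
           (auto simp: power2_eq_square[of "exp _"] intro!: mult_left_mono mult_le_one)
      from lborel_integrable_real_affine[OF this, of "- s n" "s n * x"] show ?thesis
        using s[of n] by (simp add: \<theta>_def power_mult_distrib right_diff_distrib norm_mult)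
    qed
  qed
  have "(\<lambda>n. LINT \<xi>|lborel. H \<xi> * \<phi> n \<xi>) \<longlonglongrightarrow> (LINT \<xi>|lborel. H \<xi> * ((1 / sqrt (2 * pi)) *\<^sub>R iexp (\<xi> * x)))"
  proof (rule integral_dominated_convergence[where w = "\<lambda>\<xi>. cmod (H \<xi>) * (1 / sqrt (2 * pi))"])
    show "AE \<xi> in lborel. (\<lambda>n. H \<xi> * \<phi> n \<xi>) \<longlonglongrightarrow> H \<xi> * ((1 / sqrt (2 * pi)) *\<^sub>R iexp (\<xi> * x))"
    proof (rule AE_I2)
      fix \<xi> :: real
      have "(\<lambda>n. \<xi> / s n) \<longlonglongrightarrow> 0" unfolding s_def by real_asymp
      then have "(\<lambda>n. exp (- (\<xi> / s n)\<^sup>2 / 2)) \<longlonglongrightarrow> exp (- 0\<^sup>2 / 2)" by (intro tendsto_intros) simp_all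
      then have "(\<lambda>n. exp (- (\<xi> / s n)\<^sup>2 / 2)) \<longlonglongrightarrow> 1" by simp
      from tendsto_mult_left[OF this, of "1 / sqrt (2 * pi)"]
      have "(\<lambda>n. std_normal_density (\<xi> / s n)) \<longlonglongrightarrow> 1 / sqrt (2 * pi)"
        unfolding std_normal_density_def by simp
      then show "(\<lambda>n. H \<xi> * \<phi> n \<xi>) \<longlonglongrightarrow> H \<xi> * ((1 / sqrt (2 * pi)) *\<^sub>R iexp (\<xi> * x))"
        unfolding \<phi>_def by (intro tendsto_intros)
    qed
    show "AE \<xi> in lborel. norm (H \<xi> * \<phi> n \<xi>) \<le> cmod (H \<xi>) * (1 / sqrt (2 * pi))" for n
      unfolding norm_mult norm_\<phi> by (intro AE_I2 mult_left_mono dens_le norm_ge_zero)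
    show "integrable lborel (\<lambda>\<xi>. cmod (H \<xi>) * (1 / sqrt (2 * pi)))"
      using H by (intro integrable_mult_left integrable_norm)
  qed (use H in auto)
  moreover have "(\<lambda>n. LINT \<xi>|lborel. H \<xi> * \<phi> n \<xi>) \<longlonglongrightarrow> of_real (sqrt (2 * pi) * h x)"
  proof -
    have "(LINT y|lborel. of_real (h y) * \<theta> n y) = complex_of_real (LINT y|lborel. h y * (s n * exp (- (s n * (x - y))\<^sup>2 / 2)))" for n
      unfolding \<theta>_def by (simp only: of_real_mult[symmetric] integral_complex_of_real)
    then show ?thesis
      unfolding mult s_def
      using tendsto_of_real[OF gaussian_approximate_identity[OF h h2, of x]] by simp
  qed
  ultimately have "of_real (sqrt (2 * pi) * h x) = (LINT \<xi>|lborel. H \<xi> * ((1 / sqrt (2 * pi)) *\<^sub>R iexp (\<xi> * x)))"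
    using LIMSEQ_unique by blast
  also have "\<dots> = (LINT \<xi>|lborel. (iexp (\<xi> * x) * H \<xi>) * of_real (1 / sqrt (2 * pi)))"
    by (simp add: scaleR_conv_of_real mult_ac)
  also have "\<dots> = (LINT \<xi>|lborel. iexp (\<xi> * x) * H \<xi>) * of_real (1 / sqrt (2 * pi))"
    by (rule integral_mult_left_zero)
  finally have "of_real (sqrt (2 * pi) * h x) * of_real (1 / sqrt (2 * pi))
      = (LINT \<xi>|lborel. iexp (\<xi> * x) * H \<xi>) * of_real (1 / sqrt (2 * pi) * (1 / sqrt (2 * pi)))"
    by (simp only: of_real_mult mult.assoc)
  also have "1 / sqrt (2 * pi) * (1 / sqrt (2 * pi)) = 1 / (2 * pi)" by simp
  also have "of_real (sqrt (2 * pi) * h x) * of_real (1 / sqrt (2 * pi)) = complex_of_real (h x)"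
    unfolding of_real_mult[symmetric] by simp
  finally show ?thesis by simp
qed

section \<open>Sobolev embedding\<close>

text \<open>
Comparison with \<open>\<bar>\<xi>\<bar> powr (- 2 s)\<close> for \<open>\<bar>\<xi>\<bar> \<ge> 1\<close>; this is where \<open>s > 1/2\<close> enters.
\<close>

lemma integrable_Bessel_weight:
  fixes s :: real
  assumes s: "s > 1 / 2"
  shows "integrable lborel (\<lambda>\<xi>::real. (1 + \<xi>\<^sup>2) powr (- s))"
proof -
  define P :: "real \<Rightarrow> real" where "P \<xi> = \<xi> powr (- 2 * s) * indicator {1..} \<xi>" for \<xi>
  have "(\<integral>\<^sup>+\<xi>. ennreal (\<xi> powr (- 2 * s)) * indicator {1..} \<xi> \<partial>lborel) = ennreal (0 - 1 powr (1 - 2 * s) / (1 - 2 * s))"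
  proof (rule nn_integral_FTC_atLeast[where F = "\<lambda>x. x powr (1 - 2 * s) / (1 - 2 * s)"])
    show "((\<lambda>x. x powr (1 - 2 * s) / (1 - 2 * s)) has_real_derivative x powr (- 2 * s)) (at x)" if "1 \<le> x" for x
    proof -
      have "((\<lambda>x. x powr (1 - 2 * s)) has_real_derivative (1 - 2 * s) * x powr (1 - 2 * s - 1)) (at x)"
        by (rule has_real_derivative_powr) (use that in simp)
      from DERIV_cdivide[OF this, of "1 - 2 * s"] show ?thesis using s by simp
    qed
    show "((\<lambda>x. x powr (1 - 2 * s) / (1 - 2 * s)) \<longlongrightarrow> 0) at_top"
      using s by (auto intro!: tendsto_divide_zero tendsto_neg_powr filterlim_ident)
  qed auto
  then have "(\<integral>\<^sup>+\<xi>. ennreal (P \<xi>) \<partial>lborel) < \<infinity>"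
    by (simp add: P_def ennreal_mult' ennreal_indicator)
  moreover have [measurable]: "P \<in> borel_measurable borel" unfolding P_def[abs_def] by measurable
  ultimately have P: "integrable lborel P"
    by (intro integrableI_bounded) (auto simp: P_def abs_mult)
  have P': "integrable lborel (\<lambda>\<xi>. P (- \<xi>))"
    using lborel_integrable_real_affine[OF P, of "-1" 0] by simp
  have I: "integrable lborel (indicator {-1..1::real} :: real \<Rightarrow> real)"
    by (simp add: integrable_indicator_iff emeasure_lborel_Icc_eq)
  show ?thesis
  proof (rule Bochner_Integration.integrable_bound)
    show "integrable lborel (\<lambda>\<xi>. indicator {-1..1} \<xi> + P \<xi> + P (- \<xi>))" using I P P' by simp
    show "AE \<xi> in lborel. norm ((1 + \<xi>\<^sup>2) powr (- s)) \<le> norm (indicator {-1..1} \<xi> + P \<xi> + P (- \<xi>))"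
    proof (rule AE_I2)
      fix \<xi> :: real
      have P0: "P y \<ge> 0" for y by (simp add: P_def)
      have "(1 + \<xi>\<^sup>2) powr (- s) \<le> indicator {-1..1} \<xi> + P \<xi> + P (- \<xi>)"
      proof (cases "\<xi> \<in> {-1..1}")
        case True
        have "(1 + \<xi>\<^sup>2) powr (- s) \<le> (1 + \<xi>\<^sup>2) powr 0" using s by (intro powr_mono) auto
        then show ?thesis using True P0[of \<xi>] P0[of "- \<xi>"] by (simp add: add_nonneg_eq_0_iff split: if_splits)
      next
        case False
        then have a: "\<bar>\<xi>\<bar> \<ge> 1" by auto
        then have "(1 + \<xi>\<^sup>2) powr (- s) \<le> (\<bar>\<xi>\<bar> powr 2) powr (- s)"
          using s by (intro powr_mono2') (auto simp: )
        also have "\<dots> = \<bar>\<xi>\<bar> powr (- 2 * s)" unfolding powr_powr by simp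
        also have "\<dots> \<le> P \<xi> + P (- \<xi>)" using a P0[of \<xi>] P0[of "- \<xi>"] by (cases "\<xi> \<ge> 0") (auto simp: P_def)
        finally show ?thesis by (simp add: add.assoc add_increasing)
      qed
      then show "norm ((1 + \<xi>\<^sup>2) powr (- s)) \<le> norm (indicator {-1..1} \<xi> + P \<xi> + P (- \<xi>))" by simp
    qed
  qed simp
qed

lemma has_fourier_L2_fourier_L2:
  assumes "h \<in> sobolev_space s"
  shows "has_fourier_L2 h (fourier_L2 h)"
    and "integrable lborel (\<lambda>\<xi>. (1 + \<xi>\<^sup>2) powr s * (cmod (fourier_L2 h \<xi>))\<^sup>2)"
proof -
  obtain H where H: "has_fourier_L2 h H" and i: "integrable lborel (\<lambda>\<xi>. (1 + \<xi>\<^sup>2) powr s * (cmod (H \<xi>))\<^sup>2)"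
    using assms by (auto simp: sobolev_space_def)
  show F: "has_fourier_L2 h (fourier_L2 h)" unfolding fourier_L2_def using someI[of "has_fourier_L2 h", OF H] .
  have [measurable]: "H \<in> borel_measurable borel" "fourier_L2 h \<in> borel_measurable borel"
    using H F by (simp_all add: has_fourier_L2_iff)
  have "AE \<xi> in lborel. H \<xi> = fourier_L2 h \<xi>" by (rule has_fourier_L2_unique[OF H F])
  then have "AE \<xi> in lborel. (1 + \<xi>\<^sup>2) powr s * (cmod (H \<xi>))\<^sup>2 = (1 + \<xi>\<^sup>2) powr s * (cmod (fourier_L2 h \<xi>))\<^sup>2"
    by eventually_elim simp
  then show "integrable lborel (\<lambda>\<xi>. (1 + \<xi>\<^sup>2) powr s * (cmod (fourier_L2 h \<xi>))\<^sup>2)"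
    using i by (subst integrable_cong_AE[symmetric]) auto
qed

lemma sobolev_space_lincomb:
  assumes h: "h \<in> sobolev_space s" and k: "k \<in> sobolev_space s"
  shows "(\<lambda>x. a * h x + b * k x) \<in> sobolev_space s"
proof -
  let ?H = "fourier_L2 h" and ?K = "fourier_L2 k"
  note H = has_fourier_L2_fourier_L2[OF h] and K = has_fourier_L2_fourier_L2[OF k]
  have [measurable]: "?H \<in> borel_measurable borel" "?K \<in> borel_measurable borel"
    using H(1) K(1) by (simp_all add: has_fourier_L2_iff)
  have "integrable lborel (\<lambda>\<xi>. (1 + \<xi>\<^sup>2) powr s * (cmod (of_real a * ?H \<xi> + of_real b * ?K \<xi>))\<^sup>2)"
  proof (rule Bochner_Integration.integrable_bound)
    show "integrable lborel (\<lambda>\<xi>. 2 * a\<^sup>2 * ((1 + \<xi>\<^sup>2) powr s * (cmod (?H \<xi>))\<^sup>2)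
        + 2 * b\<^sup>2 * ((1 + \<xi>\<^sup>2) powr s * (cmod (?K \<xi>))\<^sup>2))" using H(2) K(2) by simp
    show "AE \<xi> in lborel. norm ((1 + \<xi>\<^sup>2) powr s * (cmod (of_real a * ?H \<xi> + of_real b * ?K \<xi>))\<^sup>2)
        \<le> norm (2 * a\<^sup>2 * ((1 + \<xi>\<^sup>2) powr s * (cmod (?H \<xi>))\<^sup>2) + 2 * b\<^sup>2 * ((1 + \<xi>\<^sup>2) powr s * (cmod (?K \<xi>))\<^sup>2))"
    proof (rule AE_I2)
      fix \<xi> :: real
      have "(1 + \<xi>\<^sup>2) powr s * (cmod (of_real a * ?H \<xi> + of_real b * ?K \<xi>))\<^sup>2
          \<le> (1 + \<xi>\<^sup>2) powr s * (2 * (cmod (of_real a * ?H \<xi>))\<^sup>2 + 2 * (cmod (of_real b * ?K \<xi>))\<^sup>2)"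
        by (intro mult_left_mono cmod_add_power2_le) simp
      also have "\<dots> = 2 * a\<^sup>2 * ((1 + \<xi>\<^sup>2) powr s * (cmod (?H \<xi>))\<^sup>2) + 2 * b\<^sup>2 * ((1 + \<xi>\<^sup>2) powr s * (cmod (?K \<xi>))\<^sup>2)"
        by (simp add: norm_mult power_mult_distrib distrib_left)
      finally show "norm ((1 + \<xi>\<^sup>2) powr s * (cmod (of_real a * ?H \<xi> + of_real b * ?K \<xi>))\<^sup>2)
          \<le> norm (2 * a\<^sup>2 * ((1 + \<xi>\<^sup>2) powr s * (cmod (?H \<xi>))\<^sup>2) + 2 * b\<^sup>2 * ((1 + \<xi>\<^sup>2) powr s * (cmod (?K \<xi>))\<^sup>2))"
        by simp
    qed
  qed measurable
  then show ?thesis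
    using has_fourier_L2_lincomb[OF H(1) K(1), of a b] by (auto simp: sobolev_space_def)
qed

text \<open>
Cauchy--Schwarz after splitting off the weight \<open>(1 + \<xi>\<^sup>2) powr (s/2)\<close>.  It is used with \<open>q = 1\<close> to bound a function
and with \<open>q = \<bar>\<xi>\<bar>\<close> to bound its derivative.
\<close>

lemma weighted_fourier_L1_bound:
  assumes h: "h \<in> sobolev_space s" and [measurable]: "q \<in> borel_measurable borel"
    and q: "integrable lborel (\<lambda>\<xi>. (q \<xi>)\<^sup>2 * (1 + \<xi>\<^sup>2) powr (- s))"
  shows "integrable lborel (\<lambda>\<xi>. q \<xi> * cmod (fourier_L2 h \<xi>))"
    and "(LINT \<xi>|lborel. q \<xi> * cmod (fourier_L2 h \<xi>)) \<le> sqrt (LINT \<xi>|lborel. (q \<xi>)\<^sup>2 * (1 + \<xi>\<^sup>2) powr (- s)) * sobolev_norm s h"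
proof -
  let ?H = "fourier_L2 h"
  note H = has_fourier_L2_fourier_L2[OF h]
  have [measurable]: "?H \<in> borel_measurable borel" using H(1) by (simp add: has_fourier_L2_iff)
  define F where "F \<xi> = q \<xi> * (1 + \<xi>\<^sup>2) powr (- s / 2)" for \<xi>
  define G where "G \<xi> = (1 + \<xi>\<^sup>2) powr (s / 2) * cmod (?H \<xi>)" for \<xi>
  have [measurable]: "F \<in> borel_measurable borel" "G \<in> borel_measurable borel"
    unfolding F_def G_def by measurable
  have sq: "((1 + \<xi>\<^sup>2) powr (a / 2))\<^sup>2 = (1 + \<xi>\<^sup>2) powr a" for \<xi> a :: real
    unfolding power2_eq_square powr_add[symmetric] by simp
  have F2: "(F \<xi>)\<^sup>2 = (q \<xi>)\<^sup>2 * (1 + \<xi>\<^sup>2) powr (- s)" for \<xi>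
    by (simp only: F_def power_mult_distrib sq)
  have G2: "(G \<xi>)\<^sup>2 = (1 + \<xi>\<^sup>2) powr s * (cmod (?H \<xi>))\<^sup>2" for \<xi>
    by (simp only: G_def power_mult_distrib sq)
  have "F \<xi> * G \<xi> = q \<xi> * cmod (?H \<xi>) * ((1 + \<xi>\<^sup>2) powr (- s / 2) * (1 + \<xi>\<^sup>2) powr (s / 2))" for \<xi>
    by (simp only: F_def G_def mult_ac)
  moreover have "(1 + \<xi>\<^sup>2) powr (- s / 2) * (1 + \<xi>\<^sup>2) powr (s / 2) = 1" for \<xi> :: real
    unfolding powr_add[symmetric] using sum_power2_eq_zero_iff[of 1 \<xi>] by simp
  ultimately have FG: "F \<xi> * G \<xi> = q \<xi> * cmod (?H \<xi>)" for \<xi> by simp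
  have i: "integrable lborel (\<lambda>\<xi>. (F \<xi>)\<^sup>2)" "integrable lborel (\<lambda>\<xi>. (G \<xi>)\<^sup>2)"
    using q H(2) by (simp_all only: F2 G2)
  show "integrable lborel (\<lambda>\<xi>. q \<xi> * cmod (?H \<xi>))"
    using integrable_mult_power2[of F lborel G] i by (simp add: FG)
  show "(LINT \<xi>|lborel. q \<xi> * cmod (?H \<xi>)) \<le> sqrt (LINT \<xi>|lborel. (q \<xi>)\<^sup>2 * (1 + \<xi>\<^sup>2) powr (- s)) * sobolev_norm s h"
    using integral_Cauchy_Schwarz[of F lborel G] i by (simp add: FG F2 G2 sobolev_norm_def)
qed

lemma continuous_on_LINT_dominated:
  fixes f :: "real \<Rightarrow> 'a \<Rightarrow> real"
  assumes "\<And>y. f y \<in> borel_measurable M"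
    and cont: "\<And>\<xi>. continuous_on UNIV (\<lambda>y. f y \<xi>)"
    and "integrable M w" and "\<And>y \<xi>. \<bar>f y \<xi>\<bar> \<le> w \<xi>"
  shows "continuous_on UNIV (\<lambda>y. LINT \<xi>|M. f y \<xi>)"
  unfolding continuous_on_sequentially comp_def
proof (intro ballI allI impI, elim conjE)
  fix X :: "nat \<Rightarrow> real" and a assume X: "X \<longlonglongrightarrow> a"
  show "(\<lambda>n. LINT \<xi>|M. f (X n) \<xi>) \<longlonglongrightarrow> (LINT \<xi>|M. f a \<xi>)"
  proof (rule integral_dominated_convergence[where w = w])
    show "AE \<xi> in M. (\<lambda>n. f (X n) \<xi>) \<longlonglongrightarrow> f a \<xi>"
    proof (rule AE_I2)
      fix \<xi>
      show "(\<lambda>n. f (X n) \<xi>) \<longlonglongrightarrow> f a \<xi>"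
        using cont[of \<xi>] X by (auto simp: continuous_on_sequentially comp_def)
    qed
  qed (use assms in auto)
qed

text \<open>
By the mean value theorem the bound on \<open>f'\<close> dominates the difference quotients.
\<close>

lemma has_real_derivative_LINT_dominated:
  fixes f f' :: "real \<Rightarrow> 'a \<Rightarrow> real"
  assumes int: "\<And>y. integrable M (f y)" and [measurable]: "f' x \<in> borel_measurable M"
    and deriv: "\<And>y \<xi>. ((\<lambda>y. f y \<xi>) has_real_derivative f' y \<xi>) (at y)"
    and w: "integrable M w" and bound: "\<And>y \<xi>. \<bar>f' y \<xi>\<bar> \<le> w \<xi>"
  shows "((\<lambda>y. LINT \<xi>|M. f y \<xi>) has_real_derivative (LINT \<xi>|M. f' x \<xi>)) (at x)"
  unfolding has_field_derivative_iff tendsto_at_iff_sequentially comp_def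
proof (intro allI impI)
  fix X :: "nat \<Rightarrow> real" assume X: "\<forall>i. X i \<in> UNIV - {x}" "X \<longlonglongrightarrow> x"
  have "(\<lambda>n. LINT \<xi>|M. (f (X n) \<xi> - f x \<xi>) / (X n - x)) \<longlonglongrightarrow> (LINT \<xi>|M. f' x \<xi>)"
  proof (rule integral_dominated_convergence[where w = w])
    show "AE \<xi> in M. (\<lambda>n. (f (X n) \<xi> - f x \<xi>) / (X n - x)) \<longlonglongrightarrow> f' x \<xi>"
    proof (rule AE_I2)
      fix \<xi>
      show "(\<lambda>n. (f (X n) \<xi> - f x \<xi>) / (X n - x)) \<longlonglongrightarrow> f' x \<xi>"
        using deriv[of \<xi> x] X unfolding has_field_derivative_iff tendsto_at_iff_sequentially comp_def by blast
    qed
    show "AE \<xi> in M. norm ((f (X n) \<xi> - f x \<xi>) / (X n - x)) \<le> w \<xi>" for n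
    proof (rule AE_I2)
      fix \<xi>
      have "norm (f (X n) \<xi> - f x \<xi>) \<le> w \<xi> * norm (X n - x)"
        by (rule field_differentiable_bound[of UNIV "\<lambda>y. f y \<xi>" "\<lambda>y. f' y \<xi>"])
           (use deriv bound in \<open>auto intro: has_field_derivative_at_within\<close>)
      then show "norm ((f (X n) \<xi> - f x \<xi>) / (X n - x)) \<le> w \<xi>"
        using X(1) by (simp add: divide_le_eq)
    qed
    show "(\<lambda>\<xi>. (f (X n) \<xi> - f x \<xi>) / (X n - x)) \<in> borel_measurable M" for n
      using int[THEN borel_measurable_integrable] by measurable
  qed (use w in auto)
  then show "(\<lambda>n. ((LINT \<xi>|M. f (X n) \<xi>) - (LINT \<xi>|M. f x \<xi>)) / (X n - x)) \<longlonglongrightarrow> (LINT \<xi>|M. f' x \<xi>)"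
    using int by simp
qed

lemma sobolev_inversion:
  assumes s: "s > 1 / 2" and h: "h \<in> sobolev_space s" and k: "continuous_on UNIV k" and eq: "AE x in lborel. h x = k x"
  shows "integrable lborel (\<lambda>\<xi>. cmod (fourier_L2 h \<xi>))"
    and "k x = (LINT \<xi>|lborel. cos (\<xi> * x) * Re (fourier_L2 h \<xi>) - sin (\<xi> * x) * Im (fourier_L2 h \<xi>)) / (2 * pi)"
proof -
  let ?H = "fourier_L2 h"
  have [measurable]: "k \<in> borel_measurable borel" using k by (rule borel_measurable_continuous_onI)
  have H: "has_fourier_L2 h ?H" by (rule has_fourier_L2_fourier_L2[OF h])
  then have [measurable]: "?H \<in> borel_measurable borel" by (simp add: has_fourier_L2_iff)
  show I: "integrable lborel (\<lambda>\<xi>. cmod (?H \<xi>))"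
    using weighted_fourier_L1_bound(1)[OF h, of "\<lambda>_. 1"] integrable_Bessel_weight[OF s] by simp
  then have I': "integrable lborel ?H" by (rule integrable_norm_cancel) simp
  have "integrable lborel (\<lambda>\<xi>. iexp (\<xi> * x) * ?H \<xi>)"
    by (rule Bochner_Integration.integrable_bound[OF I]) (auto simp: norm_mult)
  moreover have "complex_of_real (k x) = (LINT \<xi>|lborel. iexp (\<xi> * x) * ?H \<xi>) / (2 * pi)"
    by (rule fourier_inversion[OF has_fourier_L2_AE_cong[OF H eq] k I']) simp
  then have "k x = Re ((LINT \<xi>|lborel. iexp (\<xi> * x) * ?H \<xi>) / complex_of_real (2 * pi))"
    by (metis Re_complex_of_real)
  ultimately show "k x = (LINT \<xi>|lborel. cos (\<xi> * x) * Re (?H \<xi>) - sin (\<xi> * x) * Im (?H \<xi>)) / (2 * pi)"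
    by (simp add: Re_divide_of_real integral_Re[symmetric] Re_exp Im_exp del: of_real_mult)
qed

lemma abs_rotation_le: "\<bar>cos t * Re z - sin t * Im z\<bar> \<le> cmod z"
proof -
  have "cos t * Re z - sin t * Im z = Re (iexp t * z)" by (simp add: Re_exp Im_exp)
  also have "\<bar>\<dots>\<bar> \<le> cmod (iexp t * z)" by (rule abs_Re_le_cmod)
  finally show ?thesis by (simp add: norm_mult)
qed

text \<open>
The two functions \<open>h\<close> and \<open>k\<close> allow \<open>h\<close> to be an arbitrary representative of its class: the time
derivative of a solution is continuous only after a change on a null set.
\<close>

lemma sobolev_sup_bound:
  assumes s: "s > 1 / 2"
  obtains C where "\<And>h k x. h \<in> sobolev_space s \<Longrightarrow> continuous_on UNIV k \<Longrightarrow> AE x in lborel. h x = k x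
      \<Longrightarrow> \<bar>k x\<bar> \<le> C * sobolev_norm s h"
proof
  fix h k :: "real \<Rightarrow> real" and x
  assume h: "h \<in> sobolev_space s" and k: "continuous_on UNIV k" and eq: "AE x in lborel. h x = k x"
  let ?H = "fourier_L2 h"
  have H: "has_fourier_L2 h ?H" by (rule has_fourier_L2_fourier_L2[OF h])
  then have [measurable]: "?H \<in> borel_measurable borel" by (simp add: has_fourier_L2_iff)
  note I = sobolev_inversion[OF s h k eq]
  have "\<bar>LINT \<xi>|lborel. cos (\<xi> * x) * Re (?H \<xi>) - sin (\<xi> * x) * Im (?H \<xi>)\<bar> \<le> (LINT \<xi>|lborel. cmod (?H \<xi>))"
    by (intro order_trans[OF integral_abs_bound] integral_mono I(1) integrable_abs abs_rotation_le
        Bochner_Integration.integrable_bound[OF I(1)]) (auto simp: abs_rotation_le)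
  also have "\<dots> \<le> sqrt (LINT \<xi>|lborel. (1 + \<xi>\<^sup>2) powr (- s)) * sobolev_norm s h"
    using weighted_fourier_L1_bound(2)[OF h, of "\<lambda>_. 1"] integrable_Bessel_weight[OF s] by simp
  finally show "\<bar>k x\<bar> \<le> (sqrt (LINT \<xi>|lborel. (1 + \<xi>\<^sup>2) powr (- s)) / (2 * pi)) * sobolev_norm s h"
    unfolding I(2)[of x] by (simp add: divide_right_mono)
qed

text \<open>
Differentiate the inversion integral: the frequency times the transform is integrable because
\<open>\<xi>\<^sup>2 (1 + \<xi>\<^sup>2) powr (- s) \<le> (1 + \<xi>\<^sup>2) powr (- (s - 1))\<close> and \<open>s - 1 > 1/2\<close>.
\<close>

lemma sobolev_C1_embedding:
  assumes s: "s > 3 / 2"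
  obtains C where "\<And>h. h \<in> sobolev_space s \<Longrightarrow> continuous_on UNIV h \<Longrightarrow>
      (\<forall>x. (h has_real_derivative deriv h x) (at x)) \<and> continuous_on UNIV (deriv h) \<and>
      (\<forall>x. \<bar>deriv h x\<bar> \<le> C * sobolev_norm s h)"
proof
  fix h :: "real \<Rightarrow> real"
  assume h: "h \<in> sobolev_space s" and c: "continuous_on UNIV h"
  let ?H = "fourier_L2 h"
  have H: "has_fourier_L2 h ?H" by (rule has_fourier_L2_fourier_L2[OF h])
  then have [measurable]: "?H \<in> borel_measurable borel" by (simp add: has_fourier_L2_iff)
  have s': "s > 1 / 2" "s - 1 > 1 / 2" using s by simp_all
  note I = sobolev_inversion[OF s'(1) h c AE_I2, OF refl]
  have w: "integrable lborel (\<lambda>\<xi>::real. \<bar>\<xi>\<bar>\<^sup>2 * (1 + \<xi>\<^sup>2) powr (- s))"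
  proof (rule Bochner_Integration.integrable_bound[OF integrable_Bessel_weight[OF s'(2)]])
    show "AE \<xi> in lborel. norm (\<bar>\<xi>\<bar>\<^sup>2 * (1 + \<xi>\<^sup>2) powr (- s)) \<le> norm ((1 + \<xi>\<^sup>2) powr (- (s - 1)))"
    proof (rule AE_I2)
      fix \<xi> :: real
      have "(1 + \<xi>\<^sup>2) powr (- (s - 1)) = (1 + \<xi>\<^sup>2) powr 1 * (1 + \<xi>\<^sup>2) powr (- s)"
        unfolding powr_add[symmetric] by simp
      also have "(1 + \<xi>\<^sup>2) powr 1 = 1 + \<xi>\<^sup>2" by (simp add: add_nonneg_nonneg)
      finally show "norm (\<bar>\<xi>\<bar>\<^sup>2 * (1 + \<xi>\<^sup>2) powr (- s)) \<le> norm ((1 + \<xi>\<^sup>2) powr (- (s - 1)))"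
        by (simp add: mult_right_mono)
    qed
  qed measurable
  have W: "integrable lborel (\<lambda>\<xi>. \<bar>\<xi>\<bar> * cmod (?H \<xi>))"
    by (rule weighted_fourier_L1_bound(1)[OF h _ w]) measurable
  define f where "f y \<xi> = cos (\<xi> * y) * Re (?H \<xi>) - sin (\<xi> * y) * Im (?H \<xi>)" for y \<xi>
  \<comment> \<open>multiplication by \<open>\<i> \<xi>\<close> is written as a rotation by a quarter turn, so that \<open>abs_rotation_le\<close> applies again\<close>
  define f' where "f' y \<xi> = \<xi> * (cos (\<xi> * y + pi / 2) * Re (?H \<xi>) - sin (\<xi> * y + pi / 2) * Im (?H \<xi>))" for y \<xi>
  have f'_le: "\<bar>f' y \<xi>\<bar> \<le> \<bar>\<xi>\<bar> * cmod (?H \<xi>)" for y \<xi>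
    unfolding f'_def abs_mult by (intro mult_left_mono abs_rotation_le) simp
  have d: "((\<lambda>y. LINT \<xi>|lborel. f y \<xi>) has_real_derivative (LINT \<xi>|lborel. f' x \<xi>)) (at x)" for x
  proof (rule has_real_derivative_LINT_dominated[OF _ _ _ W f'_le])
    show "integrable lborel (f y)" for y
      unfolding f_def by (rule Bochner_Integration.integrable_bound[OF I(1)]) (auto simp: abs_rotation_le)
    show "((\<lambda>y. f y \<xi>) has_real_derivative f' y \<xi>) (at y)" for y \<xi>
      unfolding f_def f'_def cos_add sin_add
      by (auto intro!: derivative_eq_intros simp: algebra_simps)
  qed (simp add: f'_def)
  have hf: "h = (\<lambda>y. (LINT \<xi>|lborel. f y \<xi>) / (2 * pi))"
    unfolding f_def by (rule ext, rule I(2))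
  have hd: "(h has_real_derivative (LINT \<xi>|lborel. f' x \<xi>) / (2 * pi)) (at x)" for x
    unfolding hf by (rule DERIV_cdivide[OF d])
  then have dh: "deriv h = (\<lambda>x. (LINT \<xi>|lborel. f' x \<xi>) / (2 * pi))"
    by (auto intro: DERIV_imp_deriv)
  have "continuous_on UNIV (\<lambda>y. LINT \<xi>|lborel. f' y \<xi>)"
    by (rule continuous_on_LINT_dominated[OF _ _ W f'_le]) (auto simp: f'_def intro!: continuous_intros)
  then have "continuous_on UNIV (deriv h)" unfolding dh by (intro continuous_intros) auto
  moreover have "\<bar>deriv h x\<bar> \<le> (sqrt (LINT \<xi>|lborel. \<bar>\<xi>\<bar>\<^sup>2 * (1 + \<xi>\<^sup>2) powr (- s)) / (2 * pi)) * sobolev_norm s h" for x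
  proof -
    have "\<bar>LINT \<xi>|lborel. f' x \<xi>\<bar> \<le> (LINT \<xi>|lborel. \<bar>f' x \<xi>\<bar>)" by (rule integral_abs_bound)
    also have "\<dots> \<le> (LINT \<xi>|lborel. \<bar>\<xi>\<bar> * cmod (?H \<xi>))"
      by (intro integral_mono W f'_le integrable_abs Bochner_Integration.integrable_bound[OF W])
         (auto simp: f'_le abs_mult intro: order_trans[OF f'_le] simp: f'_def[abs_def] intro!: mult_left_mono abs_rotation_le)
    also have "\<dots> \<le> sqrt (LINT \<xi>|lborel. \<bar>\<xi>\<bar>\<^sup>2 * (1 + \<xi>\<^sup>2) powr (- s)) * sobolev_norm s h"
      by (rule weighted_fourier_L1_bound(2)[OF h _ w]) measurable
    finally show ?thesis unfolding dh by (simp add: divide_right_mono)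
  qed
  ultimately show "(\<forall>x. (h has_real_derivative deriv h x) (at x)) \<and> continuous_on UNIV (deriv h) \<and>
      (\<forall>x. \<bar>deriv h x\<bar> \<le> (sqrt (LINT \<xi>|lborel. \<bar>\<xi>\<bar>\<^sup>2 * (1 + \<xi>\<^sup>2) powr (- s)) / (2 * pi)) * sobolev_norm s h)"
    using hd dh by auto
qed

section \<open>Convolution with the kernel on half-lines\<close>

text \<open>
Convolution with the restriction of \<open>kernel_p\<close> to the positive half-line.  For bounded continuous
\<open>F\<close> it is the unique bounded solution of \<open>y' = F/2 - y\<close>.
\<close>

definition left_avg :: "(real \<Rightarrow> real) \<Rightarrow> real \<Rightarrow> real" where
  "left_avg F x = exp (- x) / 2 * (LINT y|lborel. indicator {..x} y * (exp y * F y))"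

text \<open>
Convolution with the restriction of \<open>kernel_p\<close> to the negative half-line, written as a reflection so
that its properties follow from those of \<open>left_avg\<close>.
\<close>

definition right_avg :: "(real \<Rightarrow> real) \<Rightarrow> real \<Rightarrow> real" where
  "right_avg F x = left_avg (\<lambda>y. F (- y)) (- x)"

lemma integral_exp_atMost:
  "integrable lborel (\<lambda>y::real. indicator {..x} y * exp y)" (is ?I)
  "(LINT y|lborel. indicator {..x} y * exp y) = exp (x::real)" (is ?E)
proof -
  define p where "p y = indicator {- x..} y * exp (- y)" for y :: real
  have "(\<integral>\<^sup>+y. ennreal (exp (- y)) * indicator {- x..} y \<partial>lborel) = ennreal (0 - (- exp (- (- x))))"
  proof (rule nn_integral_FTC_atLeast[where F = "\<lambda>y. - exp (- y)"])
    show "((\<lambda>y. - exp (- y)) has_real_derivative exp (- y)) (at y)" for y :: real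
      by (auto intro!: derivative_eq_intros)
    show "((\<lambda>y::real. - exp (- y)) \<longlongrightarrow> 0) at_top"
      using tendsto_minus[OF filterlim_compose[OF exp_at_bot filterlim_uminus_at_bot_at_top]] by simp
  qed auto
  moreover have "ennreal (p y) = ennreal (exp (- y)) * indicator {- x..} y" for y
    by (simp add: p_def indicator_def)
  ultimately have n: "(\<integral>\<^sup>+y. ennreal (p y) \<partial>lborel) = ennreal (exp x)" by simp
  have [measurable]: "p \<in> borel_measurable borel" unfolding p_def[abs_def] by measurable
  have p: "has_bochner_integral lborel p (exp x)"
    by (rule has_bochner_integral_nn_integral) (use n in \<open>auto simp: p_def\<close>)
  have "has_bochner_integral lborel (\<lambda>y. p (0 + (- 1) * y)) (exp x /\<^sub>R \<bar>- 1\<bar>)"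
    by (rule lborel_has_bochner_integral_real_affine_iff[THEN iffD1, OF _ p]) simp
  moreover have "p (0 + (- 1) * y) = indicator {..x} y * exp y" for y
    by (simp add: p_def indicator_def)
  ultimately have "has_bochner_integral lborel (\<lambda>y. indicator {..x} y * exp y) (exp x)" by simp
  then show ?I ?E by (simp_all add: has_bochner_integral_iff)
qed

lemma integrable_left_avg:
  fixes F :: "real \<Rightarrow> real"
  assumes F: "continuous_on UNIV F" and M: "\<And>x. \<bar>F x\<bar> \<le> M"
  shows "integrable lborel (\<lambda>y. indicator {..x} y * (exp y * F y))"
proof (rule Bochner_Integration.integrable_bound)
  have [measurable]: "F \<in> borel_measurable borel" using F by (rule borel_measurable_continuous_onI)
  show "(\<lambda>y. indicator {..x} y * (exp y * F y)) \<in> borel_measurable lborel" by measurable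
  show "integrable lborel (\<lambda>y. indicator {..x} y * exp y * M)"
    using integral_exp_atMost(1)[of x] by (rule integrable_mult_left)
  show "AE y in lborel. norm (indicator {..x} y * (exp y * F y)) \<le> norm (indicator {..x} y * exp y * M)"
    by (rule AE_I2) (auto simp: indicator_def abs_mult intro!: mult_left_mono order_trans[OF M abs_ge_self])
qed

lemma abs_left_avg_le:
  fixes F :: "real \<Rightarrow> real"
  assumes F: "continuous_on UNIV F" and M: "\<And>x. \<bar>F x\<bar> \<le> M"
  shows "\<bar>left_avg F x\<bar> \<le> M / 2"
proof -
  have "\<bar>LINT y|lborel. indicator {..x} y * (exp y * F y)\<bar> \<le> (LINT y|lborel. \<bar>indicator {..x} y * (exp y * F y)\<bar>)"
    by (rule integral_abs_bound)
  also have "\<dots> \<le> (LINT y|lborel. indicator {..x} y * exp y * M)"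
  proof (rule integral_mono)
    show "integrable lborel (\<lambda>y. \<bar>indicator {..x} y * (exp y * F y)\<bar>)"
      using integrable_left_avg[OF F M] by (rule integrable_abs)
    show "integrable lborel (\<lambda>y. indicator {..x} y * exp y * M)"
      using integral_exp_atMost(1)[of x] by (rule integrable_mult_left)
  qed (use M in \<open>auto simp: indicator_def abs_mult\<close>)
  also have "\<dots> = exp x * M"
    using integral_mult_left_zero[of lborel "\<lambda>y. indicator {..x} y * exp y" M] integral_exp_atMost(2)[of x] by simp
  finally have "exp (- x) / 2 * \<bar>LINT y|lborel. indicator {..x} y * (exp y * F y)\<bar> \<le> exp (- x) / 2 * (exp x * M)"
    by (rule mult_left_mono) simp
  also have "\<dots> = M / 2" by (simp add: exp_minus)
  finally show ?thesis by (simp add: left_avg_def abs_mult)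
qed

lemma left_avg_diff:
  fixes F G :: "real \<Rightarrow> real"
  assumes F: "continuous_on UNIV F" "\<And>x. \<bar>F x\<bar> \<le> M" and G: "continuous_on UNIV G" "\<And>x. \<bar>G x\<bar> \<le> N"
  shows "left_avg F x - left_avg G x = left_avg (\<lambda>y. F y - G y) x"
proof -
  have "(LINT y|lborel. indicator {..x} y * (exp y * (F y - G y)))
      = (LINT y|lborel. indicator {..x} y * (exp y * F y) - indicator {..x} y * (exp y * G y))"
    by (simp add: right_diff_distrib)
  also have "\<dots> = (LINT y|lborel. indicator {..x} y * (exp y * F y)) - (LINT y|lborel. indicator {..x} y * (exp y * G y))"
    by (intro Bochner_Integration.integral_diff integrable_left_avg[OF F] integrable_left_avg[OF G])
  finally show ?thesis by (simp add: left_avg_def right_diff_distrib)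
qed

lemma left_avg_has_derivative:
  fixes F :: "real \<Rightarrow> real"
  assumes F: "continuous_on UNIV F" and M: "\<And>x. \<bar>F x\<bar> \<le> M"
  shows "(left_avg F has_real_derivative F x / 2 - left_avg F x) (at x)"
proof -
  define A where "A x = (LINT y|lborel. indicator {..x} y * (exp y * F y))" for x
  let ?k = "\<lambda>y. exp y * F y"
  have k: "continuous_on S ?k" for S
    using F by (intro continuous_intros) (auto intro: continuous_on_subset)
  have A_eq: "A y = A (x - 1) + integral {x - 1..y} ?k" if "y \<ge> x - 1" for y
  proof -
    have i: "set_integrable lborel {x - 1..y} ?k"
      by (rule borel_integrable_atLeastAtMost') (rule k)
    have "A y - A (x - 1) = (LINT z|lborel. indicator {..y} z * ?k z - indicator {..x - 1} z * ?k z)"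
      unfolding A_def by (intro Bochner_Integration.integral_diff[symmetric] integrable_left_avg[OF F M])
    also have "\<dots> = (LINT z:{x - 1..y}|lborel. ?k z)"
      unfolding set_lebesgue_integral_def
    proof (rule integral_cong_AE)
      have [measurable]: "F \<in> borel_measurable borel" using F by (rule borel_measurable_continuous_onI)
      show "(\<lambda>z. indicator {..y} z * ?k z - indicator {..x - 1} z * ?k z) \<in> borel_measurable lborel" by measurable
      show "(\<lambda>z. indicator {x - 1..y} z *\<^sub>R ?k z) \<in> borel_measurable lborel" by measurable
      show "AE z in lborel. indicator {..y} z * ?k z - indicator {..x - 1} z * ?k z = indicator {x - 1..y} z *\<^sub>R ?k z"
        using AE_lborel_singleton[of "x - 1"]
        by eventually_elim (use that in \<open>auto simp: indicator_def\<close>)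
    qed
    also have "\<dots> = integral {x - 1..y} ?k" by (rule set_borel_integral_eq_integral(2)[OF i])
    finally show ?thesis by simp
  qed
  have "((\<lambda>y. integral {x - 1..y} ?k) has_real_derivative ?k x) (at x within {x - 1..x + 1})"
    by (rule integral_has_real_derivative[OF k]) simp
  then have "((\<lambda>y. integral {x - 1..y} ?k) has_real_derivative ?k x) (at x)"
    by (simp add: at_within_Icc_at)
  from DERIV_add[OF DERIV_const this, of "A (x - 1)"]
  have "((\<lambda>y. A (x - 1) + integral {x - 1..y} ?k) has_real_derivative ?k x) (at x)"
    by (simp only: add_0)
  then have A: "(A has_real_derivative ?k x) (at x)"
    by (rule has_field_derivative_transform_within_open[where S = "{x - 1<..}"]) (auto intro!: A_eq[symmetric])
  have "((\<lambda>y. exp (- y) / 2 * A y) has_real_derivative - exp (- x) / 2 * A x + ?k x * (exp (- x) / 2)) (at x)"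
    by (intro DERIV_mult A) (auto intro!: derivative_eq_intros)
  moreover have "- exp (- x) / 2 * A x + ?k x * (exp (- x) / 2) = F x / 2 - exp (- x) / 2 * A x"
    by (simp add: exp_minus)
  moreover have "left_avg F = (\<lambda>y. exp (- y) / 2 * A y)" by (simp add: fun_eq_iff left_avg_def A_def)
  ultimately show ?thesis by (simp only:)
qed

lemma continuous_on_reflect: "continuous_on UNIV F \<Longrightarrow> continuous_on UNIV (\<lambda>y::real. F (- y) :: real)"
  by (rule continuous_on_compose2[of UNIV F UNIV uminus]) (auto intro: continuous_intros)

lemma right_avg_has_derivative:
  assumes F: "continuous_on UNIV F" and M: "\<And>x. \<bar>F x\<bar> \<le> M"
  shows "(right_avg F has_real_derivative right_avg F x - F x / 2) (at x)"
proof -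
  have "((\<lambda>y. left_avg (\<lambda>y. F (- y)) (- y)) has_real_derivative (F (- (- x)) / 2 - left_avg (\<lambda>y. F (- y)) (- x)) * (- 1)) (at x)"
    by (rule DERIV_chain2[OF left_avg_has_derivative[OF continuous_on_reflect[OF F] M]])
       (auto intro!: derivative_eq_intros)
  then show ?thesis by (simp add: right_avg_def[abs_def])
qed

lemma right_avg_eq:
  "right_avg F x = exp x / 2 * (LINT y|lborel. indicator {x..} y * (exp (- y) * F y))"
proof -
  have "(LINT y|lborel. indicator {..- x} y * (exp y * F (- y)))
      = (LINT y|lborel. indicator {..- x} (0 + (- 1) * y) * (exp (0 + (- 1) * y) * F (- (0 + (- 1) * y))))"
    using lborel_integral_real_affine[of "-1" "\<lambda>y. indicator {..- x} y * (exp y * F (- y))" 0] by simp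
  also have "(\<lambda>y. indicator {..- x} (0 + (- 1) * y) * (exp (0 + (- 1) * y) * F (- (0 + (- 1) * y))))
      = (\<lambda>y. indicator {x..} y * (exp (- y) * F y))"
    by (simp add: fun_eq_iff indicator_def)
  finally show ?thesis by (simp add: right_avg_def left_avg_def)
qed

lemma convolution_kernel_p_eq:
  fixes F :: "real \<Rightarrow> real"
  assumes F: "continuous_on UNIV F" and M: "\<And>x. \<bar>F x\<bar> \<le> M"
  shows "Defs.convolution kernel_p F x = left_avg F x + right_avg F x"
proof -
  have [measurable]: "F \<in> borel_measurable borel" using F by (rule borel_measurable_continuous_onI)
  have i1: "integrable lborel (\<lambda>y. exp (- x) / 2 * (indicator {..x} y * (exp y * F y)))"
    using integrable_left_avg[OF F M] by (rule integrable_mult_right)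
  have "integrable lborel (\<lambda>y. indicator {..- x} (0 + (- 1) * y) * (exp (0 + (- 1) * y) * F (- (0 + (- 1) * y))))"
    by (rule lborel_integrable_real_affine[OF integrable_left_avg[OF continuous_on_reflect[OF F] M]]) simp
  also have "(\<lambda>y. indicator {..- x} (0 + (- 1) * y) * (exp (0 + (- 1) * y) * F (- (0 + (- 1) * y))))
      = (\<lambda>y. indicator {x..} y * (exp (- y) * F y))"
    by (simp add: fun_eq_iff indicator_def)
  finally have i2: "integrable lborel (\<lambda>y. exp x / 2 * (indicator {x..} y * (exp (- y) * F y)))"
    by (rule integrable_mult_right)
  have "Defs.convolution kernel_p F x
      = (LINT y|lborel. exp (- x) / 2 * (indicator {..x} y * (exp y * F y)) + exp x / 2 * (indicator {x..} y * (exp (- y) * F y)))"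
    unfolding Defs.convolution_def
  proof (rule integral_cong_AE)
    show "AE y in lborel. kernel_p (x - y) * F y
        = exp (- x) / 2 * (indicator {..x} y * (exp y * F y)) + exp x / 2 * (indicator {x..} y * (exp (- y) * F y))"
      using AE_lborel_singleton[of x]
    proof eventually_elim
      case (elim y)
      show ?case
      proof (cases "y < x")
        case True
        moreover have "exp (y - x) = exp (- x) * exp y" by (simp flip: exp_add)
        ultimately show ?thesis by (simp add: kernel_p_def)
      next
        case False
        then have "x < y" using elim by simp
        moreover have "exp (x - y) = exp x * exp (- y)" by (simp flip: exp_add)
        ultimately show ?thesis by (simp add: kernel_p_def)
      qed
    qed
    show "(\<lambda>y. kernel_p (x - y) * F y) \<in> borel_measurable lborel"
      unfolding kernel_p_def by measurable
    show "(\<lambda>y. exp (- x) / 2 * (indicator {..x} y * (exp y * F y)) + exp x / 2 * (indicator {x..} y * (exp (- y) * F y)))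
        \<in> borel_measurable lborel" by measurable
  qed
  also have "\<dots> = (LINT y|lborel. exp (- x) / 2 * (indicator {..x} y * (exp y * F y)))
      + (LINT y|lborel. exp x / 2 * (indicator {x..} y * (exp (- y) * F y)))"
    by (rule Bochner_Integration.integral_add[OF i1 i2])
  also have "\<dots> = left_avg F x + right_avg F x"
    unfolding left_avg_def right_avg_eq by (simp only: integral_mult_right_zero)
  finally show ?thesis .
qed

lemma deriv_convolution_kernel_p:
  fixes F :: "real \<Rightarrow> real"
  assumes F: "continuous_on UNIV F" and M: "\<And>x. \<bar>F x\<bar> \<le> M"
  shows "deriv (Defs.convolution kernel_p F) x = right_avg F x - left_avg F x"
proof -
  have "Defs.convolution kernel_p F = (\<lambda>x. left_avg F x + right_avg F x)"
    using convolution_kernel_p_eq[OF assms] by (simp add: fun_eq_iff)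
  moreover have "((\<lambda>x. left_avg F x + right_avg F x) has_real_derivative
      (F x / 2 - left_avg F x) + (right_avg F x - F x / 2)) (at x)"
    by (intro DERIV_add left_avg_has_derivative[OF assms] right_avg_has_derivative[OF assms])
  ultimately show ?thesis by (simp add: DERIV_imp_deriv)
qed

text \<open>
The difference \<open>D = 2 \<kappa> (left_avg F - c/2) - w\<close> is bounded and satisfies \<open>D + D' \<ge> 0\<close>.  Hence \<open>e\<^sup>x D(x)\<close> is
nondecreasing with limit 0 at \<open>-\<infinity>\<close>, and so nonnegative.
\<close>

lemma left_avg_lower_bound:
  fixes F w w' :: "real \<Rightarrow> real"
  assumes F: "continuous_on UNIV F" and M: "\<And>x. \<bar>F x\<bar> \<le> M"
    and w: "\<And>x. (w has_real_derivative w' x) (at x)" and B: "\<And>x. \<bar>w x\<bar> \<le> B"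
    and le: "\<And>x. w x + w' x \<le> \<kappa> * (F x - c)"
  shows "w x \<le> 2 * \<kappa> * (left_avg F x - c / 2)"
proof -
  define D where "D x = 2 * \<kappa> * (left_avg F x - c / 2) - w x" for x
  define N where "N = 2 * \<bar>\<kappa>\<bar> * (M / 2 + \<bar>c\<bar> / 2) + B"
  have D': "(D has_real_derivative 2 * \<kappa> * (F x / 2 - left_avg F x) - w' x) (at x)" for x
    unfolding D_def by (auto intro!: derivative_eq_intros left_avg_has_derivative[OF F M] w)
  have bound: "\<bar>D x\<bar> \<le> N" for x
  proof -
    have "\<bar>left_avg F x - c / 2\<bar> \<le> M / 2 + \<bar>c\<bar> / 2" using abs_left_avg_le[OF F M, of x] by linarith
    then have "\<bar>2 * \<kappa> * (left_avg F x - c / 2)\<bar> \<le> 2 * \<bar>\<kappa>\<bar> * (M / 2 + \<bar>c\<bar> / 2)"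
      unfolding abs_mult by (intro mult_mono) auto
    then show ?thesis using B[of x] unfolding D_def N_def by linarith
  qed
  have mono: "exp y * D y \<le> exp x * D x" if "y \<le> x" for y
  proof (rule DERIV_nonneg_imp_nondecreasing[OF that])
    fix z
    have "((\<lambda>z. exp z * D z) has_real_derivative exp z * (D z + (2 * \<kappa> * (F z / 2 - left_avg F z) - w' z))) (at z)"
      by (auto intro!: derivative_eq_intros D' simp: algebra_simps)
    moreover have "D z + (2 * \<kappa> * (F z / 2 - left_avg F z) - w' z) = \<kappa> * (F z - c) - (w z + w' z)"
      by (simp add: D_def algebra_simps)
    ultimately show "\<exists>y. ((\<lambda>z. exp z * D z) has_real_derivative y) (at z) \<and> 0 \<le> y"
      using le[of z] by (intro exI conjI) auto
  qed
  have "((\<lambda>y. - (exp y * N)) \<longlongrightarrow> - (0 * N)) at_bot"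
    by (intro tendsto_intros exp_at_bot)
  moreover have "eventually (\<lambda>y. - (exp y * N) \<le> exp x * D x) at_bot"
    using eventually_le_at_bot[of x]
  proof eventually_elim
    case (elim y)
    have "- (exp y * N) \<le> exp y * D y" using mult_left_mono[of "- N" "D y" "exp y"] bound[of y] by simp
    then show ?case using mono[OF elim] by linarith
  qed
  ultimately have "- (0 * N) \<le> exp x * D x" by (intro tendsto_upperbound) auto
  then show ?thesis by (simp add: D_def zero_le_mult_iff not_le)
qed

lemma right_avg_lower_bound:
  fixes F w w' :: "real \<Rightarrow> real"
  assumes F: "continuous_on UNIV F" and M: "\<And>x. \<bar>F x\<bar> \<le> M"
    and w: "\<And>x. (w has_real_derivative w' x) (at x)" and B: "\<And>x. \<bar>w x\<bar> \<le> B"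
    and le: "\<And>x. w x - w' x \<le> \<kappa> * (F x - c)"
  shows "w x \<le> 2 * \<kappa> * (right_avg F x - c / 2)"
proof -
  have "((\<lambda>y. w (- y)) has_real_derivative - w' (- y)) (at y)" for y
  proof -
    have "((\<lambda>y. w (- y)) has_real_derivative w' (- y) * (- 1)) (at y)"
      by (rule DERIV_chain2[where f = w and g = uminus, OF w]) (auto intro!: derivative_eq_intros)
    then show ?thesis by simp
  qed
  from left_avg_lower_bound[OF continuous_on_reflect[OF F] M this B, of \<kappa> c "- x"]
  show ?thesis using le by (simp add: right_avg_def)
qed

section \<open>Curves of bounded functions and their characteristics\<close>

text \<open>
Continuous curves \<open>[0,T] \<rightarrow> C\<^sub>b(\<real>)\<close> for the sup norm.  They are kept as functions of \<open>(t,x)\<close>, rather than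
maps into a type of bounded continuous functions, because they are multiplied and composed pointwise.
\<close>

definition uniform_curve :: "real \<Rightarrow> (real \<Rightarrow> real \<Rightarrow> real) \<Rightarrow> bool" where
  "uniform_curve T w \<longleftrightarrow> (\<forall>t\<in>{0..T}. continuous_on UNIV (w t) \<and> bounded (range (w t)) \<and>
      uniform_limit UNIV w (w t) (at t within {0..T}))"

lemma uniform_curve_continuous: "uniform_curve T w \<Longrightarrow> t \<in> {0..T} \<Longrightarrow> continuous_on UNIV (w t)"
  by (simp add: uniform_curve_def)

lemma uniform_curve_limit: "uniform_curve T w \<Longrightarrow> t \<in> {0..T} \<Longrightarrow> uniform_limit UNIV w (w t) (at t within {0..T})"
  by (simp add: uniform_curve_def)

text \<open>
A uniform limit of bounded functions is locally bounded in time, and \<open>[0,T]\<close> is compact.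
\<close>

lemma uniform_curve_bounded:
  assumes w: "uniform_curve T w"
  obtains M where "\<And>t x. t \<in> {0..T} \<Longrightarrow> \<bar>w t x\<bar> \<le> M"
proof -
  have "\<exists>A M. open A \<and> t \<in> A \<and> (\<forall>\<tau>\<in>A \<inter> {0..T}. \<forall>x. \<bar>w \<tau> x\<bar> \<le> M)" if t: "t \<in> {0..T}" for t
  proof -
    obtain M where M: "\<And>x. \<bar>w t x\<bar> \<le> M"
    proof -
      have "bounded (range (w t))" using w t by (simp add: uniform_curve_def)
      then obtain M where "\<forall>v\<in>range (w t). norm v \<le> M" unfolding bounded_iff by blast
      then show ?thesis by (intro that[of M]) simp
    qed
    have "eventually (\<lambda>\<tau>. \<forall>x\<in>UNIV. dist (w \<tau> x) (w t x) < 1) (at t within {0..T})"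
      using uniform_limitD[OF uniform_curve_limit[OF w t], of 1] by simp
    then obtain A where A: "open A" "t \<in> A" "\<And>\<tau>. \<tau> \<in> A \<Longrightarrow> \<tau> \<noteq> t \<Longrightarrow> \<tau> \<in> {0..T} \<Longrightarrow> \<forall>x. dist (w \<tau> x) (w t x) < 1"
      unfolding eventually_at_topological by blast
    have "\<bar>w \<tau> x\<bar> \<le> M + 1" if "\<tau> \<in> A \<inter> {0..T}" for \<tau> x
    proof (cases "\<tau> = t")
      case True
      then show ?thesis using M[of x] by simp
    next
      case False
      then have "\<bar>w \<tau> x - w t x\<bar> < 1" using A(3)[of \<tau>] that by (simp add: dist_real_def)
      then show ?thesis using M[of x] by linarith
    qed
    then show ?thesis using A(1,2) by blast
  qed
  then obtain A M where AM: "\<And>t. t \<in> {0..T} \<Longrightarrow> open (A t)" "\<And>t. t \<in> {0..T} \<Longrightarrow> t \<in> A t"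
    "\<And>t \<tau> x. t \<in> {0..T} \<Longrightarrow> \<tau> \<in> A t \<inter> {0..T} \<Longrightarrow> \<bar>w \<tau> x\<bar> \<le> M t"
    by metis
  obtain C where C: "C \<subseteq> {0..T}" "finite C" "{0..T} \<subseteq> (\<Union>t\<in>C. A t)"
    by (rule compactE_image[of "{0..T}" "{0..T}" A]) (use AM in auto)
  show thesis
  proof (rule that)
    fix t x assume t: "t \<in> {0..T}"
    then obtain c where c: "c \<in> C" "t \<in> A c" using C by blast
    have "\<bar>w t x\<bar> \<le> M c" by (rule AM(3)[of c]) (use c t C in auto)
    also have "\<dots> \<le> Max (insert 0 (M ` C))" using c C by simp
    finally show "\<bar>w t x\<bar> \<le> Max (insert 0 (M ` C))" .
  qed
qed

lemma uniform_curveI: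
  assumes "\<And>t. t \<in> {0..T} \<Longrightarrow> continuous_on UNIV (w t)"
    and "\<And>t x. t \<in> {0..T} \<Longrightarrow> \<bar>w t x\<bar> \<le> M"
    and "\<And>t e. t \<in> {0..T} \<Longrightarrow> e > 0 \<Longrightarrow> eventually (\<lambda>\<tau>. \<forall>x. \<bar>w \<tau> x - w t x\<bar> \<le> e) (at t within {0..T})"
  shows "uniform_curve T w"
  unfolding uniform_curve_def
proof (intro ballI conjI)
  fix t assume t: "t \<in> {0..T}"
  show "bounded (range (w t))" unfolding bounded_iff using assms(2)[OF t] by auto
  show "uniform_limit UNIV w (w t) (at t within {0..T})"
  proof (rule uniform_limitI)
    fix e :: real assume "e > 0"
    then have "eventually (\<lambda>\<tau>. \<forall>x. \<bar>w \<tau> x - w t x\<bar> \<le> e / 2) (at t within {0..T})"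
      by (intro assms(3) t) simp
    then show "eventually (\<lambda>\<tau>. \<forall>x\<in>UNIV. dist (w \<tau> x) (w t x) < e) (at t within {0..T})"
    proof eventually_elim
      case (elim \<tau>)
      show ?case
      proof
        fix x
        show "dist (w \<tau> x) (w t x) < e" using spec[OF elim, of x] \<open>e > 0\<close> by (simp add: dist_real_def)
      qed
    qed
  qed
qed (rule assms)

lemma uniform_curve_eventually:
  assumes "uniform_curve T w" "t \<in> {0..T}" "e > 0"
  shows "eventually (\<lambda>\<tau>. \<forall>x. \<bar>w \<tau> x - w t x\<bar> < e) (at t within {0..T})"
  using uniform_limitD[OF uniform_curve_limit[OF assms(1,2)] assms(3)] by (simp add: dist_real_def)

lemma eventually_at_within_Icc: "eventually (\<lambda>\<tau>. \<tau> \<in> {0..T}) (at t within {0..T::real})"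
  by (simp add: eventually_at_filter)

text \<open>
Both curves take values in a compact box, on which \<open>k\<close> is uniformly continuous.
\<close>

lemma uniform_curve_compose2:
  assumes k: "continuous_on UNIV (\<lambda>(a, b). k a b)" and v: "uniform_curve T v" and w: "uniform_curve T w"
  shows "uniform_curve T (\<lambda>t x. k (v t x) (w t x))"
proof -
  obtain M N where M: "\<And>t x. t \<in> {0..T} \<Longrightarrow> \<bar>v t x\<bar> \<le> M" and N: "\<And>t x. t \<in> {0..T} \<Longrightarrow> \<bar>w t x\<bar> \<le> N"
    using uniform_curve_bounded[OF v] uniform_curve_bounded[OF w] by metis
  let ?B = "{- M..M} \<times> {- N..N}"
  have B: "compact ?B" by (intro compact_Times compact_Icc)
  have kB: "continuous_on ?B (\<lambda>(a, b). k a b)" using k by (rule continuous_on_subset) simp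
  have vw: "(v t x, w t x) \<in> ?B" if "t \<in> {0..T}" for t x
    using M[OF that, of x] N[OF that, of x] by auto
  obtain P where P: "\<And>p. p \<in> ?B \<Longrightarrow> \<bar>case p of (a, b) \<Rightarrow> k a b\<bar> \<le> P"
    using compact_imp_bounded[OF compact_continuous_image[OF kB B]] unfolding bounded_iff by auto
  show ?thesis
  proof (rule uniform_curveI)
    fix t assume t: "t \<in> {0..T}"
    have "continuous_on UNIV (\<lambda>x. (v t x, w t x))"
      by (intro continuous_on_Pair uniform_curve_continuous[OF v t] uniform_curve_continuous[OF w t])
    from continuous_on_compose2[OF k this]
    show "continuous_on UNIV (\<lambda>x. k (v t x) (w t x))" by simp
    show "\<bar>k (v t x) (w t x)\<bar> \<le> P" for x using P[OF vw[OF t, of x]] by simp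
    fix e :: real assume e: "e > 0"
    obtain d where d: "d > 0" "\<And>p q. p \<in> ?B \<Longrightarrow> q \<in> ?B \<Longrightarrow> dist q p < d \<Longrightarrow>
        dist (case q of (a, b) \<Rightarrow> k a b) (case p of (a, b) \<Rightarrow> k a b) < e"
      using compact_uniformly_continuous[OF kB B] e unfolding uniformly_continuous_on_def by metis
    have d2: "d / 2 > 0" using d by simp
    show "eventually (\<lambda>\<tau>. \<forall>x. \<bar>k (v \<tau> x) (w \<tau> x) - k (v t x) (w t x)\<bar> \<le> e) (at t within {0..T})"
      using uniform_curve_eventually[OF v t d2] uniform_curve_eventually[OF w t d2] eventually_at_within_Icc
    proof eventually_elim
      case (elim \<tau>)
      show ?case
      proof
        fix x
        have "dist (v \<tau> x, w \<tau> x) (v t x, w t x) \<le> \<bar>v \<tau> x - v t x\<bar> + \<bar>w \<tau> x - w t x\<bar>"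
          unfolding dist_Pair_Pair dist_real_def
          using sqrt_sum_squares_le_sum_abs[of "v \<tau> x - v t x" "w \<tau> x - w t x"] by simp
        also have "\<dots> < d" using spec[OF elim(1), of x] spec[OF elim(2), of x] by linarith
        finally show "\<bar>k (v \<tau> x) (w \<tau> x) - k (v t x) (w t x)\<bar> \<le> e"
          using d(2)[OF vw[OF t, of x] vw[OF elim(3), of x]] by (simp add: dist_real_def)
      qed
    qed
  qed
qed

lemma uniform_curve_compose:
  assumes "continuous_on UNIV k" and w: "uniform_curve T w"
  shows "uniform_curve T (\<lambda>t x. k (w t x))"
proof (rule uniform_curve_compose2[where k = "\<lambda>a b. k a", OF _ w w])
  show "continuous_on UNIV (\<lambda>(a, b). k a :: real)" for b :: "real set"
    unfolding case_prod_beta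
    by (rule continuous_on_compose2[OF assms(1) continuous_on_fst[OF continuous_on_id]]) simp
qed

lemma uniform_curve_add: "uniform_curve T v \<Longrightarrow> uniform_curve T w \<Longrightarrow> uniform_curve T (\<lambda>t x. v t x + w t x)"
  by (rule uniform_curve_compose2[where k = "\<lambda>a b. a + b"]) (auto simp: case_prod_beta intro!: continuous_intros)

lemma uniform_curve_diff: "uniform_curve T v \<Longrightarrow> uniform_curve T w \<Longrightarrow> uniform_curve T (\<lambda>t x. v t x - w t x)"
  by (rule uniform_curve_compose2[where k = "\<lambda>a b. a - b"]) (auto simp: case_prod_beta intro!: continuous_intros)

lemma uniform_curve_mult: "uniform_curve T v \<Longrightarrow> uniform_curve T w \<Longrightarrow> uniform_curve T (\<lambda>t x. v t x * w t x)"
  by (rule uniform_curve_compose2[where k = "\<lambda>a b. a * b"]) (auto simp: case_prod_beta intro!: continuous_intros)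

lemma uniform_curve_left_avg:
  assumes w: "uniform_curve T w"
  shows "uniform_curve T (\<lambda>t. left_avg (w t))"
proof -
  obtain M where M: "\<And>t x. t \<in> {0..T} \<Longrightarrow> \<bar>w t x\<bar> \<le> M" using uniform_curve_bounded[OF w] by blast
  show ?thesis
  proof (rule uniform_curveI)
    fix t assume t: "t \<in> {0..T}"
    note wt = uniform_curve_continuous[OF w t]
    show "continuous_on UNIV (left_avg (w t))"
      by (rule DERIV_continuous_on) (rule has_field_derivative_at_within[OF left_avg_has_derivative[OF wt M[OF t]]])
    show "\<bar>left_avg (w t) x\<bar> \<le> M / 2" for x by (rule abs_left_avg_le[OF wt M[OF t]])
    fix e :: real assume e: "e > 0"
    show "eventually (\<lambda>\<tau>. \<forall>x. \<bar>left_avg (w \<tau>) x - left_avg (w t) x\<bar> \<le> e) (at t within {0..T})"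
      using uniform_curve_eventually[OF w t e] eventually_at_within_Icc
    proof eventually_elim
      case (elim \<tau>)
      note w\<tau> = uniform_curve_continuous[OF w elim(2)]
      show ?case
      proof
        fix x
        have "\<bar>left_avg (\<lambda>y. w \<tau> y - w t y) x\<bar> \<le> e / 2"
          by (rule abs_left_avg_le) (use elim(1) in \<open>auto intro!: continuous_intros wt w\<tau> less_imp_le\<close>)
        then show "\<bar>left_avg (w \<tau>) x - left_avg (w t) x\<bar> \<le> e"
          using left_avg_diff[OF w\<tau> M[OF elim(2)] wt M[OF t], of x] e by simp
      qed
    qed
  qed
qed

lemma uniform_curve_reflect:
  assumes w: "uniform_curve T w"
  shows "uniform_curve T (\<lambda>t x. w t (- x))"
proof -
  obtain M where M: "\<And>t x. t \<in> {0..T} \<Longrightarrow> \<bar>w t x\<bar> \<le> M" using uniform_curve_bounded[OF w] by blast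
  show ?thesis
  proof (rule uniform_curveI)
    fix t e :: real assume t: "t \<in> {0..T}" and e: "e > 0"
    show "eventually (\<lambda>\<tau>. \<forall>x. \<bar>w \<tau> (- x) - w t (- x)\<bar> \<le> e) (at t within {0..T})"
      using uniform_curve_eventually[OF w t e] by eventually_elim (auto intro: less_imp_le)
  next
    fix t assume t: "t \<in> {0..T}"
    show "continuous_on UNIV (\<lambda>x. w t (- x))"
      by (rule continuous_on_reflect[OF uniform_curve_continuous[OF w t]])
    show "\<bar>w t (- x)\<bar> \<le> M" for x by (rule M[OF t])
  qed
qed

lemma uniform_curve_right_avg:
  assumes w: "uniform_curve T w"
  shows "uniform_curve T (\<lambda>t. right_avg (w t))"
  using uniform_curve_reflect[OF uniform_curve_left_avg[OF uniform_curve_reflect[OF w]]]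
  by (simp add: right_avg_def[abs_def])

lemma uniform_curve_joint_continuous:
  assumes w: "uniform_curve T w"
  shows "continuous_on ({0..T} \<times> UNIV) (\<lambda>(t, x). w t x)"
  unfolding continuous_on_iff
proof (intro ballI allI impI)
  fix p :: "real \<times> real" and e :: real
  assume p: "p \<in> {0..T} \<times> UNIV" and e: "e > 0"
  obtain t x where tx: "p = (t, x)" and t: "t \<in> {0..T}" using p by auto
  have e2: "e / 2 > 0" using e by simp
  obtain d1 where d1: "d1 > 0" "\<And>y. dist y x < d1 \<Longrightarrow> dist (w t y) (w t x) < e / 2"
    using uniform_curve_continuous[OF w t] e2 unfolding continuous_on_iff by (metis UNIV_I)
  obtain d2 where d2: "d2 > 0" "\<And>\<tau> y. \<tau> \<in> {0..T} \<Longrightarrow> \<tau> \<noteq> t \<Longrightarrow> dist \<tau> t < d2 \<Longrightarrow> \<bar>w \<tau> y - w t y\<bar> < e / 2"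
    using uniform_curve_eventually[OF w t e2] unfolding eventually_at by blast
  show "\<exists>d>0. \<forall>p'\<in>{0..T} \<times> UNIV. dist p' p < d \<longrightarrow> dist (case p' of (t, x) \<Rightarrow> w t x) (case p of (t, x) \<Rightarrow> w t x) < e"
  proof (intro exI[of _ "min d1 d2"] conjI ballI impI)
    fix p' assume p': "p' \<in> {0..T} \<times> UNIV" "dist p' p < min d1 d2"
    obtain \<tau> y where ty: "p' = (\<tau>, y)" and \<tau>: "\<tau> \<in> {0..T}" using p' by auto
    have "dist \<tau> t < d2" "dist y x < d1"
      using p'(2) dist_fst_le[of p' p] dist_snd_le[of p' p] by (auto simp: tx ty)
    then have "\<bar>w \<tau> y - w t y\<bar> < e / 2" "\<bar>w t y - w t x\<bar> < e / 2"
      using d1 d2(2)[OF \<tau>, of y] e2 by (cases "\<tau> = t"; auto simp: dist_real_def)+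
    then show "dist (case p' of (t, x) \<Rightarrow> w t x) (case p of (t, x) \<Rightarrow> w t x) < e"
      unfolding tx ty case_prod_conv dist_real_def by linarith
  qed (use d1 d2 in simp)
qed

lemma uniform_curve_along:
  assumes w: "uniform_curve T w" and q: "continuous_on {0..T} q"
  shows "continuous_on {0..T} (\<lambda>t. w t (q t))"
  using continuous_on_compose2[OF uniform_curve_joint_continuous[OF w] continuous_on_Pair[OF continuous_on_id q]]
  by auto

text \<open>
Uniform continuity of \<open>(t,h) \<mapsto> w(t, q(t) + h)\<close> on the compact rectangle \<open>[0,T] \<times> [-1,1]\<close>.
\<close>

lemma uniform_curve_shift:
  assumes w: "uniform_curve T w" and q: "continuous_on {0..T} q" and e: "e > 0"
  obtains d where "d > 0" "\<And>t h. t \<in> {0..T} \<Longrightarrow> \<bar>h\<bar> < d \<Longrightarrow> \<bar>w t (q t + h) - w t (q t)\<bar> < e"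
proof -
  let ?K = "{0..T} \<times> {- 1..1::real}"
  have "continuous_on ?K (\<lambda>p. (fst p, q (fst p) + snd p))"
    by (intro continuous_intros continuous_on_compose2[OF q]) auto
  from continuous_on_compose2[OF uniform_curve_joint_continuous[OF w] this]
  have c: "continuous_on ?K (\<lambda>p. w (fst p) (q (fst p) + snd p))"
    by (simp only: case_prod_conv) (force simp: image_subset_iff)
  have "uniformly_continuous_on ?K (\<lambda>p. w (fst p) (q (fst p) + snd p))"
    by (rule compact_uniformly_continuous[OF c]) (intro compact_Times compact_Icc)
  then obtain d where d: "d > 0" "\<And>p p'. p \<in> ?K \<Longrightarrow> p' \<in> ?K \<Longrightarrow> dist p' p < d \<Longrightarrow>
      dist (w (fst p') (q (fst p') + snd p')) (w (fst p) (q (fst p) + snd p)) < e"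
    unfolding uniformly_continuous_on_def using e by metis
  show thesis
  proof (rule that[of "min d 1"])
    fix t h :: real assume "t \<in> {0..T}" "\<bar>h\<bar> < min d 1"
    then show "\<bar>w t (q t + h) - w t (q t)\<bar> < e"
      using d(2)[of "(t, 0)" "(t, h)"] by (simp add: dist_Pair_Pair dist_real_def abs_less_iff)
  qed (use d in simp)
qed

text \<open>
The integral operator is a contraction on all of \<open>[0,T]\<close> for the weighted norm
\<open>sup exp(- 2 L t) \<bar>q(t) - x\<^sub>0\<bar>\<close>.  The fixed point argument is run for \<open>z(t) = exp(- 2 L t) (q(t) - x\<^sub>0)\<close>, for
which the norm is the ordinary sup norm.
\<close>

lemma global_Picard:
  fixes b :: "real \<Rightarrow> real \<Rightarrow> real"
  assumes T: "0 \<le> T" and L: "L > 0"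
    and cont: "\<And>y. continuous_on {0..T} y \<Longrightarrow> continuous_on {0..T} (\<lambda>t. b t (y t))"
    and lip: "\<And>t x y. t \<in> {0..T} \<Longrightarrow> \<bar>b t x - b t y\<bar> \<le> L * \<bar>x - y\<bar>"
  obtains q where "q 0 = x0" "\<And>t. t \<in> {0..T} \<Longrightarrow> (q has_real_derivative b t (q t)) (at t within {0..T})"
proof -
  define Y where "Y z \<tau> = x0 + exp (2 * L * \<tau>) * apply_bcontfun z \<tau>" for z :: "real \<Rightarrow>\<^sub>C real" and \<tau>
  define G where "G z t = exp (- (2 * L * t)) * integral {0..t} (\<lambda>\<tau>. b \<tau> (Y z \<tau>))" for z t
  have bY: "continuous_on {0..T} (\<lambda>\<tau>. b \<tau> (Y z \<tau>))" for z
    unfolding Y_def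
    by (intro cont continuous_intros continuous_on_apply_bcontfun)
  have int: "(\<lambda>\<tau>. b \<tau> (Y z \<tau>)) integrable_on {0..t}" if "t \<in> {0..T}" for z t
    by (rule integrable_continuous_interval, rule continuous_on_subset[OF bY]) (use that in auto)
  have "continuous_on {0..T} (G z)" for z
    unfolding G_def by (intro continuous_intros indefinite_integral_continuous_1 int) (use T in auto)
  then have "\<exists>g :: real \<Rightarrow>\<^sub>C real. (\<forall>x\<in>{0..T}. g x = G z x) \<and> (\<forall>x. g x = G z (clamp 0 T x))" for z
    using continuous_on_cbox_bcontfunE[of 0 T "G z"] by (metis box_real(2))
  then obtain \<Phi> :: "(real \<Rightarrow>\<^sub>C real) \<Rightarrow> (real \<Rightarrow>\<^sub>C real)" where
    \<Phi>: "\<And>z x. x \<in> {0..T} \<Longrightarrow> \<Phi> z x = G z x" "\<And>z x. \<Phi> z x = G z (clamp 0 T x)"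
    by metis
  have "dist (\<Phi> z) (\<Phi> w) \<le> 1 / 2 * dist z w" for z w
  proof (rule dist_bound)
    fix x
    define t where "t = clamp 0 T x"
    have t: "t \<in> {0..T}" using clamp_in_interval[of 0 T x] T by (simp add: t_def)
    let ?d = "dist z w"
    have le: "norm (b \<tau> (Y z \<tau>) - b \<tau> (Y w \<tau>)) \<le> L * exp (2 * L * \<tau>) * ?d" if "\<tau> \<in> {0..t}" for \<tau>
    proof -
      have "norm (b \<tau> (Y z \<tau>) - b \<tau> (Y w \<tau>)) \<le> L * \<bar>Y z \<tau> - Y w \<tau>\<bar>"
        using lip[of \<tau>] that t by simp
      also have "\<bar>Y z \<tau> - Y w \<tau>\<bar> = exp (2 * L * \<tau>) * dist (z \<tau>) (w \<tau>)"
        unfolding Y_def dist_real_def by (simp add: abs_mult flip: right_diff_distrib)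
      also have "L * \<dots> \<le> L * (exp (2 * L * \<tau>) * ?d)"
        using L by (intro mult_left_mono dist_bounded) auto
      finally show ?thesis by (simp add: mult.assoc)
    qed
    have "((\<lambda>\<tau>. L * exp (2 * L * \<tau>) * ?d) has_integral exp (2 * L * t) / 2 * ?d - exp (2 * L * 0) / 2 * ?d) {0..t}"
      by (rule fundamental_theorem_of_calculus)
         (use t in \<open>auto intro!: derivative_eq_intros simp: has_real_derivative_iff_has_vector_derivative[symmetric]\<close>)
    note bnd = this
    have "norm (integral {0..t} (\<lambda>\<tau>. b \<tau> (Y z \<tau>) - b \<tau> (Y w \<tau>))) \<le> integral {0..t} (\<lambda>\<tau>. L * exp (2 * L * \<tau>) * ?d)"
      by (rule integral_norm_bound_integral[OF integrable_diff[OF int int] has_integral_integrable[OF bnd] le]) (use t in auto)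
    also have "\<dots> = exp (2 * L * t) / 2 * ?d - exp (2 * L * 0) / 2 * ?d" by (rule integral_unique[OF bnd])
    also have "\<dots> \<le> exp (2 * L * t) / 2 * ?d" by simp
    finally have "exp (- (2 * L * t)) * norm (integral {0..t} (\<lambda>\<tau>. b \<tau> (Y z \<tau>) - b \<tau> (Y w \<tau>)))
        \<le> exp (- (2 * L * t)) * (exp (2 * L * t) / 2 * ?d)" by (rule mult_left_mono) simp
    also have "\<dots> = 1 / 2 * ?d" by (simp add: exp_minus)
    also have "exp (- (2 * L * t)) * norm (integral {0..t} (\<lambda>\<tau>. b \<tau> (Y z \<tau>) - b \<tau> (Y w \<tau>))) = dist (G z t) (G w t)"
      unfolding G_def dist_real_def
      unfolding Henstock_Kurzweil_Integration.integral_diff[OF int[OF t] int[OF t]]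
      by (simp add: abs_mult flip: right_diff_distrib)
    finally show "dist (\<Phi> z x) (\<Phi> w x) \<le> 1 / 2 * dist z w"
      unfolding \<Phi>(2) t_def[symmetric] .
  qed
  then have "\<exists>!z. \<Phi> z = z" by (intro banach_fix_type[of "1/2"]) auto
  then obtain z where z: "\<Phi> z = z" by blast
  define q where "q t = x0 + integral {0..t} (\<lambda>\<tau>. b \<tau> (Y z \<tau>))" for t
  have qY: "q t = Y z t" if "t \<in> {0..T}" for t
  proof -
    have "z t = exp (- (2 * L * t)) * integral {0..t} (\<lambda>\<tau>. b \<tau> (Y z \<tau>))"
      using \<Phi>(1)[OF that, of z] by (simp add: z G_def)
    then show ?thesis by (simp add: q_def Y_def exp_minus)
  qed
  show thesis
  proof (rule that)
    show "q 0 = x0" by (simp add: q_def)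
    fix t assume t: "t \<in> {0..T}"
    have "((\<lambda>t. integral {0..t} (\<lambda>\<tau>. b \<tau> (Y z \<tau>))) has_real_derivative b t (Y z t)) (at t within {0..T})"
      by (rule integral_has_real_derivative[OF bY t])
    from DERIV_add[OF DERIV_const this, of x0]
    show "(q has_real_derivative b t (q t)) (at t within {0..T})"
      by (simp only: q_def[abs_def, symmetric] qY[OF t] add_0)
  qed
qed

section \<open>Evolution of the slope along a characteristic\<close>

text \<open>
While \<open>P = A B\<close> is nonnegative, both factors stay above their positive initial values, so \<open>P\<close> has no
first zero.  Then \<open>C = a + \<integral> \<gamma>/2 P\<close> and \<open>D = b + \<integral> \<gamma>/2 P\<close> satisfy \<open>P \<ge> C D\<close>, and by the inequality
between arithmetic and geometric mean \<open>h = \<surd>(C D)\<close> satisfies \<open>h' \<ge> \<gamma>/2 h\<^sup>2\<close>.  Comparing \<open>1/h\<close> at the two ends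
gives \<open>\<gamma>/2 T \<le> 1/h(0)\<close>.
\<close>

lemma riccati_lifespan:
  fixes A B P :: "real \<Rightarrow> real"
  assumes \<gamma>: "\<gamma> > 0" and T: "T > 0" and P: "continuous_on {0..T} P"
    and AB: "\<And>t. t \<in> {0..T} \<Longrightarrow> P t = A t * B t"
    and A: "\<And>t. t \<in> {0..T} \<Longrightarrow> A t \<ge> a + integral {0..t} (\<lambda>\<tau>. \<gamma> / 2 * P \<tau>)"
    and B: "\<And>t. t \<in> {0..T} \<Longrightarrow> B t \<ge> b + integral {0..t} (\<lambda>\<tau>. \<gamma> / 2 * P \<tau>)"
    and ab: "a > 0" "b > 0"
  shows "T \<le> 2 / (\<gamma> * sqrt (a * b))"
proof -
  define I where "I t = integral {0..t} (\<lambda>\<tau>. \<gamma> / 2 * P \<tau>)" for t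
  have cP: "continuous_on {0..T} (\<lambda>\<tau>. \<gamma> / 2 * P \<tau>)" by (intro continuous_intros P)
  have I_nonneg: "I t \<ge> 0" if "t \<in> {0..T}" "\<And>\<tau>. \<tau> \<in> {0..<t} \<Longrightarrow> P \<tau> \<ge> 0" for t
  proof -
    have "(\<lambda>\<tau>. \<gamma> / 2 * P \<tau>) integrable_on {0..t}"
      by (rule integrable_continuous_interval[OF continuous_on_subset[OF cP]]) (use that in auto)
    then have i: "((\<lambda>\<tau>. \<gamma> / 2 * P \<tau>) has_integral I t) {0..t}" unfolding I_def by (rule integrable_integral)
    have "((\<lambda>\<tau>. if \<tau> = t then 0 else \<gamma> / 2 * P \<tau>) has_integral I t) {0..t}"
      by (rule has_integral_spike_finite[of "{t}", OF _ _ i]) auto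
    then show ?thesis
    proof (rule has_integral_nonneg)
      fix \<tau> assume "\<tau> \<in> {0..t}"
      then show "0 \<le> (if \<tau> = t then 0 else \<gamma> / 2 * P \<tau>)" using that(2)[of \<tau>] \<gamma> by simp
    qed
  qed
  have P_pos: "P t > 0" if t: "t \<in> {0..T}" for t
  proof (rule ccontr)
    assume "\<not> P t > 0"
    define Z where "Z = {0..T} \<inter> P -` {..0}"
    have "closed Z" unfolding Z_def by (rule continuous_closed_preimage[OF P]) auto
    then have "compact ({0..T} \<inter> Z)" by (intro compact_Int_closed compact_Icc)
    also have "{0..T} \<inter> Z = Z" by (auto simp: Z_def)
    finally have "compact Z" .
    moreover have "t \<in> Z" using t \<open>\<not> P t > 0\<close> by (simp add: Z_def)
    ultimately obtain t0 where t0: "t0 \<in> Z" "\<And>\<tau>. \<tau> \<in> Z \<Longrightarrow> t0 \<le> \<tau>"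
      using compact_attains_inf[of Z] by (metis empty_iff)
    have t0T: "t0 \<in> {0..T}" "P t0 \<le> 0" using t0 by (auto simp: Z_def)
    have "I t0 \<ge> 0"
    proof (rule I_nonneg[OF t0T(1)])
      fix \<tau> assume "\<tau> \<in> {0..<t0}"
      then have "\<tau> \<notin> Z" "\<tau> \<in> {0..T}" using t0(2)[of \<tau>] t0T(1) by auto
      then show "P \<tau> \<ge> 0" by (simp add: Z_def)
    qed
    then have "A t0 > 0" "B t0 > 0" using A[OF t0T(1)] B[OF t0T(1)] ab unfolding I_def by linarith+
    then show False using AB[OF t0T(1)] t0T(2) by (simp add: mult_le_0_iff)
  qed
  have I0: "I t \<ge> 0" if "t \<in> {0..T}" for t
  proof (rule I_nonneg[OF that])
    fix \<tau> assume "\<tau> \<in> {0..<t}"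
    then have "\<tau> \<in> {0..T}" using that by simp
    then show "P \<tau> \<ge> 0" by (rule less_imp_le[OF P_pos])
  qed
  define C where "C t = a + I t" for t
  define D where "D t = b + I t" for t
  have pos: "C t > 0" "D t > 0" if "t \<in> {0..T}" for t
    using I0[OF that] ab by (simp_all add: C_def D_def)
  define h where "h t = sqrt (C t * D t)" for t
  have h_pos: "h t > 0" if "t \<in> {0..T}" for t using pos[OF that] by (simp add: h_def)
  define h' where "h' t = (\<gamma> / 2 * P t * (C t + D t)) / (2 * h t)" for t
  have I': "(I has_real_derivative \<gamma> / 2 * P t) (at t within {0..T})" if "t \<in> {0..T}" for t
    unfolding I_def by (rule integral_has_real_derivative[OF cP that])
  have hd: "(h has_real_derivative h' t) (at t within {0..T})" if t: "t \<in> {0..T}" for t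
  proof -
    have "((\<lambda>t. C t * D t) has_real_derivative \<gamma> / 2 * P t * (C t + D t)) (at t within {0..T})"
    proof -
      have "(C has_real_derivative \<gamma> / 2 * P t) (at t within {0..T})"
        "(D has_real_derivative \<gamma> / 2 * P t) (at t within {0..T})"
        unfolding C_def D_def by (rule DERIV_cong[OF DERIV_add[OF DERIV_const I'[OF t]]], rule add_0)+
      from DERIV_mult[OF this] show ?thesis by (rule DERIV_cong) (simp add: algebra_simps)
    qed
    then have "((\<lambda>t. sqrt (C t * D t)) has_real_derivative inverse (sqrt (C t * D t)) / 2 * (\<gamma> / 2 * P t * (C t + D t))) (at t within {0..T})"
      by (rule DERIV_chain2[where f = sqrt, OF DERIV_real_sqrt, rotated]) (rule mult_pos_pos[OF pos[OF t]])
    then show ?thesis unfolding h_def h'_def by (rule DERIV_cong) (simp only: divide_inverse inverse_mult_distrib mult_ac)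
  qed
  have h'_ge: "h' t \<ge> \<gamma> / 2 * (h t)\<^sup>2" if t: "t \<in> {0..T}" for t
  proof -
    have CD: "C t * D t \<le> P t"
      unfolding AB[OF t]
    proof (rule mult_mono)
      show "C t \<le> A t" "D t \<le> B t" using A[OF t] B[OF t] by (simp_all add: C_def D_def I_def)
      then show "0 \<le> A t" "0 \<le> D t" using pos[OF t] by simp_all
    qed
    have h2: "(h t)\<^sup>2 = C t * D t" using pos[OF t] by (simp add: h_def)
    have "2 * h t \<le> C t + D t"
      using arith_geo_mean_sqrt[of "C t" "D t"] pos[OF t] by (simp add: h_def)
    then have "1 \<le> (C t + D t) / (2 * h t)" using h_pos[OF t] by simp
    moreover have "0 \<le> \<gamma> / 2 * P t" using \<gamma> P_pos[OF t] by simp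
    ultimately have "\<gamma> / 2 * P t * 1 \<le> \<gamma> / 2 * P t * ((C t + D t) / (2 * h t))" by (rule mult_left_mono)
    moreover have "\<gamma> / 2 * (h t)\<^sup>2 \<le> \<gamma> / 2 * P t" unfolding h2 using CD \<gamma> by simp
    ultimately show ?thesis by (simp add: h'_def)
  qed
  have inv: "((\<lambda>t. - inverse (h t)) has_derivative (\<lambda>x. h' t / (h t)\<^sup>2 * x)) (at t within {0..T})" if t: "t \<in> {0..T}" for t
  proof -
    have "((\<lambda>t. - inverse (h t)) has_real_derivative - (- (inverse (h t) * h' t * inverse (h t)))) (at t within {0..T})"
      by (intro DERIV_minus DERIV_inverse'[OF hd[OF t]]) (use h_pos[OF t] in simp)
    moreover have "- (- (inverse (h t) * h' t * inverse (h t))) = h' t / (h t)\<^sup>2"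
      by (simp add: power2_eq_square field_simps)
    ultimately show ?thesis by (simp only: has_field_derivative_def)
  qed
  from mvt_simple[OF T inv]
  obtain t where t: "t \<in> {0<..<T}" "- inverse (h T) - - inverse (h 0) = h' t / (h t)\<^sup>2 * (T - 0)"
    by auto
  have tT: "t \<in> {0..T}" using t by simp
  have "\<gamma> / 2 \<le> h' t / (h t)\<^sup>2" using h'_ge[OF tT] h_pos[OF tT] by (simp add: pos_le_divide_eq)
  then have "\<gamma> / 2 * T \<le> h' t / (h t)\<^sup>2 * T" using T by (intro mult_right_mono) auto
  moreover have "inverse (h T) > 0" using h_pos[of T] T by simp
  moreover have "h' t / (h t)\<^sup>2 * T = inverse (h 0) - inverse (h T)" using t(2) by simp
  ultimately have "\<gamma> / 2 * T \<le> inverse (h 0)" by linarith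
  moreover have "h 0 = sqrt (a * b)" by (simp add: h_def C_def D_def I_def)
  ultimately have "T * (\<gamma> / 2) \<le> 1 / sqrt (a * b)"
    unfolding inverse_eq_divide using mult.commute[of T "\<gamma> / 2"] by (simp only:)
  then have "T \<le> 1 / sqrt (a * b) / (\<gamma> / 2)" using \<gamma> by (simp only: pos_le_divide_eq half_gt_zero)
  then show ?thesis by (simp add: mult.commute)
qed

lemma uniform_limit_along:
  fixes l :: "real \<Rightarrow> real"
  assumes W: "uniform_limit UNIV W l F" and l: "isCont l a" and q: "(q \<longlongrightarrow> a) F"
  shows "((\<lambda>\<tau>. W \<tau> (q \<tau>)) \<longlongrightarrow> l a) F"
proof -
  have "((\<lambda>\<tau>. W \<tau> (q \<tau>) - l (q \<tau>)) \<longlongrightarrow> 0) F"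
  proof (rule tendstoI)
    fix e :: real assume "e > 0"
    from uniform_limitD[OF W this]
    show "eventually (\<lambda>\<tau>. dist (W \<tau> (q \<tau>) - l (q \<tau>)) 0 < e) F"
      by eventually_elim (simp add: dist_real_def)
  qed
  from tendsto_add[OF this isCont_tendsto_compose[OF l q]] show ?thesis by simp
qed

text \<open>
The square root \<open>\<phi>\<close> may fail to be differentiable, but \<open>\<phi>(a)\<^sup>2 - \<phi>(v)\<^sup>2 = (\<phi>(a) - \<phi>(v)) (\<phi>(a) + \<phi>(v))\<close>
controls the difference quotients of \<open>g\<close>.
\<close>

lemma deriv_bound_of_lipschitz_sqrt:
  fixes g g1 \<phi> :: "real \<Rightarrow> real"
  assumes g: "\<And>y. (g has_real_derivative g1 y) (at y)"
    and eq: "\<And>v. g v - c = \<mu> * (\<phi> v)\<^sup>2" and \<mu>: "\<bar>\<mu>\<bar> = \<gamma>" and \<phi>: "\<And>v. \<phi> v \<ge> 0"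
    and lip: "\<And>a b. \<bar>\<phi> a - \<phi> b\<bar> \<le> K * \<bar>a - b\<bar>"
  shows "\<bar>g1 v\<bar> \<le> 2 * K * \<gamma> * \<phi> v"
proof -
  have "K-lipschitz_on UNIV \<phi>"
    using lip lip[of 1 0] by (intro lipschitz_onI) (auto simp: dist_real_def)
  then have "isCont \<phi> v"
    using lipschitz_on_continuous_on continuous_on_eq_continuous_at[of UNIV \<phi>] by auto
  then have \<phi>v: "(\<phi> \<longlongrightarrow> \<phi> v) (at v)" by (simp add: isCont_def)
  have "((\<lambda>a. \<bar>(g a - g v) / (a - v)\<bar>) \<longlongrightarrow> \<bar>g1 v\<bar>) (at v)"
    using g[of v] by (intro tendsto_rabs) (simp add: has_field_derivative_iff)
  moreover have "((\<lambda>a. \<gamma> * K * (\<phi> a + \<phi> v)) \<longlongrightarrow> \<gamma> * K * (\<phi> v + \<phi> v)) (at v)"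
    by (intro tendsto_intros \<phi>v)
  moreover have "eventually (\<lambda>a. \<bar>(g a - g v) / (a - v)\<bar> \<le> \<gamma> * K * (\<phi> a + \<phi> v)) (at v)"
    unfolding eventually_at_filter
  proof (rule always_eventually, intro allI impI)
    fix a :: real assume a: "a \<noteq> v"
    have "g a - g v = \<mu> * ((\<phi> a - \<phi> v) * (\<phi> a + \<phi> v))"
      using eq[of a] eq[of v] by (simp add: power2_eq_square algebra_simps)
    then have "\<bar>g a - g v\<bar> = \<gamma> * (\<bar>\<phi> a - \<phi> v\<bar> * (\<phi> a + \<phi> v))"
      using \<phi>[of a] \<phi>[of v] by (simp add: abs_mult \<mu>)
    also have "\<dots> \<le> \<gamma> * ((K * \<bar>a - v\<bar>) * (\<phi> a + \<phi> v))"
      using \<phi>[of a] \<phi>[of v] \<mu> by (intro mult_left_mono mult_right_mono lip) auto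
    finally show "\<bar>(g a - g v) / (a - v)\<bar> \<le> \<gamma> * K * (\<phi> a + \<phi> v)"
      using a by (simp add: abs_divide pos_divide_le_eq mult_ac)
  qed
  ultimately have "\<bar>g1 v\<bar> \<le> \<gamma> * K * (\<phi> v + \<phi> v)" by (intro tendsto_le[OF trivial_limit_at])
  then show ?thesis by (simp add: mult_ac)
qed

definition rod_source :: "(real \<Rightarrow> real) \<Rightarrow> (real \<Rightarrow> real) \<Rightarrow> (real \<Rightarrow> real \<Rightarrow> real) \<Rightarrow> (real \<Rightarrow> real \<Rightarrow> real) \<Rightarrow> real \<Rightarrow> real \<Rightarrow> real" where
  "rod_source g f2 u ux t x = g (u t x) + f2 (u t x) / 2 * (ux t x)\<^sup>2"

text \<open>
What is needed of a solution on a closed time interval \<open>[0,T]\<close>: \<open>u\<close> and its slope are continuous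
curves for the sup norm, and the equation holds classically with difference quotients in time that converge
uniformly in \<open>x\<close>.  The functions \<open>f1\<close>, \<open>f2\<close> stand for \<open>f'\<close>, \<open>f''\<close>, and \<open>g1\<close> for \<open>g'\<close>.
\<close>

locale rod_strip =
  fixes f1 f2 g g1 :: "real \<Rightarrow> real" and T :: real and u ux :: "real \<Rightarrow> real \<Rightarrow> real"
  assumes T: "0 < T"
    and f1: "\<And>y. (f1 has_real_derivative f2 y) (at y)" and f2: "continuous_on UNIV f2"
    and g: "\<And>y. (g has_real_derivative g1 y) (at y)"
    and u: "uniform_curve T u" and ux: "uniform_curve T ux"
    and u_x: "\<And>t x. t \<in> {0..T} \<Longrightarrow> (u t has_real_derivative ux t x) (at x)"
    and u_t: "\<And>t. t \<in> {0..T} \<Longrightarrow> uniform_limit UNIV (\<lambda>\<tau> x. (u \<tau> x - u t x) / (\<tau> - t))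
        (\<lambda>x. - (f1 (u t x) * ux t x + (right_avg (rod_source g f2 u ux t) x - left_avg (rod_source g f2 u ux t) x)))
        (at t within {0..T})"
begin

abbreviation "F \<equiv> rod_source g f2 u ux"
abbreviation "L t \<equiv> left_avg (F t)"
abbreviation "R t \<equiv> right_avg (F t)"

lemma cont_f1: "continuous_on UNIV f1" and cont_g: "continuous_on UNIV g"
  using f1 g by (auto intro: DERIV_continuous_on has_field_derivative_at_within)

lemma source_curve: "uniform_curve T F"
proof -
  have "uniform_curve T (\<lambda>t x. g (u t x) + f2 (u t x) / 2 * (ux t x)\<^sup>2)"
    by (intro uniform_curve_add uniform_curve_mult uniform_curve_compose[OF _ u] uniform_curve_compose[OF _ ux] cont_g)
       (auto intro!: continuous_intros f2)
  then show ?thesis by (simp add: rod_source_def[abs_def])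
qed

lemma source_bounded:
  obtains M where "\<And>t x. t \<in> {0..T} \<Longrightarrow> \<bar>F t x\<bar> \<le> M"
  using uniform_curve_bounded[OF source_curve] by blast

lemmas source_continuous = uniform_curve_continuous[OF source_curve]
lemmas L_curve = uniform_curve_left_avg[OF source_curve]
lemmas R_curve = uniform_curve_right_avg[OF source_curve]

lemma R_minus_L_derivative:
  assumes t: "t \<in> {0..T}"
  shows "((\<lambda>x. R t x - L t x) has_real_derivative L t x + R t x - F t x) (at x)"
proof -
  obtain M where M: "\<And>t x. t \<in> {0..T} \<Longrightarrow> \<bar>F t x\<bar> \<le> M" using source_bounded by blast
  have "((\<lambda>x. R t x - L t x) has_real_derivative (R t x - F t x / 2) - (F t x / 2 - L t x)) (at x)"
    by (intro DERIV_diff left_avg_has_derivative[OF source_continuous[OF t] M[OF t]]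
        right_avg_has_derivative[OF source_continuous[OF t] M[OF t]])
  then show ?thesis by (simp add: algebra_simps)
qed

text \<open>
The increment of \<open>u(t,q(t))\<close> is split into a change of time at the new position and a change of
position at the old time.  The first needs the convergence of the difference quotients to be uniform in \<open>x\<close>,
since the position moves along.
\<close>

lemma total_derivative:
  assumes t: "t \<in> {0..T}" and q: "(q has_real_derivative q') (at t within {0..T})"
  shows "((\<lambda>\<tau>. u \<tau> (q \<tau>)) has_real_derivative
      ux t (q t) * q' - (f1 (u t (q t)) * ux t (q t) + (R t (q t) - L t (q t)))) (at t within {0..T})"
proof -
  define ut where "ut x = - (f1 (u t x) * ux t x + (R t x - L t x))" for x
  have cut: "isCont ut a" for a
  proof -
    have "continuous_on UNIV ut"
      unfolding ut_def
      by (intro continuous_intros uniform_curve_continuous[OF u t] uniform_curve_continuous[OF ux t]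
          uniform_curve_continuous[OF L_curve t] uniform_curve_continuous[OF R_curve t] continuous_on_compose2[OF cont_f1]) auto
    then show ?thesis by (simp add: continuous_on_eq_continuous_at)
  qed
  have "(q \<longlongrightarrow> q t) (at t within {0..T})"
    using DERIV_continuous[OF q] by (simp add: continuous_within)
  then have 1: "((\<lambda>\<tau>. (u \<tau> (q \<tau>) - u t (q \<tau>)) / (\<tau> - t)) \<longlongrightarrow> ut (q t)) (at t within {0..T})"
    using uniform_limit_along[OF u_t[OF t, folded ut_def] cut] by simp
  have "((\<lambda>\<tau>. u t (q \<tau>)) has_real_derivative ux t (q t) * q') (at t within {0..T})"
    by (rule DERIV_chain2[OF u_x[OF t] q])
  then have 2: "((\<lambda>\<tau>. (u t (q \<tau>) - u t (q t)) / (\<tau> - t)) \<longlongrightarrow> ux t (q t) * q') (at t within {0..T})"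
    by (simp add: has_field_derivative_iff)
  have "((\<lambda>\<tau>. (u \<tau> (q \<tau>) - u t (q \<tau>)) / (\<tau> - t) + (u t (q \<tau>) - u t (q t)) / (\<tau> - t)) \<longlongrightarrow> ut (q t) + ux t (q t) * q') (at t within {0..T})"
    by (rule tendsto_add[OF 1 2])
  then have "((\<lambda>\<tau>. u \<tau> (q \<tau>)) has_real_derivative ut (q t) + ux t (q t) * q') (at t within {0..T})"
    by (simp add: has_field_derivative_iff flip: add_divide_distrib)
  then show ?thesis by (rule DERIV_cong) (simp add: ut_def)
qed

lemma characteristic_exists:
  obtains q where "q 0 = x0" "\<And>t. t \<in> {0..T} \<Longrightarrow> (q has_real_derivative f1 (u t (q t))) (at t within {0..T})"
proof -
  have "uniform_curve T (\<lambda>t x. f2 (u t x) * ux t x)"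
    by (intro uniform_curve_mult uniform_curve_compose[OF f2 u] ux)
  then obtain M where M: "\<And>t x. t \<in> {0..T} \<Longrightarrow> \<bar>f2 (u t x) * ux t x\<bar> \<le> M"
    using uniform_curve_bounded by blast
  have lip: "\<bar>f1 (u t x) - f1 (u t y)\<bar> \<le> (\<bar>M\<bar> + 1) * \<bar>x - y\<bar>" if t: "t \<in> {0..T}" for t x y
  proof -
    have "norm (f1 (u t x) - f1 (u t y)) \<le> (\<bar>M\<bar> + 1) * norm (x - y)"
    proof (rule field_differentiable_bound[of UNIV "\<lambda>x. f1 (u t x)" "\<lambda>x. f2 (u t x) * ux t x"])
      show "((\<lambda>x. f1 (u t x)) has_real_derivative f2 (u t z) * ux t z) (at z within UNIV)" for z
        by (rule DERIV_chain2[OF f1 u_x[OF t]])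
      show "norm (f2 (u t z) * ux t z) \<le> \<bar>M\<bar> + 1" for z using M[OF t, of z] by simp
    qed auto
    then show ?thesis by simp
  qed
  have cont: "continuous_on {0..T} (\<lambda>t. f1 (u t (y t)))" if "continuous_on {0..T} y" for y
    by (rule uniform_curve_along[OF uniform_curve_compose[OF cont_f1 u] that])
  show thesis
    by (rule global_Picard[of T "\<bar>M\<bar> + 1" "\<lambda>t x. f1 (u t x)" x0]) (use T lip cont that in auto)
qed

text \<open>
The quotient \<open>f n t\<close> over the step \<open>h n\<close> is differentiable in time because \<open>t \<mapsto> q(t) + h\<close> is again a curve to
which \<open>total_derivative\<close> applies (it is not a characteristic, which produces the term with the
difference of \<open>f1\<close>).  By the mean value theorem its derivative involves only \<open>W1\<close>, \<open>W2\<close> and \<open>ux\<close> at points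
within \<open>h n\<close> of \<open>q(t)\<close>, so it converges uniformly in \<open>t\<close>, and the limit \<open>u\<^sub>x(t,q(t))\<close> is differentiable.
\<close>

lemma slope_equation:
  assumes q: "\<And>t. t \<in> {0..T} \<Longrightarrow> (q has_real_derivative f1 (u t (q t))) (at t within {0..T})"
    and t: "t \<in> {0..T}"
  shows "((\<lambda>t. ux t (q t)) has_real_derivative
      g (u t (q t)) - f2 (u t (q t)) / 2 * (ux t (q t))\<^sup>2 - L t (q t) - R t (q t)) (at t within {0..T})"
proof -
  define W1 where "W1 t x = L t x + R t x - F t x" for t x
  define W2 where "W2 t x = f2 (u t x) * ux t x" for t x
  have W1: "uniform_curve T W1" unfolding W1_def
    by (intro uniform_curve_diff uniform_curve_add L_curve R_curve source_curve)
  have W2: "uniform_curve T W2" unfolding W2_def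
    by (intro uniform_curve_mult uniform_curve_compose[OF f2 u] ux)
  have cq: "continuous_on {0..T} q" by (rule DERIV_continuous_on[OF q])
  define h where "h n = 1 / real (Suc n)" for n
  have h: "h n > 0" for n by (simp add: h_def)
  have h0: "h \<longlonglongrightarrow> 0" unfolding h_def by (rule LIMSEQ_Suc[OF lim_1_over_n])
  define f where "f n t = (u t (q t + h n) - u t (q t)) / h n" for n t
  define f' where "f' n t = (- (R t (q t + h n) - L t (q t + h n) - (R t (q t) - L t (q t)))
      - (f1 (u t (q t + h n)) - f1 (u t (q t))) * ux t (q t + h n)) / h n" for n t
  define m' where "m' t = - W1 t (q t) - W2 t (q t) * ux t (q t)" for t
  have df: "(f n has_real_derivative f' n t) (at t within {0..T})" if t: "t \<in> {0..T}" for n t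
  proof -
    have "((\<lambda>t. q t + h n) has_real_derivative f1 (u t (q t))) (at t within {0..T})"
      using DERIV_add[OF q[OF t] DERIV_const[of "h n"]] by simp
    from DERIV_cdivide[OF DERIV_diff[OF total_derivative[OF t this] total_derivative[OF t q[OF t]]], of "h n"]
    show ?thesis unfolding f_def f'_def by (rule DERIV_cong) (simp add: algebra_simps)
  qed
  have ux_bound: "\<exists>M. \<forall>t\<in>{0..T}. \<forall>x. \<bar>ux t x\<bar> \<le> M \<and> \<bar>W2 t x\<bar> \<le> M"
  proof -
    obtain M N where "\<And>t x. t \<in> {0..T} \<Longrightarrow> \<bar>ux t x\<bar> \<le> M" "\<And>t x. t \<in> {0..T} \<Longrightarrow> \<bar>W2 t x\<bar> \<le> N"
      using uniform_curve_bounded[OF ux] uniform_curve_bounded[OF W2] by metis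
    then show ?thesis by (intro exI[of _ "max M N"]) (simp add: le_max_iff_disj)
  qed
  then obtain M where M: "\<And>t x. t \<in> {0..T} \<Longrightarrow> \<bar>ux t x\<bar> \<le> M" "\<And>t x. t \<in> {0..T} \<Longrightarrow> \<bar>W2 t x\<bar> \<le> M"
    by blast
  have M0: "M \<ge> 0" using M(1)[OF t, of 0] by linarith
  have close: "eventually (\<lambda>n. \<forall>t\<in>{0..T}. \<bar>f' n t - m' t\<bar> \<le> e) sequentially" if e: "e > 0" for e
  proof -
    \<comment> \<open>an error \<open>e1\<close> in each of \<open>W1\<close>, \<open>W2\<close>, \<open>ux\<close> costs at most \<open>e1 + e1 * M + M * e1\<close> in \<open>m'\<close>\<close>
    define e1 where "e1 = e / (2 * M + 1)"
    have e1: "e1 > 0" using e M0 by (simp add: e1_def)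
    have e1e: "e1 * (2 * M + 1) = e" using M0 by (simp add: e1_def)
    obtain d1 where d1: "d1 > 0" "\<And>t h. t \<in> {0..T} \<Longrightarrow> \<bar>h\<bar> < d1 \<Longrightarrow> \<bar>W1 t (q t + h) - W1 t (q t)\<bar> < e1"
      using uniform_curve_shift[OF W1 cq e1] by blast
    obtain d2 where d2: "d2 > 0" "\<And>t h. t \<in> {0..T} \<Longrightarrow> \<bar>h\<bar> < d2 \<Longrightarrow> \<bar>W2 t (q t + h) - W2 t (q t)\<bar> < e1"
      using uniform_curve_shift[OF W2 cq e1] by blast
    obtain d3 where d3: "d3 > 0" "\<And>t h. t \<in> {0..T} \<Longrightarrow> \<bar>h\<bar> < d3 \<Longrightarrow> \<bar>ux t (q t + h) - ux t (q t)\<bar> < e1"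
      using uniform_curve_shift[OF ux cq e1] by blast
    have "eventually (\<lambda>n. h n < min d1 (min d2 d3)) sequentially"
      by (rule order_tendstoD(2)[OF h0]) (use d1 d2 d3 in simp)
    then show ?thesis
    proof eventually_elim
      case (elim n)
      show ?case
      proof
        fix t assume t: "t \<in> {0..T}"
        obtain z1 where z1: "q t < z1" "z1 < q t + h n"
          "R t (q t + h n) - L t (q t + h n) - (R t (q t) - L t (q t)) = (q t + h n - q t) * W1 t z1"
          using MVT2[of "q t" "q t + h n" "\<lambda>x. R t x - L t x" "W1 t"] R_minus_L_derivative[OF t] h[of n]
          unfolding W1_def by auto
        obtain z2 where z2: "q t < z2" "z2 < q t + h n"
          "f1 (u t (q t + h n)) - f1 (u t (q t)) = (q t + h n - q t) * W2 t z2"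
          using MVT2[of "q t" "q t + h n" "\<lambda>x. f1 (u t x)" "W2 t"] DERIV_chain2[OF f1 u_x[OF t]] h[of n]
          unfolding W2_def by auto
        have eq: "f' n t = - W1 t z1 - W2 t z2 * ux t (q t + h n)"
          unfolding f'_def z1(3) z2(3) using h[of n] by (simp add: field_simps)
        have b1: "\<bar>W1 t z1 - W1 t (q t)\<bar> < e1" using d1(2)[OF t, of "z1 - q t"] z1 elim by simp
        have b2: "\<bar>W2 t z2 - W2 t (q t)\<bar> < e1" using d2(2)[OF t, of "z2 - q t"] z2 elim by simp
        have b3: "\<bar>ux t (q t + h n) - ux t (q t)\<bar> < e1" using d3(2)[OF t, of "h n"] h[of n] elim by simp
        have "\<bar>(W2 t z2 - W2 t (q t)) * ux t (q t + h n)\<bar> \<le> e1 * M"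
          unfolding abs_mult using b2 M(1)[OF t, of "q t + h n"] by (intro mult_mono) auto
        moreover have "\<bar>W2 t (q t) * (ux t (q t + h n) - ux t (q t))\<bar> \<le> M * e1"
          unfolding abs_mult using b3 M(2)[OF t, of "q t"] M0 by (intro mult_mono) auto
        moreover have "f' n t - m' t = - (W1 t z1 - W1 t (q t)) - (W2 t z2 - W2 t (q t)) * ux t (q t + h n)
            - W2 t (q t) * (ux t (q t + h n) - ux t (q t))"
          unfolding eq m'_def by (simp add: algebra_simps)
        ultimately have "\<bar>f' n t - m' t\<bar> \<le> e1 + e1 * M + M * e1" using b1 by linarith
        also have "\<dots> = e" using e1e by (simp add: algebra_simps)
        finally show "\<bar>f' n t - m' t\<bar> \<le> e" .
      qed
    qed
  qed
  have lim: "(\<lambda>n. f n t) \<longlonglongrightarrow> ux t (q t)" if t: "t \<in> {0..T}" for t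
  proof -
    have "((\<lambda>h. (u t (q t + h) - u t (q t)) / h) \<longlongrightarrow> ux t (q t)) (at 0)"
      using u_x[OF t, of "q t"] by (simp add: DERIV_def)
    then show ?thesis
      unfolding f_def using h h0 by (auto simp: tendsto_at_iff_sequentially comp_def less_imp_neq[THEN not_sym])
  qed
  have "\<exists>k. \<forall>x\<in>{0..T}. (\<lambda>n. f n x) \<longlonglongrightarrow> k x \<and> (k has_derivative (\<lambda>y. m' x * y)) (at x within {0..T})"
  proof (rule has_derivative_sequence[where f = f and f' = "\<lambda>n x y. f' n x * y" and g' = "\<lambda>x y. m' x * y" and S = "{0..T}"])
    show "t \<in> {0..T}" by (rule t)
    show "(\<lambda>n. f n t) \<longlonglongrightarrow> ux t (q t)" by (rule lim[OF t])
    show "(f n has_derivative (\<lambda>y. f' n x * y)) (at x within {0..T})" if "x \<in> {0..T}" for n x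
      using df[OF that] by (simp add: has_field_derivative_def)
    show "eventually (\<lambda>n. \<forall>x\<in>{0..T}. \<forall>y. norm (f' n x * y - m' x * y) \<le> e * norm y) sequentially" if "e > 0" for e
      using close[OF that] by eventually_elim (auto simp: abs_mult mult_right_mono simp flip: left_diff_distrib)
  qed simp
  then obtain k where k: "\<And>x. x \<in> {0..T} \<Longrightarrow> (\<lambda>n. f n x) \<longlonglongrightarrow> k x"
    "\<And>x. x \<in> {0..T} \<Longrightarrow> (k has_real_derivative m' x) (at x within {0..T})"
    unfolding has_field_derivative_def by blast
  have "k x = ux x (q x)" if "x \<in> {0..T}" for x
    by (rule LIMSEQ_unique[OF k(1)[OF that] lim[OF that]])
  then have "((\<lambda>t. ux t (q t)) has_real_derivative m' t) (at t within {0..T})"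
    by (intro has_field_derivative_transform_within[OF k(2)[OF t] zero_less_one t]) auto
  moreover have "m' t = g (u t (q t)) - f2 (u t (q t)) / 2 * (ux t (q t))\<^sup>2 - L t (q t) - R t (q t)"
    by (simp add: m'_def W1_def W2_def rod_source_def power2_eq_square algebra_simps)
  ultimately show ?thesis by simp
qed

text \<open>
The sign \<open>\<sigma>\<close> covers minima and maxima of \<open>g\<close> at once; \<open>\<kappa> = 1 + \<sigma> \<alpha> K\<close>.  The equation for \<open>\<alpha>\<close> serves twice:
\<open>\<alpha> \<kappa> = 2 K\<close> lets the arithmetic--geometric mean inequality absorb the cross term \<open>2 K \<phi> \<bar>u\<^sub>x\<bar>\<close> without loss in
\<open>source_ge\<close>, and it turns the loss \<open>w - w/\<kappa>\<close> into \<open>\<gamma>/2 \<alpha>\<^sup>2 \<phi>\<^sup>2\<close>, which completes the Riccati term \<open>P\<close> in \<open>key\<close>.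
\<close>

lemma blowup_time:
  fixes \<gamma> \<sigma> K \<alpha> c x0 :: real and \<phi> :: "real \<Rightarrow> real"
  assumes \<gamma>: "\<gamma> > 0" and f2_ge: "\<And>y. f2 y \<ge> \<gamma>" and \<sigma>: "\<sigma>\<^sup>2 = 1"
    and \<phi>: "\<And>v. \<phi> v \<ge> 0" "\<And>v. g v - c = \<sigma> * \<gamma> * (\<phi> v)\<^sup>2"
    and lip: "\<And>a b. \<bar>\<phi> a - \<phi> b\<bar> \<le> K * \<bar>a - b\<bar>"
    and \<alpha>: "\<alpha> \<ge> 0" "\<alpha> * K \<le> 1" "1 + \<sigma> * \<alpha> * K > 0" "\<alpha> * (1 + \<sigma> * \<alpha> * K) = 2 * K"
    and x0: "ux 0 x0 < - \<alpha> * \<phi> (u 0 x0)"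
  shows "T \<le> 2 / (\<gamma> * sqrt ((ux 0 x0)\<^sup>2 - \<alpha>\<^sup>2 * (\<phi> (u 0 x0))\<^sup>2))"
proof -
  define \<kappa> where "\<kappa> = 1 + \<sigma> * \<alpha> * K"
  have \<kappa>: "\<kappa> > 0" "\<alpha> * \<kappa> = 2 * K" using \<alpha> by (simp_all add: \<kappa>_def)
  have g1: "\<bar>g1 v\<bar> \<le> 2 * K * \<gamma> * \<phi> v" for v
    by (rule deriv_bound_of_lipschitz_sqrt[OF g \<phi>(2) _ \<phi>(1) lip]) (use \<gamma> \<sigma> in \<open>auto simp: abs_mult power2_eq_1_iff\<close>)
  obtain M where M: "\<And>t x. t \<in> {0..T} \<Longrightarrow> \<bar>F t x\<bar> \<le> M" using source_bounded by blast
  have "uniform_curve T (\<lambda>t x. g (u t x) - c)"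
    by (rule uniform_curve_compose[OF _ u]) (intro continuous_intros cont_g)
  then obtain B where B: "\<And>t x. t \<in> {0..T} \<Longrightarrow> \<bar>g (u t x) - c\<bar> \<le> B" using uniform_curve_bounded by blast
  have source_ge: "g (u t x) - c + \<bar>g1 (u t x) * ux t x\<bar> \<le> \<kappa> * (F t x - c)" for t x
  proof -
    define y p where "y = \<phi> (u t x)" and "p = \<bar>ux t x\<bar>"
    have "\<bar>g1 (u t x) * ux t x\<bar> \<le> (2 * K * \<gamma> * y) * p"
      unfolding abs_mult y_def p_def by (intro mult_right_mono g1) simp
    also have "\<dots> = \<gamma> * \<kappa> * (\<alpha> * y * p)" using \<kappa>(2) by (simp add: algebra_simps)
    also have "\<dots> \<le> \<gamma> * \<kappa> * (((\<alpha> * y)\<^sup>2 + p\<^sup>2) / 2)"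
      using sum_squares_bound[of "\<alpha> * y" p] \<gamma> \<kappa> by (intro mult_left_mono) auto
    also have "\<dots> = \<gamma> * (\<alpha> * \<kappa>) * \<alpha> * y\<^sup>2 / 2 + \<kappa> * (\<gamma> / 2 * p\<^sup>2)" by (simp add: power2_eq_square algebra_simps)
    also have "\<dots> \<le> \<gamma> * (\<alpha> * K) * y\<^sup>2 + \<kappa> * (f2 (u t x) / 2 * p\<^sup>2)"
    proof -
      have "\<kappa> * (\<gamma> / 2 * p\<^sup>2) \<le> \<kappa> * (f2 (u t x) / 2 * p\<^sup>2)"
        using \<kappa> f2_ge by (intro mult_left_mono mult_right_mono divide_right_mono) auto
      then show ?thesis unfolding \<kappa>(2) by (simp add: algebra_simps)
    qed
    finally have "g (u t x) - c + \<bar>g1 (u t x) * ux t x\<bar> \<le> \<sigma> * \<gamma> * y\<^sup>2 + \<gamma> * (\<alpha> * K) * y\<^sup>2 + \<kappa> * (f2 (u t x) / 2 * p\<^sup>2)"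
      using \<phi>(2)[of "u t x"] by (simp add: y_def)
    also have "\<sigma> * \<gamma> * y\<^sup>2 + \<gamma> * (\<alpha> * K) * y\<^sup>2 = \<kappa> * (\<sigma> * \<gamma> * y\<^sup>2)"
    proof -
      have "\<kappa> * (\<sigma> * \<gamma> * y\<^sup>2) = \<sigma> * \<gamma> * y\<^sup>2 + \<sigma>\<^sup>2 * (\<gamma> * (\<alpha> * K) * y\<^sup>2)"
        by (simp add: \<kappa>_def power2_eq_square algebra_simps)
      then show ?thesis using \<sigma> by simp
    qed
    also have "\<kappa> * (\<sigma> * \<gamma> * y\<^sup>2) + \<kappa> * (f2 (u t x) / 2 * p\<^sup>2) = \<kappa> * (F t x - c)"
    proof -
      have "F t x - c = \<sigma> * \<gamma> * y\<^sup>2 + f2 (u t x) / 2 * p\<^sup>2"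
        using \<phi>(2)[of "u t x"] by (simp add: rod_source_def y_def p_def)
      then show ?thesis by (simp only: distrib_left)
    qed
    finally show ?thesis .
  qed
  have dw: "((\<lambda>x. g (u t x) - c) has_real_derivative g1 (u t x) * ux t x) (at x)" if "t \<in> {0..T}" for t x
    using DERIV_diff[OF DERIV_chain2[OF g u_x[OF that]] DERIV_const[of c]] by simp
  have L_ge: "g (u t x) - c \<le> 2 * \<kappa> * (L t x - c / 2)" if t: "t \<in> {0..T}" for t x
    by (rule left_avg_lower_bound[OF source_continuous[OF t] M[OF t] dw[OF t] B[OF t]])
       (rule order_trans[OF _ source_ge], simp add: abs_ge_self)
  have R_ge: "g (u t x) - c \<le> 2 * \<kappa> * (R t x - c / 2)" if t: "t \<in> {0..T}" for t x
    by (rule right_avg_lower_bound[OF source_continuous[OF t] M[OF t] dw[OF t] B[OF t]])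
       (rule order_trans[OF _ source_ge], use abs_ge_minus_self[of "g1 (u t _) * ux t _"] in simp)
  obtain q where q0: "q 0 = x0" and q: "\<And>t. t \<in> {0..T} \<Longrightarrow> (q has_real_derivative f1 (u t (q t))) (at t within {0..T})"
    using characteristic_exists by blast
  have cq: "continuous_on {0..T} q" by (rule DERIV_continuous_on[OF q])
  define U m where "U t = u t (q t)" and "m t = ux t (q t)" for t
  define U' where "U' t = L t (q t) - R t (q t)" for t
  define m' where "m' t = g (U t) - f2 (U t) / 2 * (m t)\<^sup>2 - L t (q t) - R t (q t)" for t
  have dU: "(U has_real_derivative U' t) (at t within {0..T})" if t: "t \<in> {0..T}" for t
    unfolding U_def U'_def by (rule DERIV_cong[OF total_derivative[OF t q[OF t]]]) simp
  have dm: "(m has_real_derivative m' t) (at t within {0..T})" if t: "t \<in> {0..T}" for t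
    unfolding U_def m_def m'_def by (rule slope_equation[OF q t])
  have cU': "continuous_on {0..T} U'" unfolding U'_def
    by (intro continuous_on_diff uniform_curve_along[OF L_curve cq] uniform_curve_along[OF R_curve cq])
  have cU: "continuous_on {0..T} U" by (rule DERIV_continuous_on[OF dU])
  have cm: "continuous_on {0..T} m" by (rule DERIV_continuous_on[OF dm])
  have c\<phi>: "continuous_on UNIV \<phi>"
  proof -
    have "K-lipschitz_on UNIV \<phi>"
      using lip lip[of 1 0] by (intro lipschitz_onI) (auto simp: dist_real_def)
    then show ?thesis by (rule lipschitz_on_continuous_on)
  qed
  have c\<phi>U: "continuous_on {0..T} (\<lambda>t. \<phi> (U t))" by (rule continuous_on_compose2[OF c\<phi> cU]) simp
  define P where "P t = (m t)\<^sup>2 - \<alpha>\<^sup>2 * (\<phi> (U t))\<^sup>2" for t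
  have cP: "continuous_on {0..T} P" unfolding P_def by (intro continuous_intros cm c\<phi>U)
  have key: "\<gamma> / 2 * P t \<le> - \<alpha> * K * \<bar>U' t\<bar> - m' t" if t: "t \<in> {0..T}" for t
  proof -
    define l r y where "l = L t (q t) - c / 2" and "r = R t (q t) - c / 2" and "y = \<phi> (U t)"
    define w where "w = \<sigma> * \<gamma> * y\<^sup>2"
    have gU: "g (U t) = c + w" using \<phi>(2)[of "U t"] by (simp add: w_def y_def)
    have lr: "w / \<kappa> \<le> 2 * l" "w / \<kappa> \<le> 2 * r"
      using L_ge[OF t, of "q t"] R_ge[OF t, of "q t"] \<kappa>(1) gU
      by (simp_all add: l_def r_def U_def[symmetric] pos_divide_le_eq mult_ac)
    have "w / \<kappa> \<le> l + r - \<bar>l - r\<bar>" using lr by linarith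
    also have "\<dots> \<le> l + r - \<alpha> * K * \<bar>l - r\<bar>"
      using mult_right_mono[OF \<alpha>(2), of "\<bar>l - r\<bar>"] by simp
    finally have "w / \<kappa> \<le> l + r - \<alpha> * K * \<bar>l - r\<bar>" .
    moreover have "w - w / \<kappa> = \<gamma> / 2 * (\<alpha>\<^sup>2 * y\<^sup>2)"
    proof -
      have "w * \<kappa> - w = \<sigma>\<^sup>2 * (\<gamma> * y\<^sup>2 * (\<alpha> * K))" by (simp add: w_def \<kappa>_def power2_eq_square algebra_simps)
      also have "\<dots> = \<gamma> / 2 * (\<alpha> * y\<^sup>2) * (2 * K)" using \<sigma> by simp
      also have "\<dots> = \<gamma> / 2 * (\<alpha>\<^sup>2 * y\<^sup>2) * \<kappa>" unfolding \<kappa>(2)[symmetric] by (simp add: power2_eq_square)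
      finally show ?thesis using \<kappa>(1) by (simp add: field_simps)
    qed
    moreover have "\<gamma> / 2 * (m t)\<^sup>2 \<le> f2 (U t) / 2 * (m t)\<^sup>2"
      using f2_ge by (intro mult_right_mono divide_right_mono) auto
    moreover have "- \<alpha> * K * \<bar>U' t\<bar> - m' t = f2 (U t) / 2 * (m t)\<^sup>2 - w + (l + r - \<alpha> * K * \<bar>l - r\<bar>)"
      by (simp add: U'_def m'_def gU l_def r_def)
    moreover have "\<gamma> / 2 * P t = \<gamma> / 2 * (m t)\<^sup>2 - \<gamma> / 2 * (\<alpha>\<^sup>2 * y\<^sup>2)"
      by (simp add: P_def y_def right_diff_distrib)
    ultimately show ?thesis by linarith
  qed
  \<comment> \<open>\<open>\<epsilon> = 1\<close> gives the first factor of \<open>P\<close>, \<open>\<epsilon> = -1\<close> the second\<close>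
  have growth: "\<epsilon> * \<alpha> * \<phi> (U t) - m t \<ge> (\<epsilon> * \<alpha> * \<phi> (U 0) - m 0) + integral {0..t} (\<lambda>\<tau>. \<gamma> / 2 * P \<tau>)"
    if t: "t \<in> {0..T}" and \<epsilon>: "\<bar>\<epsilon>\<bar> = 1" for \<epsilon> t
  proof -
    have sub: "{0..t} \<subseteq> {0..T}" and t0: "0 \<le> t" using t by auto
    have iU: "(U' has_integral U t - U 0) {0..t}"
    proof (rule fundamental_theorem_of_calculus[OF t0])
      fix x assume "x \<in> {0..t}"
      then have "x \<in> {0..T}" using sub by blast
      from DERIV_subset[OF dU[OF this] sub]
      show "(U has_vector_derivative U' x) (at x within {0..t})"
        by (simp only: has_real_derivative_iff_has_vector_derivative)
    qed
    have im: "(m' has_integral m t - m 0) {0..t}"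
    proof (rule fundamental_theorem_of_calculus[OF t0])
      fix x assume "x \<in> {0..t}"
      then have "x \<in> {0..T}" using sub by blast
      from DERIV_subset[OF dm[OF this] sub]
      show "(m has_vector_derivative m' x) (at x within {0..t})"
        by (simp only: has_real_derivative_iff_has_vector_derivative)
    qed
    have ia: "(\<lambda>\<tau>. \<bar>U' \<tau>\<bar>) integrable_on {0..t}"
      by (rule integrable_continuous_interval) (intro continuous_intros continuous_on_subset[OF cU' sub])
    have "\<bar>integral {0..t} U'\<bar> \<le> integral {0..t} (\<lambda>\<tau>. \<bar>U' \<tau>\<bar>)"
      unfolding real_norm_def[symmetric]
      by (rule integral_norm_bound_integral[OF has_integral_integrable[OF iU]]) (use ia in simp_all)
    then have Ule: "\<bar>U t - U 0\<bar> \<le> integral {0..t} (\<lambda>\<tau>. \<bar>U' \<tau>\<bar>)"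
      unfolding integral_unique[OF iU] .
    have K0: "K \<ge> 0" using lip[of 1 0] by simp
    have "\<bar>\<epsilon> * \<alpha> * (\<phi> (U t) - \<phi> (U 0))\<bar> = \<alpha> * \<bar>\<phi> (U t) - \<phi> (U 0)\<bar>"
      using \<epsilon> \<alpha>(1) by (simp add: abs_mult)
    also have "\<dots> \<le> \<alpha> * (K * integral {0..t} (\<lambda>\<tau>. \<bar>U' \<tau>\<bar>))"
      by (rule mult_left_mono[OF order_trans[OF lip mult_left_mono[OF Ule K0]] \<alpha>(1)])
    finally have "- (\<alpha> * (K * integral {0..t} (\<lambda>\<tau>. \<bar>U' \<tau>\<bar>))) \<le> \<epsilon> * \<alpha> * (\<phi> (U t) - \<phi> (U 0))"
      by (simp only: abs_le_iff minus_le_iff)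
    then have 1: "\<epsilon> * \<alpha> * \<phi> (U t) - \<epsilon> * \<alpha> * \<phi> (U 0) \<ge> - \<alpha> * K * integral {0..t} (\<lambda>\<tau>. \<bar>U' \<tau>\<bar>)"
      by (simp only: right_diff_distrib mult.assoc mult_minus_left)
    have 2: "((\<lambda>\<tau>. - \<alpha> * K * \<bar>U' \<tau>\<bar> - m' \<tau>) has_integral
        - \<alpha> * K * integral {0..t} (\<lambda>\<tau>. \<bar>U' \<tau>\<bar>) - (m t - m 0)) {0..t}"
      by (intro has_integral_diff has_integral_mult_right integrable_integral ia im)
    have 3: "((\<lambda>\<tau>. \<gamma> / 2 * P \<tau>) has_integral integral {0..t} (\<lambda>\<tau>. \<gamma> / 2 * P \<tau>)) {0..t}"
      by (intro integrable_integral integrable_continuous_interval continuous_intros continuous_on_subset[OF cP sub])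
    have "integral {0..t} (\<lambda>\<tau>. \<gamma> / 2 * P \<tau>) \<le> - \<alpha> * K * integral {0..t} (\<lambda>\<tau>. \<bar>U' \<tau>\<bar>) - (m t - m 0)"
      by (rule has_integral_le[OF 3 2 key]) (use sub in blast)
    then show ?thesis using 1 by linarith
  qed
  have U0: "U 0 = u 0 x0" "m 0 = ux 0 x0" by (simp_all add: U_def m_def q0)
  have "T \<le> 2 / (\<gamma> * sqrt ((\<alpha> * \<phi> (U 0) - m 0) * (- \<alpha> * \<phi> (U 0) - m 0)))"
  proof (rule riccati_lifespan[OF \<gamma> T cP])
    show "P t = (\<alpha> * \<phi> (U t) - m t) * (- \<alpha> * \<phi> (U t) - m t)" for t
      by (simp add: P_def power2_eq_square algebra_simps)
    show "\<alpha> * \<phi> (U t) - m t \<ge> (\<alpha> * \<phi> (U 0) - m 0) + integral {0..t} (\<lambda>\<tau>. \<gamma> / 2 * P \<tau>)" if "t \<in> {0..T}" for t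
      using growth[OF that, of 1] by simp
    show "- \<alpha> * \<phi> (U t) - m t \<ge> (- \<alpha> * \<phi> (U 0) - m 0) + integral {0..t} (\<lambda>\<tau>. \<gamma> / 2 * P \<tau>)" if "t \<in> {0..T}" for t
      using growth[OF that, of "-1"] by simp
    have "0 \<le> \<alpha> * \<phi> (U 0)" using \<alpha>(1) \<phi>(1) by simp
    then show "0 < \<alpha> * \<phi> (U 0) - m 0" "0 < - \<alpha> * \<phi> (U 0) - m 0" using x0 unfolding U0 by simp_all
  qed
  also have "(\<alpha> * \<phi> (U 0) - m 0) * (- \<alpha> * \<phi> (U 0) - m 0) = (m 0)\<^sup>2 - \<alpha>\<^sup>2 * (\<phi> (U 0))\<^sup>2"
    by (simp add: power2_eq_square algebra_simps)
  finally show ?thesis unfolding U0 .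
qed

end

section \<open>Lifespan of solutions\<close>

lemma smoothD:
  assumes "smooth h"
  shows "(h has_real_derivative deriv h x) (at x)"
    and "(deriv h has_real_derivative deriv (deriv h) x) (at x)"
    and "continuous_on UNIV (deriv (deriv h))"
proof -
  have d: "(deriv ^^ n) h differentiable (at y)" for n y using assms by (simp add: smooth_def)
  show "(h has_real_derivative deriv h x) (at x)"
    using d[of 0 x] by (simp add: DERIV_deriv_iff_real_differentiable)
  show "(deriv h has_real_derivative deriv (deriv h) x) (at x)"
    using d[of 1 x] by (simp add: DERIV_deriv_iff_real_differentiable)
  show "continuous_on UNIV (deriv (deriv h))"
    using d[of 2] by (simp add: numeral_2_eq_2 continuous_on_eq_continuous_at differentiable_imp_continuous_within)
qed

text \<open>
The form in which the Sobolev estimates turn convergence in norm into uniform convergence.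
\<close>

lemma uniform_limit_of_norm_bound:
  fixes w :: "real \<Rightarrow> real \<Rightarrow> real"
  assumes N: "(N \<longlongrightarrow> 0) (at t within S)" and sub: "S' \<subseteq> S"
    and bound: "\<And>\<tau> x. \<tau> \<in> S' \<Longrightarrow> \<tau> \<noteq> t \<Longrightarrow> \<bar>w \<tau> x - l x\<bar> \<le> C * N \<tau>"
  shows "uniform_limit UNIV w l (at t within S')"
proof (rule uniform_limitI)
  fix e :: real assume e: "e > 0"
  have "((\<lambda>\<tau>. C * N \<tau>) \<longlongrightarrow> C * 0) (at t within S')"
    by (intro tendsto_intros tendsto_within_subset[OF N sub])
  then have "eventually (\<lambda>\<tau>. C * N \<tau> < e) (at t within S')" using e by (intro order_tendstoD(2)) auto
  moreover have "eventually (\<lambda>\<tau>. \<tau> \<in> S' \<and> \<tau> \<noteq> t) (at t within S')" by (simp add: eventually_at_filter)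
  ultimately show "eventually (\<lambda>\<tau>. \<forall>x\<in>UNIV. dist (w \<tau> x) (l x) < e) (at t within S')"
  proof eventually_elim
    case (elim \<tau>)
    show ?case
    proof
      fix x
      show "dist (w \<tau> x) (l x) < e" using bound[of \<tau> x] elim by (simp add: dist_real_def)
    qed
  qed
qed

text \<open>
The right-hand side of the equation is continuous in \<open>x\<close>, and it is the continuous representative of the
time derivative, which is given only almost everywhere.  As \<open>s - 1 > 1/2\<close>, convergence of the difference
quotients in \<open>H\<^sup>s\<^sup>-\<^sup>1\<close> is then uniform convergence to the right-hand side.
\<close>

lemma rod_solution_imp_rod_strip:
  assumes s: "s > 3 / 2" and f: "smooth f" and g: "smooth g"
    and sol: "rod_solution f g s u0 T' u" and T: "0 < T" "T < T'"
  shows "rod_strip (deriv f) (deriv (deriv f)) g (deriv g) T u (\<lambda>t. deriv (u t))"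
proof -
  have sub: "{0..T} \<subseteq> {0..<T'}" using T by auto
  have s': "s > 1 / 2" "s - 1 > 1 / 2" using s by simp_all
  have cont: "continuous_on UNIV (u t)" if "t \<in> {0..T}" for t
    using sol sub that unfolding rod_solution_def by blast
  have C0: "sobolev_C0 s T' u" using sol unfolding rod_solution_def by blast
  obtain v where C1: "sobolev_C1 (s - 1) T' u v"
    and eq: "\<And>t. t \<in> {0..<T'} \<Longrightarrow> AE x in lborel. v t x + deriv f (u t x) * deriv (u t) x
        + deriv (Defs.convolution kernel_p (\<lambda>y. g (u t y) + deriv (deriv f) (u t y) / 2 * (deriv (u t) y)\<^sup>2)) x = 0"
    using sol unfolding rod_solution_def by blast
  have us: "u t \<in> sobolev_space s" if "t \<in> {0..T}" for t
    using C0 sub that unfolding sobolev_C0_def by blast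
  have us1: "u t \<in> sobolev_space (s - 1)" "v t \<in> sobolev_space (s - 1)" if "t \<in> {0..T}" for t
    using C1 sub that unfolding sobolev_C0_def sobolev_C1_def by blast+
  have N0: "((\<lambda>\<tau>. sobolev_norm s (\<lambda>x. u \<tau> x - u t x)) \<longlongrightarrow> 0) (at t within {0..<T'})" if "t \<in> {0..T}" for t
    using C0 sub that unfolding sobolev_C0_def by blast
  have N1: "((\<lambda>\<tau>. sobolev_norm (s - 1) (\<lambda>x. (u \<tau> x - u t x) / (\<tau> - t) - v t x)) \<longlongrightarrow> 0) (at t within {0..<T'})"
    if "t \<in> {0..T}" for t
    using C1 sub that unfolding sobolev_C1_def by blast
  have diff: "(\<lambda>x. u \<tau> x - u t x) \<in> sobolev_space s" "continuous_on UNIV (\<lambda>x. u \<tau> x - u t x)"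
    if "\<tau> \<in> {0..T}" "t \<in> {0..T}" for \<tau> t
    using sobolev_space_lincomb[OF us us, OF that, of 1 "-1"] by (auto intro!: continuous_intros cont that)
  obtain A where A: "\<And>h k x. h \<in> sobolev_space s \<Longrightarrow> continuous_on UNIV k \<Longrightarrow> AE x in lborel. h x = k x
      \<Longrightarrow> \<bar>k x\<bar> \<le> A * sobolev_norm s h"
    using sobolev_sup_bound[OF s'(1)] by blast
  obtain B where B: "\<And>h k x. h \<in> sobolev_space (s - 1) \<Longrightarrow> continuous_on UNIV k \<Longrightarrow> AE x in lborel. h x = k x
      \<Longrightarrow> \<bar>k x\<bar> \<le> B * sobolev_norm (s - 1) h"
    using sobolev_sup_bound[OF s'(2)] by blast
  obtain D where D: "\<And>h. h \<in> sobolev_space s \<Longrightarrow> continuous_on UNIV h \<Longrightarrow>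
      (\<forall>x. (h has_real_derivative deriv h x) (at x)) \<and> continuous_on UNIV (deriv h) \<and>
      (\<forall>x. \<bar>deriv h x\<bar> \<le> D * sobolev_norm s h)"
    using sobolev_C1_embedding[OF s] by blast
  have du: "(u t has_real_derivative deriv (u t) x) (at x)" if "t \<in> {0..T}" for t x
    using D[OF us[OF that] cont[OF that]] by blast
  have U: "uniform_curve T u"
    unfolding uniform_curve_def
  proof (intro ballI conjI)
    fix t assume t: "t \<in> {0..T}"
    show "continuous_on UNIV (u t)" by (rule cont[OF t])
    show "bounded (range (u t))"
      unfolding bounded_iff using A[OF us[OF t] cont[OF t]] by auto
    show "uniform_limit UNIV u (u t) (at t within {0..T})"
      by (rule uniform_limit_of_norm_bound[OF N0[OF t] sub]) (rule A[OF diff], use t in auto)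
  qed
  have DU: "uniform_curve T (\<lambda>t. deriv (u t))"
    unfolding uniform_curve_def
  proof (intro ballI conjI)
    fix t assume t: "t \<in> {0..T}"
    show "continuous_on UNIV (deriv (u t))" using D[OF us[OF t] cont[OF t]] by blast
    show "bounded (range (deriv (u t)))"
      unfolding bounded_iff using D[OF us[OF t] cont[OF t]] by auto
    show "uniform_limit UNIV (\<lambda>t. deriv (u t)) (deriv (u t)) (at t within {0..T})"
    proof (rule uniform_limit_of_norm_bound[OF N0[OF t] sub])
      fix \<tau> x assume \<tau>: "\<tau> \<in> {0..T}"
      have "deriv (\<lambda>x. u \<tau> x - u t x) x = deriv (u \<tau>) x - deriv (u t) x"
        by (rule DERIV_imp_deriv[OF DERIV_diff[OF du[OF \<tau>] du[OF t]]])
      then show "\<bar>deriv (u \<tau>) x - deriv (u t) x\<bar> \<le> D * sobolev_norm s (\<lambda>x. u \<tau> x - u t x)"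
        using D[OF diff[OF \<tau> t]] by metis
    qed
  qed
  let ?F = "rod_source g (deriv (deriv f)) u (\<lambda>t. deriv (u t))"
  have "continuous_on UNIV (deriv f)" "continuous_on UNIV g"
    by (auto intro: DERIV_continuous_on has_field_derivative_at_within smoothD[OF f] smoothD[OF g])
  have F: "uniform_curve T ?F"
  proof -
    have "uniform_curve T (\<lambda>t x. g (u t x) + deriv (deriv f) (u t x) / 2 * (deriv (u t) x)\<^sup>2)"
      by (intro uniform_curve_add uniform_curve_mult uniform_curve_compose[OF _ U] uniform_curve_compose[OF _ DU])
         (auto intro!: continuous_intros smoothD[OF f] \<open>continuous_on UNIV g\<close>)
    then show ?thesis by (simp add: rod_source_def[abs_def])
  qed
  obtain M where M: "\<And>t x. t \<in> {0..T} \<Longrightarrow> \<bar>?F t x\<bar> \<le> M" using uniform_curve_bounded[OF F] by blast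
  have time: "uniform_limit UNIV (\<lambda>\<tau> x. (u \<tau> x - u t x) / (\<tau> - t))
        (\<lambda>x. - (deriv f (u t x) * deriv (u t) x + (right_avg (?F t) x - left_avg (?F t) x))) (at t within {0..T})"
    if t: "t \<in> {0..T}" for t
  proof (rule uniform_limit_of_norm_bound[OF N1[OF t] sub])
    fix \<tau> x assume \<tau>: "\<tau> \<in> {0..T}" "\<tau> \<noteq> t"
    let ?v = "\<lambda>x. - (deriv f (u t x) * deriv (u t) x + (right_avg (?F t) x - left_avg (?F t) x))"
    have cv: "continuous_on UNIV ?v"
      using uniform_curve_continuous[OF uniform_curve_left_avg[OF F] t] uniform_curve_continuous[OF uniform_curve_right_avg[OF F] t]
        uniform_curve_continuous[OF DU t] uniform_curve_continuous[OF uniform_curve_compose[OF \<open>continuous_on UNIV (deriv f)\<close> U] t]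
      by (intro continuous_intros)
    have conv: "deriv (Defs.convolution kernel_p (?F t)) x = right_avg (?F t) x - left_avg (?F t) x" for x
      by (rule deriv_convolution_kernel_p[OF uniform_curve_continuous[OF F t] M[OF t]])
    have F_eq: "?F t = (\<lambda>y. g (u t y) + deriv (deriv f) (u t y) / 2 * (deriv (u t) y)\<^sup>2)"
      by (simp add: fun_eq_iff rod_source_def)
    have "t \<in> {0..<T'}" using t sub by blast
    from eq[OF this, folded F_eq] have "AE x in lborel. v t x = ?v x"
      unfolding conv by eventually_elim linarith
    then have ae: "AE x in lborel. (u \<tau> x - u t x) / (\<tau> - t) - v t x = (u \<tau> x - u t x) / (\<tau> - t) - ?v x"
      by eventually_elim simp
    have "(\<lambda>x. (1 / (\<tau> - t)) * u \<tau> x + (- 1 / (\<tau> - t)) * u t x) \<in> sobolev_space (s - 1)"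
      by (rule sobolev_space_lincomb[OF us1(1) us1(1), OF \<tau>(1) t])
    from sobolev_space_lincomb[OF this us1(2)[OF t], of 1 "-1"]
    have mem: "(\<lambda>x. (u \<tau> x - u t x) / (\<tau> - t) - v t x) \<in> sobolev_space (s - 1)"
      by (simp add: diff_divide_distrib)
    have "continuous_on UNIV (\<lambda>x. (u \<tau> x - u t x) / (\<tau> - t) - ?v x)"
      using \<tau> by (intro continuous_on_diff[OF _ cv] continuous_on_divide continuous_on_const diff(2) t) auto
    from B[OF mem this ae]
    show "\<bar>(u \<tau> x - u t x) / (\<tau> - t) - ?v x\<bar> \<le> B * sobolev_norm (s - 1) (\<lambda>x. (u \<tau> x - u t x) / (\<tau> - t) - v t x)" .
  qed
  show ?thesis
    by (rule rod_strip.intro) (fact T smoothD[OF f] smoothD(1)[OF g] U DU du time)+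
qed

text \<open>
A solution on \<open>[0,T')\<close> is restricted to \<open>[0,T]\<close> for every \<open>T < T'\<close>, where \<open>blowup_time\<close> applies.
\<close>

lemma max_time_le:
  assumes s: "s > 3 / 2" and f: "smooth f" and g: "smooth g"
    and \<gamma>: "\<gamma> > 0" and convex: "\<And>y. deriv (deriv f) y \<ge> \<gamma>" and \<sigma>: "\<sigma>\<^sup>2 = 1"
    and \<phi>: "\<And>v. \<phi> v \<ge> 0" "\<And>v. g v - c = \<sigma> * \<gamma> * (\<phi> v)\<^sup>2"
    and lip: "K-lipschitz_on UNIV \<phi>"
    and \<alpha>: "\<alpha> \<ge> 0" "\<alpha> * K \<le> 1" "1 + \<sigma> * \<alpha> * K > 0" "\<alpha> * (1 + \<sigma> * \<alpha> * K) = 2 * K"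
    and x0: "deriv u0 x0 < - \<alpha> * \<phi> (u0 x0)"
  shows "max_time f g s u0 \<le> ennreal (2 / (\<gamma> * sqrt ((deriv u0 x0)\<^sup>2 - \<alpha>\<^sup>2 * (\<phi> (u0 x0))\<^sup>2)))"
  unfolding max_time_def
proof (rule SUP_least, elim CollectE conjE exE)
  fix T' u assume T': "0 < T'" and sol: "rod_solution f g s u0 T' u"
  have "u 0 = u0" using sol unfolding rod_solution_def by auto
  have lip': "\<bar>\<phi> a - \<phi> b\<bar> \<le> K * \<bar>a - b\<bar>" for a b
    using lipschitz_onD[OF lip, of a b] by (simp add: dist_real_def)
  have "T' \<le> 2 / (\<gamma> * sqrt ((deriv u0 x0)\<^sup>2 - \<alpha>\<^sup>2 * (\<phi> (u0 x0))\<^sup>2))"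
  proof (rule dense_le_bounded[OF T'])
    fix T assume T: "0 < T" "T < T'"
    interpret rod_strip "deriv f" "deriv (deriv f)" g "deriv g" T u "\<lambda>t. deriv (u t)"
      by (rule rod_solution_imp_rod_strip[OF s f g sol T])
    show "T \<le> 2 / (\<gamma> * sqrt ((deriv u0 x0)\<^sup>2 - \<alpha>\<^sup>2 * (\<phi> (u0 x0))\<^sup>2))"
      using blowup_time[OF \<gamma> convex \<sigma> \<phi> lip' \<alpha>, of x0] x0 unfolding \<open>u 0 = u0\<close> by simp
  qed
  then show "ennreal T' \<le> ennreal (2 / (\<gamma> * sqrt ((deriv u0 x0)\<^sup>2 - \<alpha>\<^sup>2 * (\<phi> (u0 x0))\<^sup>2)))"
    by (rule ennreal_leI)
qed

lemma lifespan_bound_rescale: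
  fixes K \<gamma> d \<beta> y :: real
  assumes "K > 0"
  shows "2 / (\<gamma> * sqrt (d\<^sup>2 - (\<beta> / (2 * K))\<^sup>2 * y\<^sup>2)) = 4 * K / (\<gamma> * sqrt (4 * K\<^sup>2 * d\<^sup>2 - \<beta>\<^sup>2 * y\<^sup>2))"
proof -
  have "4 * K\<^sup>2 * d\<^sup>2 - \<beta>\<^sup>2 * y\<^sup>2 = (2 * K)\<^sup>2 * (d\<^sup>2 - (\<beta> / (2 * K))\<^sup>2 * y\<^sup>2)"
    using assms by (simp add: power_divide power_mult_distrib right_diff_distrib)
  then have "sqrt (4 * K\<^sup>2 * d\<^sup>2 - \<beta>\<^sup>2 * y\<^sup>2) = 2 * K * sqrt (d\<^sup>2 - (\<beta> / (2 * K))\<^sup>2 * y\<^sup>2)"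
    using assms by (simp add: real_sqrt_mult)
  then show ?thesis using assms by simp
qed

text \<open>
With \<open>r = \<surd>(1 + 8 K\<^sup>2)\<close> the root is \<open>\<alpha> = (r - 1)/(2K)\<close>, and \<open>\<alpha> K = (r - 1)/2 \<le> 1\<close> amounts to \<open>K \<le> 1\<close>.  Division
by zero yields \<open>\<alpha> = 0\<close> for \<open>K = 0\<close>, which is the limit value.
\<close>

lemma max_time_le_bound_i:
  assumes s: "s > 3 / 2" and f: "smooth f" and g: "smooth g"
    and \<gamma>: "\<gamma> > 0" and f2: "\<And>y. deriv (deriv f) y \<ge> \<gamma>" and cond: "condition_i g \<gamma> u0 c K x0"
  shows "max_time f g s u0 \<le> ennreal (bound_i g \<gamma> u0 c K x0)"
proof -
  let ?\<phi> = "phi g \<gamma> c"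
  note cond = cond[unfolded condition_i_def]
  have K: "0 \<le> K" "K \<le> 1" using cond by auto
  have \<phi>: "?\<phi> v \<ge> 0" "g v - g c = 1 * \<gamma> * (?\<phi> v)\<^sup>2" for v
    using cond \<gamma> by (simp_all add: phi_def)
  define r where "r = sqrt (1 + 8 * K\<^sup>2)"
  have r2: "r\<^sup>2 = 1 + 8 * K\<^sup>2" by (simp add: r_def add_nonneg_nonneg)
  have r: "1 \<le> r" "r \<le> 3"
  proof -
    show "1 \<le> r" by (simp add: r_def)
    have "K\<^sup>2 \<le> 1" using K by (simp add: power_le_one)
    then have "r\<^sup>2 \<le> 3\<^sup>2" using r2 by simp
    then show "r \<le> 3" by (rule power2_le_imp_le) simp
  qed
  define \<alpha> where "\<alpha> = (r - 1) / (2 * K)"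
  have \<alpha>K: "\<alpha> * K = (r - 1) / 2" if "K \<noteq> 0" using that by (simp add: \<alpha>_def)
  have \<alpha>: "\<alpha> \<ge> 0" "\<alpha> * K \<le> 1" "1 + 1 * \<alpha> * K > 0" "\<alpha> * (1 + 1 * \<alpha> * K) = 2 * K"
  proof -
    show "\<alpha> \<ge> 0" using r K by (simp add: \<alpha>_def)
    show "\<alpha> * K \<le> 1" using r \<alpha>K by (cases "K = 0") auto
    show "1 + 1 * \<alpha> * K > 0" using r \<alpha>K by (cases "K = 0") auto
    show "\<alpha> * (1 + 1 * \<alpha> * K) = 2 * K"
    proof (cases "K = 0")
      case False
      have "\<alpha> * (1 + 1 * \<alpha> * K) = (r - 1) / (2 * K) * (1 + (r - 1) / 2)" by (simp only: mult_1 \<alpha>K[OF False]) (simp only: \<alpha>_def)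
      also have "\<dots> = (r\<^sup>2 - 1) / (4 * K)" using False by (simp add: field_simps power2_eq_square)
      also have "\<dots> = 2 * K" using False unfolding r2 by (simp add: power2_eq_square)
      finally show ?thesis .
    qed (simp add: \<alpha>_def)
  qed
  have x0: "deriv u0 x0 < - \<alpha> * ?\<phi> (u0 x0)"
    using cond by (auto simp: \<alpha>_def r_def split: if_splits)
  have "max_time f g s u0 \<le> ennreal (2 / (\<gamma> * sqrt ((deriv u0 x0)\<^sup>2 - \<alpha>\<^sup>2 * (?\<phi> (u0 x0))\<^sup>2)))"
    by (rule max_time_le[OF s f g \<gamma> f2 _ \<phi> _ \<alpha> x0]) (use cond in auto)
  also have "2 / (\<gamma> * sqrt ((deriv u0 x0)\<^sup>2 - \<alpha>\<^sup>2 * (?\<phi> (u0 x0))\<^sup>2)) = bound_i g \<gamma> u0 c K x0"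
  proof (cases "K = 0")
    case True
    then show ?thesis by (simp add: bound_i_def \<alpha>_def)
  next
    case False
    then have "K > 0" using K by simp
    from lifespan_bound_rescale[OF this, of \<gamma> "deriv u0 x0" "r - 1" "?\<phi> (u0 x0)"]
    show ?thesis using False by (simp add: bound_i_def \<alpha>_def r_def)
  qed
  finally show ?thesis .
qed

text \<open>
Here \<open>r = \<surd>(1 - 8 K\<^sup>2)\<close> is real because \<open>K \<le> 1/\<surd>8\<close>, and \<open>\<alpha> = (1 - r)/(2K)\<close> has \<open>\<alpha> K \<le> 1/2\<close>.
\<close>

lemma max_time_le_bound_ii:
  assumes s: "s > 3 / 2" and f: "smooth f" and g: "smooth g"
    and \<gamma>: "\<gamma> > 0" and f2: "\<And>y. deriv (deriv f) y \<ge> \<gamma>" and cond: "condition_ii g \<gamma> u0 c K x0"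
  shows "max_time f g s u0 \<le> ennreal (bound_ii g \<gamma> u0 c K x0)"
proof -
  let ?\<phi> = "psi g \<gamma> c"
  note cond = cond[unfolded condition_ii_def]
  have K: "0 \<le> K" "K \<le> 1 / sqrt 8" using cond by auto
  have \<phi>: "?\<phi> v \<ge> 0" "g v - g c = - 1 * \<gamma> * (?\<phi> v)\<^sup>2" for v
    using cond \<gamma> by (simp_all add: psi_def)
  have "K\<^sup>2 \<le> (1 / sqrt 8)\<^sup>2" using K by (intro power_mono) auto
  then have K8: "8 * K\<^sup>2 \<le> 1" by (simp add: power_divide)
  define r where "r = sqrt (1 - 8 * K\<^sup>2)"
  have r2: "r\<^sup>2 = 1 - 8 * K\<^sup>2" using K8 by (simp add: r_def)
  have r: "0 \<le> r" "r \<le> 1" using K8 by (simp_all add: r_def)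
  define \<alpha> where "\<alpha> = (1 - r) / (2 * K)"
  have \<alpha>K: "\<alpha> * K = (1 - r) / 2" if "K \<noteq> 0" using that by (simp add: \<alpha>_def)
  have \<alpha>: "\<alpha> \<ge> 0" "\<alpha> * K \<le> 1" "1 + - 1 * \<alpha> * K > 0" "\<alpha> * (1 + - 1 * \<alpha> * K) = 2 * K"
  proof -
    show "\<alpha> \<ge> 0" using r K by (simp add: \<alpha>_def)
    show "\<alpha> * K \<le> 1" using r \<alpha>K by (cases "K = 0") auto
    show "1 + - 1 * \<alpha> * K > 0" using r \<alpha>K by (cases "K = 0") auto
    show "\<alpha> * (1 + - 1 * \<alpha> * K) = 2 * K"
    proof (cases "K = 0")
      case False
      have "\<alpha> * (1 + - 1 * \<alpha> * K) = \<alpha> * (1 - \<alpha> * K)" by simp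
      also have "\<dots> = (1 - r) / (2 * K) * (1 - (1 - r) / 2)" by (simp only: \<alpha>K[OF False]) (simp only: \<alpha>_def)
      also have "\<dots> = (1 - r\<^sup>2) / (4 * K)" using False by (simp add: field_simps power2_eq_square)
      also have "\<dots> = 2 * K" using False unfolding r2 by (simp add: power2_eq_square)
      finally show ?thesis .
    qed (simp add: \<alpha>_def)
  qed
  have x0: "deriv u0 x0 < - \<alpha> * ?\<phi> (u0 x0)"
    using cond by (auto simp: \<alpha>_def r_def split: if_splits)
  have "max_time f g s u0 \<le> ennreal (2 / (\<gamma> * sqrt ((deriv u0 x0)\<^sup>2 - \<alpha>\<^sup>2 * (?\<phi> (u0 x0))\<^sup>2)))"
    by (rule max_time_le[OF s f g \<gamma> f2 _ \<phi> _ \<alpha> x0]) (use cond in auto)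
  also have "2 / (\<gamma> * sqrt ((deriv u0 x0)\<^sup>2 - \<alpha>\<^sup>2 * (?\<phi> (u0 x0))\<^sup>2)) = bound_ii g \<gamma> u0 c K x0"
  proof (cases "K = 0")
    case True
    then show ?thesis by (simp add: bound_ii_def \<alpha>_def)
  next
    case False
    then have "K > 0" using K by simp
    from lifespan_bound_rescale[OF this, of \<gamma> "deriv u0 x0" "1 - r" "?\<phi> (u0 x0)"]
    show ?thesis using False by (simp add: bound_ii_def \<alpha>_def r_def power2_commute[of 1])
  qed
  finally show ?thesis .
qed

theorem theorem1p2:
  fixes s \<gamma> :: real and u0 f g :: "real \<Rightarrow> real"
  assumes "s > 3 / 2"
    and "u0 \<in> sobolev_space s" and "continuous_on UNIV u0"
    and "smooth f" and "smooth g"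
    and "\<gamma> > 0" and "\<forall>x. deriv (deriv f) x \<ge> \<gamma>"
  shows "((\<exists>c K x0. condition_i g \<gamma> u0 c K x0) \<or> (\<exists>c K x0. condition_ii g \<gamma> u0 c K x0)
            \<longrightarrow> max_time f g s u0 < \<infinity>) \<and>
         (\<forall>c K x0. condition_i g \<gamma> u0 c K x0
            \<longrightarrow> max_time f g s u0 \<le> ennreal (bound_i g \<gamma> u0 c K x0)) \<and>
         (\<forall>c K x0. condition_ii g \<gamma> u0 c K x0
            \<longrightarrow> max_time f g s u0 \<le> ennreal (bound_ii g \<gamma> u0 c K x0))"
proof -
  have f2: "\<And>x. deriv (deriv f) x \<ge> \<gamma>" using assms(7) by blast
  note i = max_time_le_bound_i[OF assms(1,4,5,6) f2] and ii = max_time_le_bound_ii[OF assms(1,4,5,6) f2]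
  have "max_time f g s u0 < \<infinity>" if "(\<exists>c K x0. condition_i g \<gamma> u0 c K x0) \<or> (\<exists>c K x0. condition_ii g \<gamma> u0 c K x0)"
    using that by (auto intro: le_less_trans[OF i] le_less_trans[OF ii])
  then show ?thesis using i ii by blast
qed

end
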